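(* Let $n,m$ be natural numbers, let $F(z)$ be an $m\times m$-valued real rational function of a complex variable $z$, and let $R_F$ be an $(n+m)\times(n+m)$ state-space realization of $F$, i.e. $$F(z)=C(zI_n-A)^{-1}B+D,\qquad R_F=\begin{pmatrix}A&B\\ C&D\end{pmatrix},$$ with $A$ of size $n\times n$, $B$ of size $n\times m$, $C$ of size $m\times n$ and $D$ of size $m\times m$. For a positive definite matrix $P\in\mathbf{P}_n$, define the $2(n+m)\times 2(n+m)$ matrices (block sizes $n,m,n,m$) $$W_{\alpha}=\begin{pmatrix}0&0&-P&0\\0&0&0&I_m\\-P&0&0&0\\0&I_m&0&0\end{pmatrix},\qquad W_{\beta}=\begin{pmatrix}0&0&-P&0\\0&-I_m&0&0\\-P&0&0&0\\0&0&0&I_m\end{pmatrix},$$ $$W_{\gamma}=\begin{pmatrix}-P&0&0&0\\0&0&0&I_m\\0&0&P&0\\0&I_m&0&0\end{pmatrix},\qquad W_{\delta}=\begin{pmatrix}-P&0&0&0\\0&-I_m&0&0\\0&0&P&0\\0&0&0&I_m\end{pmatrix}.$$ For $l\in\{\alpha,\beta,\gamma,\delta\}$ consider the condition $$(\ast_l)\qquad \text{there exists } P\in\mathbf{P}_n \text{ such that}\quad \begin{pmatrix}R_F\\ I_{n+m}\end{pmatrix}^*W_l\begin{pmatrix}R_F\\ I_{n+m}\end{pmatrix}\in\overline{\mathbf{P}}_{n+m}.$$ (I) The following hold. ($\alpha$) If $(\ast_\alpha)$ holds, then $F\in\mathcal{P}$ (Positive-Real). ($\beta$) If $(\ast_\beta)$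 holds, then $F\in\mathcal{B}$ (Bounded-Real). ($\gamma$) If $(\ast_\gamma)$ holds, then $F\in\mathcal{DP}$ (Discrete-Time-Positive-Real). ($\delta$) If $(\ast_\delta)$ holds, then $F\in\mathcal{DB}$ (Discrete-Time-Bounded-Real). (II) In each of the four cases, if the realization $R_F$ is minimal, then the converse is true as well: $F\in\mathcal{P}$ implies $(\ast_\alpha)$, $F\in\mathcal{B}$ implies $(\ast_\beta)$, $F\in\mathcal{DP}$ implies $(\ast_\gamma)$, and $F\in\mathcal{DB}$ implies $(\ast_\delta)$.
   Context: $\mathbf{P}_n$ (resp. $\overline{\mathbf{P}}_n$) denotes the set of $n\times n$ Hermitian positive definite (resp. positive semi-definite) matrices; $X^*$ is the conjugate transpose. $\mathbb{C}_R=\{z\in\mathbb{C}:\operatorname{Re}z>0\}$ and $\overline{\mathbb{D}}^c=\{z\in\mathbb{C}:|z|>1\}$. Let $\overline{\mathbf{L}}_{I_m}=\{X\in\mathbb{C}^{m\times m}: X+X^*\in\overline{\mathbf{P}}_m\}$ and $\overline{\mathbf{S}}_{I_m}=\{X\in\mathbb{C}^{m\times m}: \|X\|_2\le 1\}$ ($\|\cdot\|_2$ is the spectral norm). A real rational function is a rational function with real coefficients. For an $m\times m$-valued real rational function $F$ of a complex variable $z$: - $F\in\mathcal{P}$ (Positive-Real) means $F$ is analytic in $\mathbb{C}_R$ and $F(z)\in\overline{\mathbf{L}}_{I_m}$ for all $z\in\mathbb{C}_R$; - $F\in\mathcal{B}$ (Bounded-Real) means $F$ is analytic in $\mathbb{C}_R$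 and $F(z)\in\overline{\mathbf{S}}_{I_m}$ for all $z\in\mathbb{C}_R$; - $F\in\mathcal{DP}$ (Discrete-Time-Positive-Real) means $F$ is analytic in $\overline{\mathbb{D}}^c$ and $F(z)\in\overline{\mathbf{L}}_{I_m}$ for all $z\in\overline{\mathbb{D}}^c$; - $F\in\mathcal{DB}$ (Discrete-Time-Bounded-Real) means $F$ is analytic in $\overline{\mathbb{D}}^c$ and $F(z)\in\overline{\mathbf{S}}_{I_m}$ for all $z\in\overline{\mathbb{D}}^c$. The realization $R_F$ is called minimal if $n$ is the McMillan degree of $F$. *)

theory Defs
  imports
    "HOL-Analysis.Complex_Analysis_Basics"
    "Jordan_Normal_Form.Schur_Decomposition"
    "Jordan_Normal_Form.Gauss_Jordan_Elimination"
begin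

text \<open>Matrices are those of \<open>Jordan_Normal_Form\<close>, whose dimensions are values rather than types;
  the sizes \<open>n\<close> and \<open>m\<close> may be \<open>0\<close>. The conjugate transpose of \<open>X\<close> is \<open>mat_adjoint X\<close>, and
  \<open>(A *\<^sub>v v) \<bullet>c v\<close> is \<open>v\<^sup>* A v\<close>.\<close>

definition psd_mats :: "nat \<Rightarrow> complex mat set" where
  "psd_mats n = {A \<in> carrier_mat n n. mat_adjoint A = A \<and>
     (\<forall>v \<in> carrier_vec n. 0 \<le> Re ((A *\<^sub>v v) \<bullet>c v))}"

definition pd_mats :: "nat \<Rightarrow> complex mat set" where
  "pd_mats n = {A \<in> carrier_mat n n. mat_adjoint A = A \<and>
     (\<forall>v \<in> carrier_vec n. v \<noteq> 0\<^sub>v n \<longrightarrow> 0 < Re ((A *\<^sub>v v) \<bullet>c v))}"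

definition euclid_norm :: "complex vec \<Rightarrow> real" where
  "euclid_norm v = sqrt (Re (v \<bullet>c v))"

definition spectral_norm :: "complex mat \<Rightarrow> real" where
  "spectral_norm X =
     (SUP v \<in> {v \<in> carrier_vec (dim_col X). euclid_norm v \<le> 1}. euclid_norm (X *\<^sub>v v))"

definition L_bar :: "nat \<Rightarrow> complex mat set" where
  "L_bar m = {X \<in> carrier_mat m m. X + mat_adjoint X \<in> psd_mats m}"

definition S_bar :: "nat \<Rightarrow> complex mat set" where
  "S_bar m = {X \<in> carrier_mat m m. spectral_norm X \<le> 1}"

text \<open>A rational function is represented by the evaluation of its reduced fraction. Hence removable
  singularities are filled in, while at a genuine pole the value is \<open>0\<close> (division by zero) and the
  function is not analytic there, so that analyticity on an open set means having no pole in it.\<close>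

definition real_rational :: "(complex \<Rightarrow> complex) \<Rightarrow> bool" where
  "real_rational f \<longleftrightarrow> (\<exists>p q :: real poly. q \<noteq> 0 \<and> coprime p q \<and>
     (\<forall>z. f z = poly (map_poly of_real p) z / poly (map_poly of_real q) z))"

definition real_rational_mat :: "nat \<Rightarrow> (complex \<Rightarrow> complex mat) \<Rightarrow> bool" where
  "real_rational_mat m F \<longleftrightarrow> (\<forall>z. F z \<in> carrier_mat m m) \<and>
     (\<forall>i<m. \<forall>j<m. real_rational (\<lambda>z. F z $$ (i,j)))"

definition mat_analytic_on :: "nat \<Rightarrow> (complex \<Rightarrow> complex mat) \<Rightarrow> complex set \<Rightarrow> bool" where
  "mat_analytic_on m F S \<longleftrightarrow> (\<forall>i<m. \<forall>j<m. (\<lambda>z. F z $$ (i,j)) analytic_on S)"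

definition right_half_plane :: "complex set" where
  "right_half_plane = {z. Re z > 0}"

definition disc_exterior :: "complex set" where
  "disc_exterior = {z. norm z > 1}"

definition Positive_Real :: "nat \<Rightarrow> (complex \<Rightarrow> complex mat) set" where
  "Positive_Real m = {F. real_rational_mat m F \<and> mat_analytic_on m F right_half_plane \<and>
     (\<forall>z \<in> right_half_plane. F z \<in> L_bar m)}"

definition Bounded_Real :: "nat \<Rightarrow> (complex \<Rightarrow> complex mat) set" where
  "Bounded_Real m = {F. real_rational_mat m F \<and> mat_analytic_on m F right_half_plane \<and>
     (\<forall>z \<in> right_half_plane. F z \<in> S_bar m)}"

definition Discrete_Positive_Real :: "nat \<Rightarrow> (complex \<Rightarrow> complex mat) set" where
  "Discrete_Positive_Real m = {F. real_rational_mat m F \<and> mat_analytic_on m F disc_exterior \<and>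
     (\<forall>z \<in> disc_exterior. F z \<in> L_bar m)}"

definition Discrete_Bounded_Real :: "nat \<Rightarrow> (complex \<Rightarrow> complex mat) set" where
  "Discrete_Bounded_Real m = {F. real_rational_mat m F \<and> mat_analytic_on m F disc_exterior \<and>
     (\<forall>z \<in> disc_exterior. F z \<in> S_bar m)}"

text \<open>The equation \<open>F(z) = C (z I - A)\<^sup>-\<^sup>1 B + D\<close> is one between rational functions; it is
  required at every \<open>z\<close> outside the spectrum of \<open>A\<close>, where the right-hand side is defined.
  An eigenvalue of \<open>A\<close> need not be a pole of \<open>F\<close>.\<close>

definition is_realization :: "nat \<Rightarrow> nat \<Rightarrow> (complex \<Rightarrow> complex mat) \<Rightarrow>
    complex mat \<Rightarrow> complex mat \<Rightarrow> complex mat \<Rightarrow> complex mat \<Rightarrow> bool" where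
  "is_realization n m F A B C D \<longleftrightarrow>
     A \<in> carrier_mat n n \<and> B \<in> carrier_mat n m \<and> C \<in> carrier_mat m n \<and> D \<in> carrier_mat m m \<and>
     (\<forall>z. det (z \<cdot>\<^sub>m 1\<^sub>m n - A) \<noteq> 0 \<longrightarrow>
        F z = C * the (mat_inverse (z \<cdot>\<^sub>m 1\<^sub>m n - A)) * B + D)"

text \<open>The McMillan degree is the least state dimension of a realization. It is meaningful only for
  functions that have one, that is, those without a pole at infinity.\<close>

definition mcmillan_degree :: "nat \<Rightarrow> (complex \<Rightarrow> complex mat) \<Rightarrow> nat" where
  "mcmillan_degree m F = (LEAST n. \<exists>A B C D. is_realization n m F A B C D)"

definition block_diag :: "complex mat \<Rightarrow> complex mat \<Rightarrow> complex mat" where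
  "block_diag X Y =
     four_block_mat X (0\<^sub>m (dim_row X) (dim_col Y)) (0\<^sub>m (dim_row Y) (dim_col X)) Y"

text \<open>The \<open>4 \<times> 4\<close> block matrices \<open>W\<close>, with block sizes \<open>n, m, n, m\<close>, are written as
  \<open>2 \<times> 2\<close> block matrices whose blocks have size \<open>n + m\<close>.\<close>

definition W_alpha :: "nat \<Rightarrow> nat \<Rightarrow> complex mat \<Rightarrow> complex mat" where
  "W_alpha n m P = four_block_mat
     (0\<^sub>m (n+m) (n+m))           (block_diag (- P) (1\<^sub>m m))
     (block_diag (- P) (1\<^sub>m m))   (0\<^sub>m (n+m) (n+m))"

definition W_beta :: "nat \<Rightarrow> nat \<Rightarrow> complex mat \<Rightarrow> complex mat" where
  "W_beta n m P = four_block_mat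
     (block_diag (0\<^sub>m n n) (- 1\<^sub>m m))   (block_diag (- P) (0\<^sub>m m m))
     (block_diag (- P) (0\<^sub>m m m))       (block_diag (0\<^sub>m n n) (1\<^sub>m m))"

definition W_gamma :: "nat \<Rightarrow> nat \<Rightarrow> complex mat \<Rightarrow> complex mat" where
  "W_gamma n m P = four_block_mat
     (block_diag (- P) (0\<^sub>m m m))       (block_diag (0\<^sub>m n n) (1\<^sub>m m))
     (block_diag (0\<^sub>m n n) (1\<^sub>m m))     (block_diag P (0\<^sub>m m m))"

definition W_delta :: "nat \<Rightarrow> nat \<Rightarrow> complex mat \<Rightarrow> complex mat" where
  "W_delta n m P = four_block_mat
     (block_diag (- P) (- 1\<^sub>m m))     (0\<^sub>m (n+m) (n+m))
     (0\<^sub>m (n+m) (n+m))               (block_diag P (1\<^sub>m m))"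

definition quadratic_condition ::
    "nat \<Rightarrow> nat \<Rightarrow> (nat \<Rightarrow> nat \<Rightarrow> complex mat \<Rightarrow> complex mat) \<Rightarrow> complex mat \<Rightarrow> bool" where
  "quadratic_condition n m W R \<longleftrightarrow> (\<exists>P \<in> pd_mats n.
     mat_adjoint (R @\<^sub>r 1\<^sub>m (n+m)) * W n m P * (R @\<^sub>r 1\<^sub>m (n+m)) \<in> psd_mats (n+m))"

end

theory Submission
  imports "HOL-Complex_Analysis.Complex_Analysis" "HOL-Computational_Algebra.Field_as_Ring" Defs
begin

text \<open>
  All four equivalences are instances of one statement about dissipative systems. Read the
  realization as a linear system with input \<open>u\<close>, state \<open>x\<close> and output \<open>y = C x + D u\<close>, and measure
  the power that is supplied to it by a quadratic supply rate \<open>s(u,y)\<close>: \<open>|u|\<^sup>2 - |y|\<^sup>2\<close> in the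
  bounded-real cases and \<open>2 Re (u\<^sup>* y)\<close> in the positive-real cases. The analytic condition says
  \<open>s(v, F(z) v) \<ge> 0\<close> for every \<open>z\<close> of the region and every vector \<open>v\<close>; the matrix condition says that
  the stored energy \<open>V(x) = x\<^sup>* P x\<close> never grows faster than it is supplied, that is
  \<open>V(A x + B u) \<le> V(x) + s(u,y)\<close> in discrete and \<open>2 Re (x\<^sup>* P (A x + B u)) \<le> s(u,y)\<close> in
  continuous time (\<open>quadratic_condition_iff\<close>).

  Sufficiency: a vector \<open>x\<close> with \<open>A x + B v = z x\<close> turns the dissipation inequality into
  \<open>0 \<le> \<kappa>(z) V(x) + s(v, F(z) v)\<close>, where \<open>\<kappa>(z)\<close> is \<open>1 - |z|\<^sup>2\<close> or \<open>- 2 Re z\<close> and is negative in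
  the region. Hence \<open>s(v, F(z) v) \<ge> 0\<close>; with \<open>v = 0\<close> the same inequality shows that no eigenvalue
  of \<open>A\<close> lies in the region, so that \<open>F\<close> is analytic there.

  Necessity in discrete time: feed the system, starting at rest, with finitely many inputs \<open>u\<^sub>k\<close>.
  With \<open>w = 1 / z\<close>, the generating functions of inputs and outputs satisfy \<open>Y(w) = F(1/w) U(w)\<close>
  near \<open>0\<close>, and therefore in the whole unit disc, where \<open>F(1/w)\<close> is analytic. Averaging
  \<open>s(U(w), Y(w)) \<ge> 0\<close> over the circle \<open>|w| = \<rho>\<close>, where Parseval's identity applies, and letting
  \<open>\<rho>\<close> tend to \<open>1\<close> gives \<open>\<Sum> s(u\<^sub>k,y\<^sub>k) \<ge> 0\<close> (\<open>zero_state_dissipative\<close>): no energy can be gained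
  from the system at rest. The available storage of a state \<open>x\<close>, the supremum of the energy
  \<open>- \<Sum> s(u\<^sub>k,y\<^sub>k)\<close> that can be extracted when starting at \<open>x\<close>, is then finite if \<open>x\<close> is reachable, and
  positive if \<open>x\<close> is nonzero and the system is observable. It satisfies the dissipation inequality
  by construction. As a supremum over all inputs of a form that is jointly quadratic in state and
  inputs it obeys the parallelogram law, so by the Jordan--von Neumann theorem
  (\<open>parallelogram_imp_quadratic_form\<close>) it equals \<open>x\<^sup>* P x\<close> for a Hermitian matrix \<open>P\<close>.
  Reachability and observability come from minimality: an invariant subspace that contains the
  range of \<open>B\<close>, or dually one inside the kernel of \<open>C\<close>, yields a realization of smaller
  dimension.

  Necessity in continuous time reduces to discrete time by the Cayley transform
  \<open>\<xi> = \<sigma> x - x', \<xi>\<^sub>+ = \<sigma> x + x'\<close> with \<open>x' = A x + B u\<close>, which keeps inputs and outputs. It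
  satisfies \<open>V(\<xi>\<^sub>+) - V(\<xi>) = 4 \<sigma> Re (x\<^sup>* P x')\<close>, so the two dissipation inequalities
  correspond up to a positive factor.
\<close>

unbundle no vec_syntax
no_notation fps_nth (infixl \<open>$\<close> 75)

section \<open>Hermitian forms from the parallelogram law\<close>

abbreviation energy :: "complex mat \<Rightarrow> complex vec \<Rightarrow> real" where
  "energy Q x \<equiv> Re ((Q *\<^sub>v x) \<bullet>c x)"

text \<open>The only regularity used to pass from additivity to real homogeneity in the Jordan--von Neumann
  argument is boundedness on an interval, which positivity of the form provides.\<close>

lemma bounded_additive_is_linear:
  fixes g :: "real \<Rightarrow> real"
  assumes add: "\<And>s t. g (s + t) = g s + g t"
    and bnd: "\<And>t. 0 \<le> t \<Longrightarrow> t \<le> 1 \<Longrightarrow> \<bar>g t\<bar> \<le> K"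
  shows "g t = t * g 1"
proof -
  \<comment> \<open>The defect of linearity is additive and vanishes at the integers, so it has period 1 and is
    bounded everywhere; but then \<open>h (n t) = n h t\<close> forces \<open>h t = 0\<close>.\<close>
  define h where "h t = g t - t * g 1" for t
  have h_add: "h (s + t) = h s + h t" for s t
    unfolding h_def by (simp add: add algebra_simps)
  have h1: "h 1 = 0" by (simp add: h_def)
  have h0: "h 0 = 0" using h_add[of 0 0] by simp
  have h_nat: "h (real n * t) = real n * h t" for n t
    by (induction n) (simp_all add: h0 h_add algebra_simps)
  have h_minus: "h (- t) = - h t" for t using h_add[of t "-t"] h0 by simp
  have h_int: "h (of_int k) = 0" for k
  proof (cases k)
    case (nonneg n) then show ?thesis using h_nat[of n 1] h1 by simp
  next
    case (neg n) then show ?thesis using h_nat[of "Suc n" 1] h1 h_minus[of "real (Suc n)"] by simp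
  qed
  have h_bnd: "\<bar>h t\<bar> \<le> K + \<bar>g 1\<bar>" for t
  proof -
    have "h t = h (frac t)"
      using h_add[of "of_int \<lfloor>t\<rfloor>" "frac t"] h_int by (simp add: frac_def)
    moreover have "\<bar>h (frac t)\<bar> \<le> \<bar>g (frac t)\<bar> + \<bar>frac t * g 1\<bar>"
      unfolding h_def by linarith
    moreover have "\<bar>frac t * g 1\<bar> \<le> 1 * \<bar>g 1\<bar>"
      unfolding abs_mult by (intro mult_right_mono) (auto simp: frac_lt_1 less_imp_le)
    moreover have "\<bar>g (frac t)\<bar> \<le> K" by (rule bnd) (auto simp: frac_lt_1 less_imp_le)
    ultimately show ?thesis by linarith
  qed
  have "h t = 0"
  proof (rule ccontr)
    assume "h t \<noteq> 0"
    then obtain n where "real n * \<bar>h t\<bar> > K + \<bar>g 1\<bar>"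
      using reals_Archimedean3[of "\<bar>h t\<bar>"] by auto
    moreover have "\<bar>h (real n * t)\<bar> \<le> K + \<bar>g 1\<bar>" by (rule h_bnd)
    ultimately show False by (simp add: h_nat abs_mult)
  qed
  then show ?thesis by (simp add: h_def)
qed

text \<open>The polarization \<open>S\<close> of a function satisfying the parallelogram law is the real part of the
  Hermitian form to be constructed. Nonnegativity of \<open>V\<close> replaces continuity: it bounds
  \<open>S x y\<close> by \<open>(V x + V y) / 2\<close>.\<close>

lemma jordan_von_neumann_real:
  fixes V :: "complex vec \<Rightarrow> real"
  assumes nonneg: "\<And>x. x \<in> carrier_vec n \<Longrightarrow> 0 \<le> V x"
    and hom: "\<And>l x. x \<in> carrier_vec n \<Longrightarrow> V (l \<cdot>\<^sub>v x) = (norm l)\<^sup>2 * V x"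
    and par: "\<And>x y. x \<in> carrier_vec n \<Longrightarrow> y \<in> carrier_vec n \<Longrightarrow>
                V (x + y) + V (x - y) = 2 * V x + 2 * V y"
  defines "S x y \<equiv> (V (x + y) - V (x - y)) / 4"
  shows "x \<in> carrier_vec n \<Longrightarrow> y \<in> carrier_vec n \<Longrightarrow> z \<in> carrier_vec n \<Longrightarrow> S (x + y) z = S x z + S y z"
    and "x \<in> carrier_vec n \<Longrightarrow> y \<in> carrier_vec n \<Longrightarrow> S x y = S y x"
    and "x \<in> carrier_vec n \<Longrightarrow> S x x = V x"
    and "x \<in> carrier_vec n \<Longrightarrow> y \<in> carrier_vec n \<Longrightarrow> S (\<i> \<cdot>\<^sub>v x) (\<i> \<cdot>\<^sub>v y) = S x y"
    and "x \<in> carrier_vec n \<Longrightarrow> y \<in> carrier_vec n \<Longrightarrow> S (of_real t \<cdot>\<^sub>v x) y = t * S x y"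
proof -
  have neg: "V (- x) = V x" if "x \<in> carrier_vec n" for x
    proof -
    have "- x = -1 \<cdot>\<^sub>v x" by auto
    then show ?thesis using hom[OF that, of "-1"] by simp
  qed
  have V0: "V (0\<^sub>v n) = 0"
  proof -
    have "0\<^sub>v n = (0 :: complex) \<cdot>\<^sub>v 0\<^sub>v n" by auto
    then show ?thesis using hom[of "0\<^sub>v n" 0] by simp
  qed
  have V2: "V (2 \<cdot>\<^sub>v x) = 4 * V x" if "x \<in> carrier_vec n" for x
    using hom[OF that, of 2] by simp
  have zero: "S (0\<^sub>v n) z = 0" if "z \<in> carrier_vec n" for z
    using that neg[OF that] unfolding S_def by (simp add: minus_add_uminus_vec[of _ n])
  \<comment> \<open>The difference of the parallelogram laws for \<open>x + z, y\<close> and \<open>x - z, y\<close>.\<close>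
  have four: "S (x + y) z + S (x - y) z = 2 * S x z"
    if c: "x \<in> carrier_vec n" "y \<in> carrier_vec n" "z \<in> carrier_vec n" for x y z
  proof -
    have e: "x + z + y = x + y + z" "x + z - y = x - y + z" "x - z + y = x + y - z" "x - z - y = x - y - z"
      using c by auto
    have arith: "(p - q) / 4 + (r - s) / 4 = 2 * ((g - h) / 4)"
      if "p + r = 2 * g + 2 * v" "q + s = 2 * h + 2 * v" for p q r s g h v :: real
      using that by argo
    show ?thesis
      using par[OF add_carrier_vec[OF c(1) c(3)] c(2)] par[OF minus_carrier_vec[OF c(1) c(3)] c(2)]
      unfolding S_def e by (rule arith)
  qed
  have dbl: "S (2 \<cdot>\<^sub>v x) z = 2 * S x z" if c: "x \<in> carrier_vec n" "z \<in> carrier_vec n" for x z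
  proof -
    have "x + x = 2 \<cdot>\<^sub>v x" using c by auto
    then show ?thesis using four[of x x z] c zero[of z] by simp
  qed
  show add: "S (x + y) z = S x z + S y z"
    if c: "x \<in> carrier_vec n" "y \<in> carrier_vec n" "z \<in> carrier_vec n" for x y z
  proof -
    \<comment> \<open>The identity above at the half sum and the half difference of the summands.\<close>
    define p where "p = (1/2) \<cdot>\<^sub>v (x + y)"
    define q where "q = (1/2) \<cdot>\<^sub>v (x - y)"
    have pq: "p \<in> carrier_vec n" "q \<in> carrier_vec n" using c by (auto simp: p_def q_def)
    have e: "p + q = x" "p - q = y" "2 \<cdot>\<^sub>v p = x + y"
      using c by (auto simp: p_def q_def field_simps)
    show ?thesis using four[OF pq c(3)] dbl[OF pq(1) c(3)] unfolding e by simp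
  qed
  show "S x y = S y x" if c: "x \<in> carrier_vec n" "y \<in> carrier_vec n" for x y
  proof -
    have e: "y + x = x + y" "y - x = - (x - y)" using c by auto
    show ?thesis unfolding S_def e using neg[of "x - y"] c by simp
  qed
  show "S x x = V x" if c: "x \<in> carrier_vec n" for x
  proof -
    have "x + x = 2 \<cdot>\<^sub>v x" "x - x = 0\<^sub>v n" using c by auto
    then show ?thesis unfolding S_def using V0 V2[OF c] by simp
  qed
  show "S (\<i> \<cdot>\<^sub>v x) (\<i> \<cdot>\<^sub>v y) = S x y" if c: "x \<in> carrier_vec n" "y \<in> carrier_vec n" for x y
  proof -
    have e: "\<i> \<cdot>\<^sub>v x + \<i> \<cdot>\<^sub>v y = \<i> \<cdot>\<^sub>v (x + y)" "\<i> \<cdot>\<^sub>v x - \<i> \<cdot>\<^sub>v y = \<i> \<cdot>\<^sub>v (x - y)"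
      using c by (auto simp: algebra_simps)
    show ?thesis unfolding S_def e using c by (simp add: hom)
  qed
  show "S (of_real t \<cdot>\<^sub>v x) y = t * S x y" if c: "x \<in> carrier_vec n" "y \<in> carrier_vec n" for x y t
  proof -
    define g where "g t = S (of_real t \<cdot>\<^sub>v x) y" for t
    have "g t = t * g 1"
    proof (rule bounded_additive_is_linear)
      fix s t
      have "of_real (s + t) \<cdot>\<^sub>v x = of_real s \<cdot>\<^sub>v x + of_real t \<cdot>\<^sub>v x"
        using c by (auto simp: algebra_simps)
      then show "g (s + t) = g s + g t" using c by (simp add: g_def add)
    next
      fix t :: real assume t: "0 \<le> t" "t \<le> 1"
      define x' where "x' = of_real t \<cdot>\<^sub>v x"
      have c': "x' \<in> carrier_vec n" using c by (simp add: x'_def)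
      have "V x' \<le> V x" unfolding x'_def hom[OF c(1)]
        using t nonneg[OF c(1)] by (simp add: mult_left_le_one_le power_le_one)
      moreover have "0 \<le> V (x' + y)" "0 \<le> V (x' - y)" using c c' nonneg by auto
      moreover have "V (x' + y) + V (x' - y) = 2 * V x' + 2 * V y" by (rule par[OF c' c(2)])
      ultimately show "\<bar>g t\<bar> \<le> (V x + V y) / 2"
        unfolding g_def S_def x'_def[symmetric] by (auto simp: abs_le_iff)
    qed
    then show ?thesis using c by (simp add: g_def)
  qed
qed

lemma mat_adjoint_index:
  "i < dim_col X \<Longrightarrow> j < dim_row X \<Longrightarrow> mat_adjoint X $$ (i,j) = cnj (X $$ (j,i))"
  by (simp add: mat_adjoint_def mat_of_rows_def)

lemma mat_adjoint_carrier[intro]: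
  "X \<in> carrier_mat a b \<Longrightarrow> mat_adjoint X \<in> carrier_mat b a"
  by (auto simp: mat_adjoint_def mat_of_rows_def)

lemma dim_mat_adjoint[simp]: "dim_row (mat_adjoint X) = dim_col X" "dim_col (mat_adjoint X) = dim_row X"
  by (simp_all add: mat_adjoint_def mat_of_rows_def)

text \<open>Jordan--von Neumann in coordinates: the matrix entries are the values of the polarized form at
  unit vectors.\<close>

lemma parallelogram_imp_quadratic_form:
  fixes V :: "complex vec \<Rightarrow> real"
  assumes nonneg: "\<And>x. x \<in> carrier_vec n \<Longrightarrow> 0 \<le> V x"
    and hom: "\<And>l x. x \<in> carrier_vec n \<Longrightarrow> V (l \<cdot>\<^sub>v x) = (norm l)\<^sup>2 * V x"
    and par: "\<And>x y. x \<in> carrier_vec n \<Longrightarrow> y \<in> carrier_vec n \<Longrightarrow>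
                V (x + y) + V (x - y) = 2 * V x + 2 * V y"
  shows "\<exists>P \<in> carrier_mat n n. mat_adjoint P = P \<and> (\<forall>x \<in> carrier_vec n. energy P x = V x)"
proof -
  define S where "S x y = (V (x + y) - V (x - y)) / 4" for x y
  note JN = jordan_von_neumann_real[of n V, OF nonneg hom par, folded S_def]
  have SI: "S (\<i> \<cdot>\<^sub>v x) y = - S x (\<i> \<cdot>\<^sub>v y)" if c: "x \<in> carrier_vec n" "y \<in> carrier_vec n" for x y
  proof -
    have "\<i> \<cdot>\<^sub>v (\<i> \<cdot>\<^sub>v x) = of_real (-1) \<cdot>\<^sub>v x" using c by auto
    then show ?thesis using JN(4)[of "\<i> \<cdot>\<^sub>v x" y] JN(5)[of x "\<i> \<cdot>\<^sub>v y" "-1"] c by simp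
  qed
  define H where "H x y = Complex (S x y) (S x (\<i> \<cdot>\<^sub>v y))" for x y
  have H_add: "H (x + y) z = H x z + H y z"
    if c: "x \<in> carrier_vec n" "y \<in> carrier_vec n" "z \<in> carrier_vec n" for x y z
    using c by (simp add: H_def JN(1) complex_eq_iff)
  have H_i: "H (\<i> \<cdot>\<^sub>v x) y = \<i> * H x y" if c: "x \<in> carrier_vec n" "y \<in> carrier_vec n" for x y
    using c SI[of x y] JN(4)[of x y] by (simp add: H_def complex_eq_iff)
  have H_re: "H (of_real t \<cdot>\<^sub>v x) y = of_real t * H x y"
    if c: "x \<in> carrier_vec n" "y \<in> carrier_vec n" for x y t
    using c by (simp add: H_def JN(5) complex_eq_iff)
  have H_smult: "H (l \<cdot>\<^sub>v x) y = l * H x y" if c: "x \<in> carrier_vec n" "y \<in> carrier_vec n" for l x y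
  proof -
    have "l \<cdot>\<^sub>v x = of_real (Re l) \<cdot>\<^sub>v x + \<i> \<cdot>\<^sub>v (of_real (Im l) \<cdot>\<^sub>v x)"
      using c by (intro eq_vecI) (auto simp: complex_eq_iff)
    then have "H (l \<cdot>\<^sub>v x) y = (of_real (Re l) + \<i> * of_real (Im l)) * H x y"
      using c by (simp add: H_add H_i H_re algebra_simps)
    then show ?thesis by (metis complex_eq)
  qed
  have H_herm: "H y x = cnj (H x y)" if c: "x \<in> carrier_vec n" "y \<in> carrier_vec n" for x y
    using c SI[of x y] JN(2)[of y x] JN(2)[of y "\<i> \<cdot>\<^sub>v x"]
    by (simp add: H_def complex_eq_iff)
  have H_sum: "H x y = (\<Sum>j<n. x $ j * H (unit_vec n j) y)"
    if c: "x \<in> carrier_vec n" "y \<in> carrier_vec n" for x y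
  proof -
    define t where "t k = vec n (\<lambda>i. if i < k then x $ i else 0)" for k
    have tc: "t k \<in> carrier_vec n" for k by (simp add: t_def)
    have "k \<le> n \<Longrightarrow> H (t k) y = (\<Sum>j<k. x $ j * H (unit_vec n j) y)" for k
    proof (induction k)
      case 0
      have "t 0 = 0 \<cdot>\<^sub>v t 0" by (auto simp: t_def)
      then have "H (t 0) y = 0" using H_smult[OF tc c(2), of 0 0] by simp
      then show ?case by simp
    next
      case (Suc k)
      have "t (Suc k) = t k + x $ k \<cdot>\<^sub>v unit_vec n k"
        by (intro eq_vecI) (auto simp: t_def less_Suc_eq unit_vec_def)
      then show ?case using Suc c tc by (simp add: H_add H_smult)
    qed
    from this[of n] have "H (t n) y = (\<Sum>j<n. x $ j * H (unit_vec n j) y)" by simp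
    moreover have "t n = x" using c by (intro eq_vecI) (auto simp: t_def)
    ultimately show ?thesis by simp
  qed
  define P where "P = mat n n (\<lambda>(i,j). H (unit_vec n j) (unit_vec n i))"
  have P: "P \<in> carrier_mat n n" by (simp add: P_def)
  have adj: "mat_adjoint P = P"
    by (intro eq_matI) (auto simp: mat_adjoint_index P_def H_herm[of "unit_vec n _" "unit_vec n _", symmetric])
  have "energy P x = V x" if x: "x \<in> carrier_vec n" for x
  proof -
    have "(P *\<^sub>v x) $ i = cnj (H (unit_vec n i) x)" if i: "i < n" for i
    proof -
      have "H x (unit_vec n i) = (P *\<^sub>v x) $ i"
        using x i by (simp add: H_sum[of x] scalar_prod_def P_def atLeast0LessThan mult.commute)
      then show ?thesis using H_herm[of "unit_vec n i" x] x by simp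
    qed
    then have "(P *\<^sub>v x) \<bullet>c x = cnj (H x x)"
      using x P by (simp add: scalar_prod_def H_sum[of x x] atLeast0LessThan mult.commute)
    moreover have "Re (H x x) = V x" using x by (simp add: H_def JN(3))
    ultimately show ?thesis by simp
  qed
  with P adj show ?thesis by blast
qed

section \<open>A discrete Parseval inequality for power series on a circle\<close>

text \<open>The supply rate of a single input-output channel. Keeping the three coefficients free covers
  \<open>|p|\<^sup>2 - |q|\<^sup>2\<close> and \<open>2 Re (q p\<^sup>*)\<close> at once; \<open>c \<ge> 0\<close> means that output can only cost energy.\<close>

definition scalar_supply :: "real \<Rightarrow> real \<Rightarrow> real \<Rightarrow> complex \<Rightarrow> complex \<Rightarrow> real" where
  "scalar_supply a b c p q = a * (norm p)\<^sup>2 + 2 * b * Re (q * cnj p) - c * (norm q)\<^sup>2"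

lemma sum_roots_of_unity_orthogonal:
  assumes "k < K" "l < K"
  defines "\<zeta> \<equiv> \<lambda>j::nat. cis (2 * pi * real j / real K)"
  shows "(\<Sum>j<K. \<zeta> j ^ k * cnj (\<zeta> j ^ l)) = (if k = l then of_nat K else 0)"
proof (cases "k = l")
  case True
  have "\<zeta> j ^ k * cnj (\<zeta> j ^ k) = 1" for j
    unfolding complex_norm_square[symmetric] by (simp add: \<zeta>_def norm_power)
  then show ?thesis using True by simp
next
  case False
  have K: "K > 0" using assms by simp
  define q where "q = \<zeta> k * cnj (\<zeta> l)"
  have z: "\<zeta> j ^ k = \<zeta> k ^ j" for j k
    unfolding \<zeta>_def Complex.DeMoivre by (rule arg_cong[of _ _ cis]) simp
  have "inj_on \<zeta> {..<K}" unfolding \<zeta>_def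
    using Complex.bij_betw_roots_unity[OF K] by (auto simp: bij_betw_def)
  then have "\<zeta> k \<noteq> \<zeta> l" using assms False by (auto simp: inj_on_def)
  moreover have "\<zeta> l * cnj (\<zeta> l) = 1"
    unfolding complex_norm_square[symmetric] by (simp add: \<zeta>_def)
  ultimately have "q \<noteq> 1"
    unfolding q_def by (metis mult.assoc mult.commute mult.right_neutral)
  have unity: "\<zeta> j ^ K = 1" for j
    using K unfolding \<zeta>_def Complex.DeMoivre by (simp add: cis_multiple_2pi)
  have "q ^ K = 1" unfolding q_def
    by (simp add: power_mult_distrib unity flip: complex_cnj_power)
  then have "(\<Sum>j<K. q ^ j) = 0" using \<open>q \<noteq> 1\<close> by (simp add: geometric_sum)
  moreover have "\<zeta> j ^ k * cnj (\<zeta> j ^ l) = q ^ j" for j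
    by (simp only: q_def z[of j k] z[of j l] power_mult_distrib complex_cnj_power)
  ultimately show ?thesis using False by simp
qed

text \<open>Sampling at the \<open>K\<close>-th roots of unity makes Parseval's identity for polynomials of degree below
  \<open>K\<close> a finite computation, which avoids integrals over the circle.\<close>

lemma discrete_parseval:
  fixes p q :: "nat \<Rightarrow> complex" and \<rho> :: real
  defines "w \<equiv> \<lambda>K j::nat. of_real \<rho> * cis (2 * pi * real j / real K)"
  shows "(\<Sum>j<K. (\<Sum>k<K. p k * w K j ^ k) * cnj (\<Sum>k<K. q k * w K j ^ k))
       = of_nat K * (\<Sum>k<K. p k * cnj (q k) * of_real (\<rho> ^ (2 * k)))"
proof -
  let ?z = "\<lambda>j::nat. cis (2 * pi * real j / real K)"
  have "(\<Sum>j<K. (\<Sum>k<K. p k * w K j ^ k) * cnj (\<Sum>k<K. q k * w K j ^ k))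
      = (\<Sum>j<K. \<Sum>k<K. \<Sum>l<K. p k * cnj (q l) * of_real (\<rho> ^ (k + l)) * (?z j ^ k * cnj (?z j ^ l)))"
    unfolding w_def cnj_sum sum_product
    by (intro sum.cong refl) (simp add: power_mult_distrib power_add)
  also have "\<dots> = (\<Sum>k<K. \<Sum>l<K. \<Sum>j<K. p k * cnj (q l) * of_real (\<rho> ^ (k + l)) * (?z j ^ k * cnj (?z j ^ l)))"
    by (subst sum.swap, intro sum.cong refl sum.swap)
  also have "\<dots> = (\<Sum>k<K. \<Sum>l<K. if k = l then p k * cnj (q l) * of_real (\<rho> ^ (k + l)) * of_nat K else 0)"
    unfolding sum_distrib_left[symmetric]
    by (intro sum.cong refl, subst sum_roots_of_unity_orthogonal) auto
  also have "\<dots> = (\<Sum>k<K. p k * cnj (q k) * of_real (\<rho> ^ (2 * k)) * of_nat K)"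
    by (intro sum.cong refl) (simp add: mult_2)
  finally show ?thesis by (simp add: sum_distrib_left mult_ac)
qed

lemma discrete_parseval_supply:
  fixes p q :: "nat \<Rightarrow> complex" and \<rho> :: real
  defines "w \<equiv> \<lambda>K j::nat. of_real \<rho> * cis (2 * pi * real j / real K)"
  shows "(\<Sum>j<K. scalar_supply a b c (\<Sum>k<K. p k * w K j ^ k) (\<Sum>k<K. q k * w K j ^ k))
       = real K * (\<Sum>k<K. scalar_supply a b c (p k) (q k) * \<rho> ^ (2 * k))"
proof -
  note P = discrete_parseval[where \<rho> = \<rho> and K = K]
  have sq: "(norm z)\<^sup>2 = Re (z * cnj z)" for z
    by (simp add: complex_mult_cnj cmod_power2)
  have r: "Re (z * of_real t) = Re z * t" "Re (of_nat K * z) = real K * Re z" for z and t :: real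
    by simp_all
  have PR: "(\<Sum>j<K. Re ((\<Sum>k<K. p k * w K j ^ k) * cnj (\<Sum>k<K. q k * w K j ^ k)))
       = real K * (\<Sum>k<K. Re (p k * cnj (q k)) * \<rho> ^ (2 * k))" for p q
    using arg_cong[OF P[of p q], of Re] unfolding Re_sum r w_def .
  have split: "(\<Sum>j<K. a * X j + 2 * b * Y j - c * Z j) = a * sum X {..<K} + 2 * b * sum Y {..<K} - c * sum Z {..<K}"
    for X Y Z :: "nat \<Rightarrow> real"
    by (simp add: sum.distrib sum_subtractf sum_distrib_left)
  have rw: "(a * X + 2 * b * Y - c * Z) * t = a * (X * t) + 2 * b * (Y * t) - c * (Z * t)" for X Y Z t :: real
    by (simp add: algebra_simps)
  show ?thesis
    unfolding scalar_supply_def sq rw split PR by (simp add: algebra_simps)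
qed

lemma scalar_supply_diff:
  assumes "c \<ge> 0"
  shows "scalar_supply a b c p q \<le> scalar_supply a b c p q' +
     (2 * \<bar>b\<bar> * norm p + c * (norm q + norm q')) * norm (q - q')"
proof -
  have "Re (q * cnj p) - Re (q' * cnj p) = Re ((q - q') * cnj p)" by (simp add: algebra_simps)
  also have "\<bar>\<dots>\<bar> \<le> norm ((q - q') * cnj p)" by (rule abs_Re_le_cmod)
  finally have 1: "\<bar>Re (q * cnj p) - Re (q' * cnj p)\<bar> \<le> norm p * norm (q - q')"
    by (simp add: norm_mult mult.commute)
  have "b * (Re (q * cnj p) - Re (q' * cnj p)) \<le> \<bar>b\<bar> * \<bar>Re (q * cnj p) - Re (q' * cnj p)\<bar>"
    by (metis abs_ge_self abs_mult)
  also have "\<dots> \<le> \<bar>b\<bar> * (norm p * norm (q - q'))" using 1 by (intro mult_left_mono) auto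
  finally have 2: "b * (Re (q * cnj p) - Re (q' * cnj p)) \<le> \<bar>b\<bar> * (norm p * norm (q - q'))" .
  have "(norm q')\<^sup>2 - (norm q)\<^sup>2 = (norm q + norm q') * (norm q' - norm q)"
    by (simp add: power2_eq_square algebra_simps)
  also have "\<dots> \<le> (norm q + norm q') * norm (q - q')"
    by (intro mult_left_mono) (auto simp: norm_triangle_ineq2 norm_minus_commute[of q])
  finally have "c * ((norm q')\<^sup>2 - (norm q)\<^sup>2) \<le> c * ((norm q + norm q') * norm (q - q'))"
    using assms by (intro mult_left_mono)
  with 2 show ?thesis unfolding scalar_supply_def by (simp add: algebra_simps)
qed

text \<open>The output series is infinite, so it is cut at \<open>K\<close> terms before sampling at the \<open>K\<close>-th roots of
  unity; the error is controlled by the tail of an absolutely convergent series and vanishes as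
  \<open>K\<close> grows. The terms from \<open>N\<close> on carry no input, hence contribute \<open>- c |y\<^sub>k|\<^sup>2 \<le> 0\<close> and may be
  dropped.\<close>

lemma supply_sum_nonneg_on_circle:
  fixes u y :: "nat \<Rightarrow> nat \<Rightarrow> complex" and \<rho> :: real
  assumes c: "c \<ge> 0" and \<rho>: "0 < \<rho>"
    and u0: "\<And>k i. N \<le> k \<Longrightarrow> u k i = 0"
    and sm: "\<And>i. i < m \<Longrightarrow> summable (\<lambda>k. norm (y k i) * \<rho> ^ k)"
    and pos: "\<And>w. norm w = \<rho> \<Longrightarrow>
       0 \<le> (\<Sum>i<m. scalar_supply a b c (\<Sum>k<N. u k i * w ^ k) (\<Sum>k. y k i * w ^ k))"
  shows "0 \<le> (\<Sum>k<N. \<Sum>i<m. scalar_supply a b c (u k i) (y k i) * \<rho> ^ (2 * k))"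
proof -
  define T where "T i = (\<Sum>k. norm (y k i) * \<rho> ^ k)" for i
  define L where "L i = (\<Sum>k<N. norm (u k i) * \<rho> ^ k)" for i
  \<comment> \<open>\<open>\<delta> i K\<close> bounds the tail of the \<open>i\<close>-th output series on the circle, and \<open>E i\<close> is a Lipschitz
    constant of the supply in the output for the values that occur there.\<close>
  define \<delta> where "\<delta> i K = T i - (\<Sum>k<K. norm (y k i) * \<rho> ^ k)" for i K
  define E where "E i = 2 * \<bar>b\<bar> * L i + c * (T i + T i)" for i
  define R where "R = (\<Sum>k<N. \<Sum>i<m. scalar_supply a b c (u k i) (y k i) * \<rho> ^ (2 * k))"
  have main: "- (\<Sum>i<m. E i * \<delta> i K) \<le> R" if K: "K > N" for K
  proof -
    define w where "w j = of_real \<rho> * cis (2 * pi * real j / real K)" for j :: nat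
    have nw: "norm (w j) = \<rho>" for j using \<rho> by (simp add: w_def norm_mult)
    have ny: "norm (y k i * w j ^ k) = norm (y k i) * \<rho> ^ k" for k i j
      by (simp add: norm_mult norm_power nw)
    have U: "(\<Sum>k<N. u k i * w j ^ k) = (\<Sum>k<K. u k i * w j ^ k)" for i j
      using K u0 by (intro sum.mono_neutral_left) auto
    have step: "scalar_supply a b c (\<Sum>k<N. u k i * w j ^ k) (\<Sum>k. y k i * w j ^ k)
        \<le> scalar_supply a b c (\<Sum>k<K. u k i * w j ^ k) (\<Sum>k<K. y k i * w j ^ k) + E i * \<delta> i K"
      (is "scalar_supply a b c ?U ?Y \<le> scalar_supply a b c _ ?Z + _") if i: "i < m" for i j
    proof -
      have s1: "summable (\<lambda>k. norm (y k i * w j ^ k))" using sm[OF i] by (simp add: ny)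
      have s2: "summable (\<lambda>k. y k i * w j ^ k)" using s1 by (rule summable_norm_cancel)
      have nU: "norm ?U \<le> L i" unfolding L_def
        by (rule order_trans[OF norm_sum]) (simp add: norm_mult norm_power nw)
      have nY: "norm ?Y \<le> T i" using summable_norm[OF s1] by (simp add: T_def ny)
      have nZ: "norm ?Z \<le> T i"
      proof -
        have "norm ?Z \<le> (\<Sum>k<K. norm (y k i) * \<rho> ^ k)"
          by (rule order_trans[OF norm_sum]) (simp add: ny)
        also have "\<dots> \<le> T i" unfolding T_def using sm[OF i] \<rho> by (intro sum_le_suminf) auto
        finally show ?thesis .
      qed
      have nYZ: "norm (?Y - ?Z) \<le> \<delta> i K"
      proof -
        have "?Y - ?Z = (\<Sum>k. y (k + K) i * w j ^ (k + K))"
          using suminf_minus_initial_segment[OF s2, of K] by simp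
        also have "norm \<dots> \<le> (\<Sum>k. norm (y (k + K) i * w j ^ (k + K)))"
          using s1 by (intro summable_norm) (rule summable_ignore_initial_segment)
        also have "\<dots> = \<delta> i K"
          using suminf_minus_initial_segment[OF sm[OF i], of K] by (simp add: \<delta>_def T_def ny)
        finally show ?thesis .
      qed
      have "(2 * \<bar>b\<bar> * norm ?U + c * (norm ?Y + norm ?Z)) * norm (?Y - ?Z) \<le> E i * \<delta> i K"
        unfolding E_def using nU nY nZ nYZ c
        by (intro mult_mono add_mono mult_left_mono add_nonneg_nonneg mult_nonneg_nonneg)
          (auto intro: order_trans[OF norm_ge_zero])
      then show ?thesis
        using scalar_supply_diff[OF c, of a b ?U ?Y ?Z] unfolding U by linarith
    qed
    have "0 \<le> (\<Sum>j<K. \<Sum>i<m. scalar_supply a b c (\<Sum>k<N. u k i * w j ^ k) (\<Sum>k. y k i * w j ^ k))"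
      by (intro sum_nonneg pos nw)
    also have "\<dots> \<le> (\<Sum>j<K. \<Sum>i<m.
        scalar_supply a b c (\<Sum>k<K. u k i * w j ^ k) (\<Sum>k<K. y k i * w j ^ k) + E i * \<delta> i K)"
      by (intro sum_mono step) auto
    also have "\<dots> = (\<Sum>i<m. \<Sum>j<K.
        scalar_supply a b c (\<Sum>k<K. u k i * w j ^ k) (\<Sum>k<K. y k i * w j ^ k)) + real K * (\<Sum>i<m. E i * \<delta> i K)"
      unfolding sum.distrib by (subst sum.swap) simp
    also have "\<dots> = real K * ((\<Sum>i<m. \<Sum>k<K. scalar_supply a b c (u k i) (y k i) * \<rho> ^ (2 * k)) + (\<Sum>i<m. E i * \<delta> i K))"
      unfolding w_def discrete_parseval_supply by (simp add: sum_distrib_left algebra_simps)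
    finally have "0 \<le> (\<Sum>i<m. \<Sum>k<K. scalar_supply a b c (u k i) (y k i) * \<rho> ^ (2 * k)) + (\<Sum>i<m. E i * \<delta> i K)"
      using K by (simp add: zero_le_mult_iff)
    moreover have "(\<Sum>k<K. scalar_supply a b c (u k i) (y k i) * \<rho> ^ (2 * k))
        \<le> (\<Sum>k<N. scalar_supply a b c (u k i) (y k i) * \<rho> ^ (2 * k))" for i
    proof -
      have "(\<Sum>k<K. scalar_supply a b c (u k i) (y k i) * \<rho> ^ (2 * k))
        = (\<Sum>k<N. scalar_supply a b c (u k i) (y k i) * \<rho> ^ (2 * k))
         + (\<Sum>k\<in>{N..<K}. scalar_supply a b c (u k i) (y k i) * \<rho> ^ (2 * k))"
        using K by (subst sum.union_disjoint[symmetric]) (auto intro: sum.cong)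
      moreover have "(\<Sum>k\<in>{N..<K}. scalar_supply a b c (u k i) (y k i) * \<rho> ^ (2 * k)) \<le> 0"
        using c \<rho> u0 by (intro sum_nonpos) (auto simp: scalar_supply_def mult_le_0_iff)
      ultimately show ?thesis by linarith
    qed
    ultimately have "0 \<le> (\<Sum>i<m. \<Sum>k<N. scalar_supply a b c (u k i) (y k i) * \<rho> ^ (2 * k)) + (\<Sum>i<m. E i * \<delta> i K)"
      using sum_mono[of "{..<m}" "\<lambda>i. \<Sum>k<K. scalar_supply a b c (u k i) (y k i) * \<rho> ^ (2 * k)"
          "\<lambda>i. \<Sum>k<N. scalar_supply a b c (u k i) (y k i) * \<rho> ^ (2 * k)"] by fastforce
    then show ?thesis unfolding R_def by (subst sum.swap) linarith
  qed
  have "(\<lambda>K. \<delta> i K) \<longlonglongrightarrow> 0" if "i < m" for i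
    unfolding \<delta>_def T_def using tendsto_diff[OF tendsto_const summable_LIMSEQ[OF sm[OF that]],
        of "\<Sum>k. norm (y k i) * \<rho> ^ k"] by simp
  then have "(\<lambda>K. - (\<Sum>i<m. E i * \<delta> i K)) \<longlonglongrightarrow> - (\<Sum>i<m. E i * 0)"
    by (intro tendsto_intros) auto
  then have "- (\<Sum>i<m. E i * 0) \<le> R"
    by (rule LIMSEQ_le_const2) (use main in \<open>auto intro: exI[of _ "Suc N"]\<close>)
  then show ?thesis by (simp add: R_def)
qed

section \<open>Trajectories of a linear system and their generating functions\<close>

text \<open>\<open>supply_rate 1 0 1 u y\<close> is \<open>|u|\<^sup>2 - |y|\<^sup>2\<close> and \<open>supply_rate 0 1 0 u y\<close> is \<open>2 Re (u\<^sup>* y)\<close>.\<close>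

definition supply_rate :: "real \<Rightarrow> real \<Rightarrow> real \<Rightarrow> complex vec \<Rightarrow> complex vec \<Rightarrow> real" where
  "supply_rate a b c u y = a * Re (u \<bullet>c u) + 2 * b * Re (y \<bullet>c u) - c * Re (y \<bullet>c y)"

lemma mult_mat_vec_index_sum:
  assumes "M \<in> carrier_mat k l" "v \<in> carrier_vec l" "i < k"
  shows "(M *\<^sub>v v) $ i = (\<Sum>j<l. M $$ (i,j) * v $ j)"
  using assms by (auto simp: scalar_prod_def atLeast0LessThan intro!: sum.cong)

lemma Re_cscalar_prod_self:
  assumes "v \<in> carrier_vec k"
  shows "Re (v \<bullet>c v) = (\<Sum>i<k. (norm (v $ i))\<^sup>2)"
  using assms by (auto simp: scalar_prod_def atLeast0LessThan cmod_power2 sum.distrib power2_eq_square[of "Re _"] power2_eq_square[of "Im _"])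

lemma Re_cscalar_prod_nonneg: "v \<in> carrier_vec k \<Longrightarrow> 0 \<le> Re (v \<bullet>c v)"
  by (simp add: Re_cscalar_prod_self sum_nonneg)

lemma supply_eq_sum:
  assumes "u \<in> carrier_vec m" "y \<in> carrier_vec m"
  shows "supply_rate a b c u y = (\<Sum>i<m. scalar_supply a b c (u $ i) (y $ i))"
proof -
  have "Re (y \<bullet>c u) = (\<Sum>i<m. Re (y $ i * cnj (u $ i)))"
    using assms by (auto simp: scalar_prod_def atLeast0LessThan intro!: sum.cong)
  then show ?thesis
    unfolding supply_rate_def scalar_supply_def
      Re_cscalar_prod_self[OF assms(1)] Re_cscalar_prod_self[OF assms(2)]
    by (simp only: sum.distrib sum_subtractf sum_distrib_left)
qed

text \<open>A function that is holomorphic in the punctured unit disc and is given near \<open>0\<close> by a power series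
  extends over \<open>0\<close>, so by Cauchy's theorem its series converges to it in the whole disc. This
  transports information about the transfer function from the neighbourhood of \<open>0\<close>, where the
  resolvent exists, to the disc, where only analyticity is known.\<close>

lemma power_series_continuation:
  fixes g :: "complex \<Rightarrow> complex"
  assumes hol: "g holomorphic_on ball 0 1 - {0}" and r: "0 < r"
    and ser: "\<And>w. 0 < norm w \<Longrightarrow> norm w < r \<Longrightarrow> (\<lambda>k. y k * w ^ k) sums g w"
    and w: "0 < norm w" "norm w < 1"
  shows "(\<lambda>k. y k * w ^ k) sums g w"
proof -
  define h where "h = (\<lambda>w. if w = 0 then y 0 else g w)"
  have "\<forall>\<^sub>F w in nhds 0. (\<lambda>k. fps_nth (Abs_fps y) k * w ^ k) sums h w"
    unfolding eventually_nhds_metric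
  proof (intro exI[of _ r] conjI r allI impI)
    fix w :: complex assume "dist w 0 < r"
    then show "(\<lambda>k. fps_nth (Abs_fps y) k * w ^ k) sums h w"
      using ser[of w] powser_sums_zero[of y] by (cases "w = 0") (auto simp: h_def)
  qed
  then have fps: "h has_fps_expansion Abs_fps y" by (rule has_fps_expansionI)
  then obtain s where s: "0 < s" "h holomorphic_on ball 0 s"
    using has_fps_expansion_imp_analytic_0 by (auto simp: analytic_on_def)
  have "h holomorphic_on ball 0 1 - {0}"
    using hol by (rule holomorphic_transform) (auto simp: h_def)
  then have "h holomorphic_on ball 0 s \<union> (ball 0 1 - {0})"
    using s by (intro holomorphic_on_Un) auto
  then have "h holomorphic_on eball 0 1"
    by (rule holomorphic_on_subset) (use s in \<open>auto simp: eball_def\<close>)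
  from has_fps_expansion_imp_sums_complex[OF fps this, of w] w show ?thesis
    by (auto simp: h_def one_ereal_def)
qed

locale linear_system =
  fixes n m :: nat and A B C D :: "complex mat"
  assumes A: "A \<in> carrier_mat n n" and B: "B \<in> carrier_mat n m"
    and C: "C \<in> carrier_mat m n" and D: "D \<in> carrier_mat m m"
begin

definition "step x u = A *\<^sub>v x + B *\<^sub>v u"
definition "out x u = C *\<^sub>v x + D *\<^sub>v u"

lemma step_carrier[simp, intro]:
  "x \<in> carrier_vec n \<Longrightarrow> u \<in> carrier_vec m \<Longrightarrow> step x u \<in> carrier_vec n"
  using A B by (auto simp: step_def)

lemma out_carrier[simp, intro]:
  "x \<in> carrier_vec n \<Longrightarrow> u \<in> carrier_vec m \<Longrightarrow> out x u \<in> carrier_vec m"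
  using C D by (auto simp: out_def)

text \<open>The states reached from rest; the recursion \<open>x\<^sub>k\<^sub>+\<^sub>1 = A x\<^sub>k + B u\<^sub>k\<close> becomes
  \<open>X = w (A X + B U)\<close> for the generating functions.\<close>

primrec trajectory :: "(nat \<Rightarrow> complex vec) \<Rightarrow> nat \<Rightarrow> complex vec" where
  "trajectory u 0 = 0\<^sub>v n"
| "trajectory u (Suc k) = step (trajectory u k) (u k)"

lemma trajectory_carrier:
  "(\<And>k. u k \<in> carrier_vec m) \<Longrightarrow> trajectory u k \<in> carrier_vec n"
  by (induction k) auto

text \<open>Geometric growth gives the generating function of the states a positive radius of convergence.\<close>

lemma trajectory_geometric_bound:
  assumes u: "\<And>k. u k \<in> carrier_vec m" and u0: "\<And>k. N \<le> k \<Longrightarrow> u k = 0\<^sub>v m"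
  shows "\<exists>M \<ge> 0. \<exists>L \<ge> 1. \<forall>k. \<forall>i<n. norm (trajectory u k $ i) \<le> M * L ^ k"
proof -
  define M where "M = (\<Sum>k<N. \<Sum>i<n. norm ((B *\<^sub>v u k) $ i))"
  define L where "L = 1 + (\<Sum>i<n. \<Sum>j<n. norm (A $$ (i,j)))"
  have M: "0 \<le> M" unfolding M_def by (intro sum_nonneg) auto
  have L: "1 \<le> L" unfolding L_def by (simp add: sum_nonneg)
  have Bu: "norm ((B *\<^sub>v u k) $ i) \<le> M" if i: "i < n" for i k
  proof (cases "k < N")
    case True
    have "norm ((B *\<^sub>v u k) $ i) \<le> (\<Sum>i<n. norm ((B *\<^sub>v u k) $ i))"
      using i by (intro member_le_sum) auto
    also have "\<dots> \<le> M" unfolding M_def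
      using True by (intro member_le_sum[of k "{..<N}" "\<lambda>k. \<Sum>i<n. norm ((B *\<^sub>v u k) $ i)"])
        (auto intro: sum_nonneg)
    finally show ?thesis .
  next
    case False
    then have "(B *\<^sub>v u k) $ i = 0" using u0[of k] B i by simp
    then show ?thesis using M by simp
  qed
  have "\<forall>i<n. norm (trajectory u k $ i) \<le> M * L ^ k" for k
  proof (induction k)
    case 0 then show ?case using M by simp
  next
    case (Suc k)
    show ?case
    proof (intro allI impI)
      fix i assume i: "i < n"
      have x: "trajectory u k \<in> carrier_vec n" using trajectory_carrier u .
      have "norm ((A *\<^sub>v trajectory u k) $ i) \<le> (\<Sum>j<n. norm (A $$ (i,j)) * (M * L ^ k))"
        unfolding mult_mat_vec_index_sum[OF A x i]
        by (rule order_trans[OF norm_sum], intro sum_mono)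
          (simp add: norm_mult mult_left_mono Suc.IH)
      also have "\<dots> = (\<Sum>j<n. norm (A $$ (i,j))) * (M * L ^ k)" by (simp add: sum_distrib_right)
      also have "(\<Sum>j<n. norm (A $$ (i,j))) \<le> L - 1"
        unfolding L_def using i
        by (simp, intro member_le_sum[of i "{..<n}" "\<lambda>i. \<Sum>j<n. norm (A $$ (i,j))"])
          (auto intro: sum_nonneg)
      then have "(\<Sum>j<n. norm (A $$ (i,j))) * (M * L ^ k) \<le> (L - 1) * (M * L ^ k)"
        using M L by (intro mult_right_mono) auto
      finally have 1: "norm ((A *\<^sub>v trajectory u k) $ i) \<le> (L - 1) * (M * L ^ k)" .
      have "M * 1 \<le> M * L ^ k" using M L by (intro mult_left_mono) auto
      then have 2: "norm ((B *\<^sub>v u k) $ i) \<le> M * L ^ k" using Bu[OF i, of k] by linarith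
      have "trajectory u (Suc k) $ i = (A *\<^sub>v trajectory u k) $ i + (B *\<^sub>v u k) $ i"
        using i A B by (simp add: step_def)
      then have "norm (trajectory u (Suc k) $ i) \<le> (L - 1) * (M * L ^ k) + M * L ^ k"
        using 1 2 norm_triangle_ineq[of "(A *\<^sub>v trajectory u k) $ i" "(B *\<^sub>v u k) $ i"] by simp
      then show "norm (trajectory u (Suc k) $ i) \<le> M * L ^ Suc k" by (simp add: algebra_simps)
    qed
  qed
  with M L show ?thesis by blast
qed

lemma trajectory_generating_function:
  assumes u: "\<And>k. u k \<in> carrier_vec m" and u0: "\<And>k. N \<le> k \<Longrightarrow> u k = 0\<^sub>v m"
  defines "U \<equiv> \<lambda>w. vec m (\<lambda>j. \<Sum>k<N. u k $ j * w ^ k)"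
  shows "\<exists>r>0. \<forall>w. norm w < r \<longrightarrow> (\<exists>X \<in> carrier_vec n. X = w \<cdot>\<^sub>v step X (U w) \<and>
    (\<forall>i<m. (\<lambda>k. out (trajectory u k) (u k) $ i * w ^ k) sums (out X (U w) $ i)))"
proof -
  obtain M L where M: "0 \<le> M" and L: "1 \<le> L"
    and bnd: "\<And>k i. i < n \<Longrightarrow> norm (trajectory u k $ i) \<le> M * L ^ k"
    using trajectory_geometric_bound[of u N, OF u u0] by blast
  have x: "trajectory u k \<in> carrier_vec n" for k using trajectory_carrier u .
  have "\<exists>X \<in> carrier_vec n. X = w \<cdot>\<^sub>v step X (U w) \<and>
    (\<forall>i<m. (\<lambda>k. out (trajectory u k) (u k) $ i * w ^ k) sums (out X (U w) $ i))"
    if w: "norm w < 1 / L" for w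
  proof -
    define X where "X = vec n (\<lambda>i. \<Sum>k. trajectory u k $ i * w ^ k)"
    have X: "X \<in> carrier_vec n" by (simp add: X_def)
    have Uc: "U w \<in> carrier_vec m" by (simp add: U_def)
    have Lw: "norm (L * norm w) < 1" using w L by (simp add: field_simps)
    have Xs: "(\<lambda>k. trajectory u k $ i * w ^ k) sums (X $ i)" if i: "i < n" for i
    proof -
      have "summable (\<lambda>k. M * (L * norm w) ^ k)"
        using Lw by (intro summable_mult summable_geometric)
      moreover have "norm (trajectory u k $ i * w ^ k) \<le> M * (L * norm w) ^ k" for k
        using mult_right_mono[OF bnd[OF i, of k], of "norm w ^ k"]
        by (simp add: norm_mult norm_power power_mult_distrib mult.assoc)
      ultimately have "summable (\<lambda>k. trajectory u k $ i * w ^ k)"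
        by (rule summable_comparison_test'[where N = 0])
      then show ?thesis using i by (simp add: X_def summable_sums)
    qed
    have Us: "(\<lambda>k. u k $ j * w ^ k) sums (U w $ j)" if j: "j < m" for j
      using sums_finite[of "{..<N}" "\<lambda>k. u k $ j * w ^ k"] j u0 by (simp add: U_def not_less)
    have lin: "(\<lambda>k. (E *\<^sub>v trajectory u k + G *\<^sub>v u k) $ i * w ^ k) sums ((E *\<^sub>v X + G *\<^sub>v U w) $ i)"
      if E: "E \<in> carrier_mat l n" and G: "G \<in> carrier_mat l m" and i: "i < l" for E G l i
    proof -
      have "(\<lambda>k. (\<Sum>j<n. E $$ (i,j) * (trajectory u k $ j * w ^ k)) + (\<Sum>j<m. G $$ (i,j) * (u k $ j * w ^ k)))
        sums ((\<Sum>j<n. E $$ (i,j) * X $ j) + (\<Sum>j<m. G $$ (i,j) * U w $ j))"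
        by (intro sums_add sums_sum sums_mult Xs Us) auto
      then show ?thesis
        using i mult_mat_vec_index_sum[OF E X i] mult_mat_vec_index_sum[OF G Uc i]
          mult_mat_vec_index_sum[OF E x i] mult_mat_vec_index_sum[OF G u i] E G
        by (simp add: sum_distrib_right distrib_right mult.assoc)
    qed
    have "X $ i = w * step X (U w) $ i" if i: "i < n" for i
    proof -
      have "(\<lambda>k. w * (step (trajectory u k) (u k) $ i * w ^ k)) sums (w * step X (U w) $ i)"
        unfolding step_def by (intro sums_mult lin[OF A B i])
      then have "(\<lambda>k. trajectory u (Suc k) $ i * w ^ Suc k) sums (w * step X (U w) $ i)"
        by (simp add: mult_ac)
      then have "(\<lambda>k. trajectory u k $ i * w ^ k) sums (w * step X (U w) $ i)"
        using i by (intro sums_Suc_imp[of "\<lambda>k. trajectory u k $ i * w ^ k"]) simp_all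
      then show ?thesis using Xs[OF i] sums_unique2 by blast
    qed
    moreover have "dim_vec (step X (U w)) = n" using step_carrier[OF X Uc] by simp
    ultimately have "X = w \<cdot>\<^sub>v step X (U w)" using X by (intro eq_vecI) auto
    moreover have "(\<lambda>k. out (trajectory u k) (u k) $ i * w ^ k) sums (out X (U w) $ i)" if i: "i < m" for i
      unfolding out_def by (rule lin[OF C D i])
    ultimately show ?thesis using X by blast
  qed
  moreover have "0 < 1 / L" using L by simp
  ultimately show ?thesis by blast
qed

text \<open>The passage from the frequency domain to the time domain. The function \<open>G\<close> is the transfer
  function in the variable \<open>w\<close>; near \<open>0\<close> it is characterized by its action on stationary
  solutions \<open>x = w (A x + B v)\<close>, a form that applies both to discrete-time systems and to Cayley
  transforms without mentioning an inverse matrix.\<close>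

lemma zero_state_dissipative:
  assumes c: "0 \<le> c"
    and G: "\<And>w. G w \<in> carrier_mat m m"
    and hol: "\<And>i j. i < m \<Longrightarrow> j < m \<Longrightarrow> (\<lambda>w. G w $$ (i,j)) holomorphic_on ball 0 1 - {0}"
    and rep: "\<exists>r>0. \<forall>w. 0 < norm w \<longrightarrow> norm w < r \<longrightarrow> (\<forall>v \<in> carrier_vec m. \<forall>x \<in> carrier_vec n.
        x = w \<cdot>\<^sub>v step x v \<longrightarrow> G w *\<^sub>v v = out x v)"
    and diss: "\<And>w v. 0 < norm w \<Longrightarrow> norm w < 1 \<Longrightarrow> v \<in> carrier_vec m \<Longrightarrow> 0 \<le> supply_rate a b c v (G w *\<^sub>v v)"
    and u: "\<And>k. u k \<in> carrier_vec m" and u0: "\<And>k. N \<le> k \<Longrightarrow> u k = 0\<^sub>v m"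
  shows "0 \<le> (\<Sum>k<N. supply_rate a b c (u k) (out (trajectory u k) (u k)))"
proof -
  define U where "U w = vec m (\<lambda>j. \<Sum>k<N. u k $ j * w ^ k)" for w
  define y where "y k = out (trajectory u k) (u k)" for k
  have x: "trajectory u k \<in> carrier_vec n" for k using trajectory_carrier u .
  have y: "y k \<in> carrier_vec m" for k unfolding y_def using x u by auto
  have Uc: "U w \<in> carrier_vec m" for w by (simp add: U_def)
  obtain r1 where r1: "0 < r1" and rep': "\<And>w v x. 0 < norm w \<Longrightarrow> norm w < r1 \<Longrightarrow> v \<in> carrier_vec m \<Longrightarrow>
      x \<in> carrier_vec n \<Longrightarrow> x = w \<cdot>\<^sub>v step x v \<Longrightarrow> G w *\<^sub>v v = out x v"
    using rep by blast
  obtain r2 where r2: "0 < r2" and gen: "\<And>w. norm w < r2 \<Longrightarrow> \<exists>X \<in> carrier_vec n. X = w \<cdot>\<^sub>v step X (U w) \<and>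
    (\<forall>i<m. (\<lambda>k. y k $ i * w ^ k) sums (out X (U w) $ i))"
    using trajectory_generating_function[of u N, OF u u0] unfolding U_def y_def by blast
  have ser: "(\<lambda>k. y k $ i * w ^ k) sums ((G w *\<^sub>v U w) $ i)"
    if i: "i < m" and w: "0 < norm w" "norm w < 1" for i w
  proof (rule power_series_continuation[of "\<lambda>w. (G w *\<^sub>v U w) $ i" "min r1 r2" "\<lambda>k. y k $ i", OF _ _ _ w])
    have "(\<lambda>w. \<Sum>j<m. G w $$ (i,j) * U w $ j) holomorphic_on ball 0 1 - {0}"
      unfolding U_def by (intro holomorphic_intros hol[OF i]) (auto intro!: holomorphic_intros)
    then show "(\<lambda>w. (G w *\<^sub>v U w) $ i) holomorphic_on ball 0 1 - {0}"
      using mult_mat_vec_index_sum[OF G Uc i] by simp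
    show "0 < min r1 r2" using r1 r2 by simp
    fix w :: complex assume w: "0 < norm w" "norm w < min r1 r2"
    then obtain X where X: "X \<in> carrier_vec n" "X = w \<cdot>\<^sub>v step X (U w)"
      and s: "\<And>i. i < m \<Longrightarrow> (\<lambda>k. y k $ i * w ^ k) sums (out X (U w) $ i)"
      using gen[of w] by auto
    have "G w *\<^sub>v U w = out X (U w)" using rep'[of w "U w" X] w Uc X by auto
    then show "(\<lambda>k. y k $ i * w ^ k) sums ((G w *\<^sub>v U w) $ i)" using s[OF i] by simp
  qed
  have circ: "0 \<le> (\<Sum>k<N. \<Sum>i<m. scalar_supply a b c (u k $ i) (y k $ i) * \<rho> ^ (2 * k))"
    if \<rho>: "0 < \<rho>" "\<rho> < 1" for \<rho>
  proof -
    \<comment> \<open>Entries of a vector beyond its dimension are unspecified, hence the cut-off.\<close>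
    define u' where "u' k i = (if i < m then u k $ i else 0)" for k i
    have "0 \<le> (\<Sum>k<N. \<Sum>i<m. scalar_supply a b c (u' k i) (y k $ i) * \<rho> ^ (2 * k))"
    proof (rule supply_sum_nonneg_on_circle[OF c \<rho>(1)])
      show "u' k i = 0" if "N \<le> k" for k i using u0[OF that] by (simp add: u'_def)
      show "summable (\<lambda>k. norm (y k $ i) * \<rho> ^ k)" if i: "i < m" for i
      proof -
        obtain \<rho>' where \<rho>': "\<rho> < \<rho>'" "\<rho>' < 1" using dense[OF \<rho>(2)] by blast
        have "summable (\<lambda>k. y k $ i * of_real \<rho>' ^ k)"
          using ser[OF i, of "of_real \<rho>'"] \<rho> \<rho>' by (simp add: sums_iff)
        then have "summable (\<lambda>k. norm (y k $ i * of_real \<rho> ^ k))"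
          by (rule powser_insidea) (use \<rho> \<rho>' in simp)
        then show ?thesis using \<rho> by (simp add: norm_mult norm_power)
      qed
      show "0 \<le> (\<Sum>i<m. scalar_supply a b c (\<Sum>k<N. u' k i * w ^ k) (\<Sum>k. y k $ i * w ^ k))"
        if w: "norm w = \<rho>" for w
      proof -
        have "0 \<le> supply_rate a b c (U w) (G w *\<^sub>v U w)" using diss[of w "U w"] w \<rho> Uc by simp
        also have "\<dots> = (\<Sum>i<m. scalar_supply a b c (U w $ i) ((G w *\<^sub>v U w) $ i))"
          by (rule supply_eq_sum[OF Uc mult_mat_vec_carrier[OF G Uc]])
        also have "\<dots> = (\<Sum>i<m. scalar_supply a b c (\<Sum>k<N. u' k i * w ^ k) (\<Sum>k. y k $ i * w ^ k))"
          using ser[of _ w] w \<rho> by (intro sum.cong refl) (simp add: U_def u'_def sums_iff)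
        finally show ?thesis .
      qed
    qed
    then show ?thesis by (simp add: u'_def)
  qed
  \<comment> \<open>The radius can now tend to 1, because only finitely many terms are left.\<close>
  define S where "S \<rho> = (\<Sum>k<N. \<Sum>i<m. scalar_supply a b c (u k $ i) (y k $ i) * \<rho> ^ (2 * k))" for \<rho>
  have "(S \<longlongrightarrow> S 1) (at_left 1)"
    unfolding S_def by (intro tendsto_intros)
  moreover have "\<forall>\<^sub>F \<rho> in at_left 1. 0 \<le> S \<rho>"
    using circ eventually_at_left_real[of 0 1] by (auto simp: S_def elim!: eventually_mono)
  ultimately have "0 \<le> S 1" by (intro tendsto_lowerbound) auto
  also have "S 1 = (\<Sum>k<N. supply_rate a b c (u k) (y k))"
    by (simp add: S_def supply_eq_sum[OF u y])
  finally show ?thesis by (simp add: y_def)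
qed

end

section \<open>Injective matrices and subspaces\<close>

definition inj_mat :: "complex mat \<Rightarrow> bool" where
  "inj_mat T \<longleftrightarrow> (\<forall>v \<in> carrier_vec (dim_col T). T *\<^sub>v v = 0\<^sub>v (dim_row T) \<longrightarrow> v = 0\<^sub>v (dim_col T))"

lemma mult_unit_vec_eq_col:
  "(M :: complex mat) \<in> carrier_mat k l \<Longrightarrow> j < l \<Longrightarrow> M *\<^sub>v unit_vec l j = col M j"
  by (intro eq_vecI) auto

lemma inverse_of_det_nonzero:
  fixes M :: "complex mat"
  assumes M: "M \<in> carrier_mat k k" and d: "det M \<noteq> 0"
  defines "N \<equiv> (1 / det M) \<cdot>\<^sub>m adj_mat M"
  shows "N \<in> carrier_mat k k" "M * N = 1\<^sub>m k" "N * M = 1\<^sub>m k"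
proof -
  note a = adj_mat[OF M]
  show "N \<in> carrier_mat k k" using a by (simp add: N_def)
  have e: "(1 / det M) \<cdot>\<^sub>m (det M \<cdot>\<^sub>m 1\<^sub>m k) = 1\<^sub>m k" using d by (intro eq_matI) auto
  show "M * N = 1\<^sub>m k" unfolding N_def mult_smult_distrib[OF M a(1)] a(2) by (rule e)
  show "N * M = 1\<^sub>m k" unfolding N_def mult_smult_assoc_mat[OF a(1) M] a(3) by (rule e)
qed

lemma inj_mat_square_inverse:
  assumes M: "M \<in> carrier_mat k k" and i: "inj_mat M"
  obtains N where "N \<in> carrier_mat k k" "M * N = 1\<^sub>m k" "N * M = 1\<^sub>m k"
proof -
  have "det M \<noteq> 0" using det_0_iff_vec_prod_zero[OF M] i M by (auto simp: inj_mat_def)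
  then show ?thesis using inverse_of_det_nonzero[OF M] that by blast
qed

text \<open>A matrix with more columns than rows has a nonzero kernel: completed by zero rows to a square
  matrix it has determinant \<open>0\<close>.\<close>

lemma inj_mat_dim_le:
  assumes T: "T \<in> carrier_mat k r" and i: "inj_mat T"
  shows "r \<le> k"
proof (rule ccontr)
  assume r: "\<not> r \<le> k"
  \<comment> \<open>The transpose of \<open>M\<close> annihilates the unit vector with index \<open>k\<close>, the first row that was added.\<close>
  define M where "M = mat r r (\<lambda>(i,j). if i < k then T $$ (i,j) else 0)"
  have M: "M \<in> carrier_mat r r" by (simp add: M_def)
  have "M\<^sup>T *\<^sub>v unit_vec r k = 0\<^sub>v r"
    using r M by (subst mult_unit_vec_eq_col[of _ r]) (auto intro!: eq_vecI simp: M_def)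
  moreover have "unit_vec r k \<noteq> (0\<^sub>v r :: complex vec)" using r by simp
  ultimately have "det M\<^sup>T = 0"
    using det_0_iff_vec_prod_zero[OF transpose_carrier_mat[THEN iffD2, OF M]] unit_vec_carrier by blast
  then have "det M = 0" using det_transpose[OF M] by simp
  then obtain v where v: "v \<in> carrier_vec r" "v \<noteq> 0\<^sub>v r" "M *\<^sub>v v = 0\<^sub>v r"
    using det_0_iff_vec_prod_zero[OF M] by blast
  have "T *\<^sub>v v = 0\<^sub>v k"
  proof (rule eq_vecI)
    fix i assume "i < dim_vec (0\<^sub>v k)"
    then have i: "i < k" by simp
    have "(T *\<^sub>v v) $ i = (M *\<^sub>v v) $ i"
      using i r by (simp add: mult_mat_vec_index_sum[OF T v(1)] mult_mat_vec_index_sum[OF M v(1)] del: index_mult_mat_vec)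
        (simp add: M_def)
    then show "(T *\<^sub>v v) $ i = 0\<^sub>v k $ i" using v(3) i r by simp
  qed (use T in simp)
  then show False using i v T by (auto simp: inj_mat_def)
qed

text \<open>A basis of a subspace, written as the columns of a matrix: among the injective matrices with range
  inside the subspace one with the most columns must exhaust it, because any missing vector could
  be appended as a further column.\<close>

lemma subspace_eq_range_inj_mat:
  assumes W: "W \<subseteq> carrier_vec k" and z: "0\<^sub>v k \<in> W"
    and add: "\<And>v w. v \<in> W \<Longrightarrow> w \<in> W \<Longrightarrow> v + w \<in> W"
    and smult: "\<And>l v. v \<in> W \<Longrightarrow> l \<cdot>\<^sub>v v \<in> W"
  obtains r T where "T \<in> carrier_mat k r" "inj_mat T" "W = (\<lambda>v. T *\<^sub>v v) ` carrier_vec r"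
proof -
  define Q where "Q r \<longleftrightarrow> (\<exists>T \<in> carrier_mat k r. inj_mat T \<and> (\<lambda>v. T *\<^sub>v v) ` carrier_vec r \<subseteq> W)" for r
  have "0\<^sub>m k 0 *\<^sub>v v = 0\<^sub>v k" if "v \<in> carrier_vec 0" for v :: "complex vec"
    using that by (intro eq_vecI) (auto simp: scalar_prod_def)
  then have "Q 0" unfolding Q_def
    by (intro bexI[of _ "0\<^sub>m k 0"]) (auto simp: z inj_mat_def)
  moreover have "Q r \<Longrightarrow> r \<le> k" for r using inj_mat_dim_le by (auto simp: Q_def)
  ultimately obtain r where r: "Q r" "\<And>s. Q s \<Longrightarrow> s \<le> r"
    using Nat.ex_has_greatest_nat[of Q 0 k] by blast
  then obtain T where T: "T \<in> carrier_mat k r" "inj_mat T" "(\<lambda>v. T *\<^sub>v v) ` carrier_vec r \<subseteq> W"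
    by (auto simp: Q_def)
  have "W \<subseteq> (\<lambda>v. T *\<^sub>v v) ` carrier_vec r"
  proof
    fix w assume w: "w \<in> W"
    then have wc: "w \<in> carrier_vec k" using W by auto
    show "w \<in> (\<lambda>v. T *\<^sub>v v) ` carrier_vec r"
    proof (rule ccontr)
      assume nw: "w \<notin> (\<lambda>v. T *\<^sub>v v) ` carrier_vec r"
      define T' where "T' = mat k (Suc r) (\<lambda>(i,j). if j < r then T $$ (i,j) else w $ i)"
      have T': "T' \<in> carrier_mat k (Suc r)" by (simp add: T'_def)
      define h where "h v = vec r (\<lambda>i. v $ i)" for v :: "complex vec"
      have h: "h v \<in> carrier_vec r" for v by (simp add: h_def)
      have eq: "T' *\<^sub>v v = T *\<^sub>v h v + v $ r \<cdot>\<^sub>v w" if v: "v \<in> carrier_vec (Suc r)" for v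
      proof (rule eq_vecI)
        fix i assume "i < dim_vec (T *\<^sub>v h v + v $ r \<cdot>\<^sub>v w)"
        then have i: "i < k" using wc by simp
        have "(T' *\<^sub>v v) $ i = (\<Sum>j<r. T $$ (i,j) * h v $ j) + w $ i * v $ r"
          using i unfolding mult_mat_vec_index_sum[OF T' v i] by (simp add: T'_def h_def)
        then show "(T' *\<^sub>v v) $ i = (T *\<^sub>v h v + v $ r \<cdot>\<^sub>v w) $ i"
          using mult_mat_vec_index_sum[OF T(1) h i] i wc T(1) by (simp del: index_mult_mat_vec)
      qed (use T(1) T' wc in simp)
      have "v = 0\<^sub>v (Suc r)" if v: "v \<in> carrier_vec (Suc r)" and 0: "T' *\<^sub>v v = 0\<^sub>v k" for v
      proof -
        have vr: "v $ r = 0"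
        proof (rule ccontr)
          assume vr: "v $ r \<noteq> 0"
          \<comment> \<open>A relation that involves the new column would put \<open>w\<close> into the range of \<open>T\<close>.\<close>
          have "w = T *\<^sub>v ((- 1 / v $ r) \<cdot>\<^sub>v h v)"
          proof (rule eq_vecI)
            fix i assume "i < dim_vec (T *\<^sub>v ((- 1 / v $ r) \<cdot>\<^sub>v h v))"
            then have i: "i < k" using T(1) by simp
            have "(T *\<^sub>v h v) $ i + v $ r * w $ i = (T' *\<^sub>v v) $ i"
              unfolding eq[OF v] using i wc T(1) by simp
            also have "\<dots> = 0" unfolding 0 using i by simp
            finally have "w $ i = (- 1 / v $ r) * (T *\<^sub>v h v) $ i"
              using vr by (simp add: field_simps add_eq_0_iff)
            then show "w $ i = (T *\<^sub>v ((- 1 / v $ r) \<cdot>\<^sub>v h v)) $ i"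
              unfolding mult_mat_vec[OF T(1) h] using i T(1) by simp
          qed (use T(1) wc in simp)
          then show False using nw h by auto
        qed
        then have "T *\<^sub>v h v = 0\<^sub>v k"
          using eq[OF v] 0 wc T(1) by auto
        then have "h v = 0\<^sub>v r" using T h by (auto simp: inj_mat_def)
        then have "v $ i = 0" if "i < r" for i
          using that by (metis h_def index_vec index_zero_vec(1))
        then show ?thesis using vr v by (intro eq_vecI) (auto simp: less_Suc_eq)
      qed
      then have "inj_mat T'" using T' by (auto simp: inj_mat_def)
      moreover have "(\<lambda>v. T' *\<^sub>v v) ` carrier_vec (Suc r) \<subseteq> W"
        using T(3) h eq by (auto intro!: add smult w)
      ultimately have "Q (Suc r)" using T' by (auto simp: Q_def)
      then show False using r(2)[of "Suc r"] by simp
    qed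
  qed
  with T that show ?thesis by blast
qed

lemma factor_through_range:
  fixes T X :: "complex mat"
  assumes T: "T \<in> carrier_mat k r" and X: "X \<in> carrier_mat k l"
    and sub: "\<And>v. v \<in> carrier_vec l \<Longrightarrow> X *\<^sub>v v \<in> (\<lambda>v. T *\<^sub>v v) ` carrier_vec r"
  obtains Y where "Y \<in> carrier_mat r l" "X = T * Y"
proof -
  have "\<forall>j. \<exists>y. j < l \<longrightarrow> y \<in> carrier_vec r \<and> X *\<^sub>v unit_vec l j = T *\<^sub>v y"
    using sub by (metis imageE unit_vec_carrier)
  then obtain y where y: "\<And>j. j < l \<Longrightarrow> y j \<in> carrier_vec r"
      "\<And>j. j < l \<Longrightarrow> X *\<^sub>v unit_vec l j = T *\<^sub>v y j" by metis
  define Y where "Y = mat r l (\<lambda>(i,j). y j $ i)"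
  have Y: "Y \<in> carrier_mat r l" by (simp add: Y_def)
  have cY: "col Y j = y j" if "j < l" for j using y(1)[OF that] that by (auto simp: Y_def)
  have "X = T * Y"
  proof (rule eq_matI)
    fix i j assume "i < dim_row (T * Y)" "j < dim_col (T * Y)"
    then have ij: "i < k" "j < l" using T Y by auto
    have "X $$ (i,j) = (X *\<^sub>v unit_vec l j) $ i"
      using ij X unfolding mult_unit_vec_eq_col[OF X ij(2)] by simp
    also have "\<dots> = (T * Y) $$ (i,j)" unfolding y(2)[OF ij(2)] cY[OF ij(2), symmetric] using ij T Y by simp
    finally show "X $$ (i,j) = (T * Y) $$ (i,j)" .
  qed (use X T Y in auto)
  with Y that show ?thesis by blast
qed

section \<open>Reachable and unobservable states\<close>

text \<open>Controllability, stated as the absence of a proper subspace that is invariant under \<open>A\<close> and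
  contains the range of \<open>B\<close>. The subspace is the range of \<open>T\<close>, and \<open>A'\<close>, \<open>B'\<close> describe the
  restricted system in the coordinates given by \<open>T\<close>; so a failure directly exhibits a smaller
  realization. Observability of \<open>(C, A)\<close> is controllability of the transposed pair.\<close>

definition controllable_pair :: "nat \<Rightarrow> nat \<Rightarrow> complex mat \<Rightarrow> complex mat \<Rightarrow> bool" where
  "controllable_pair n m A B \<longleftrightarrow> (\<forall>r T A' B'. T \<in> carrier_mat n r \<longrightarrow> A' \<in> carrier_mat r r \<longrightarrow>
     B' \<in> carrier_mat r m \<longrightarrow> inj_mat T \<longrightarrow> A * T = T * A' \<longrightarrow> B = T * B' \<longrightarrow> n \<le> r)"

context linear_system
begin

primrec final :: "complex vec \<Rightarrow> complex vec list \<Rightarrow> complex vec" where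
  "final x [] = x"
| "final x (u # us) = final (step x u) us"

abbreviation inputs :: "complex vec list set" where
  "inputs \<equiv> {us. set us \<subseteq> carrier_vec m}"

lemma step_add:
  assumes "x \<in> carrier_vec n" "x' \<in> carrier_vec n" "u \<in> carrier_vec m" "u' \<in> carrier_vec m"
  shows "step (x + x') (u + u') = step x u + step x' u'"
    and "step (x - x') (u - u') = step x u - step x' u'"
    and "out (x + x') (u + u') = out x u + out x' u'"
    and "out (x - x') (u - u') = out x u - out x' u'"
proof -
  have "E *\<^sub>v (x + x') + G *\<^sub>v (u + u') = (E *\<^sub>v x + G *\<^sub>v u) + (E *\<^sub>v x' + G *\<^sub>v u')"
    and "E *\<^sub>v (x - x') + G *\<^sub>v (u - u') = (E *\<^sub>v x + G *\<^sub>v u) - (E *\<^sub>v x' + G *\<^sub>v u')"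
    if E: "E \<in> carrier_mat l n" and G: "G \<in> carrier_mat l m" for E G :: "complex mat" and l
    unfolding mult_add_distrib_mat_vec[OF E assms(1,2)] mult_add_distrib_mat_vec[OF G assms(3,4)]
      mult_minus_distrib_mat_vec[OF E assms(1,2)] mult_minus_distrib_mat_vec[OF G assms(3,4)]
    using E G by (intro eq_vecI; simp)+
  note lin = this
  show "step (x + x') (u + u') = step x u + step x' u'" "step (x - x') (u - u') = step x u - step x' u'"
    "out (x + x') (u + u') = out x u + out x' u'" "out (x - x') (u - u') = out x u - out x' u'"
    unfolding step_def out_def by (rule lin[OF A B] lin[OF C D])+
qed

lemma step_smult:
  assumes "x \<in> carrier_vec n" "u \<in> carrier_vec m"
  shows "step (l \<cdot>\<^sub>v x) (l \<cdot>\<^sub>v u) = l \<cdot>\<^sub>v step x u"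
    and "out (l \<cdot>\<^sub>v x) (l \<cdot>\<^sub>v u) = l \<cdot>\<^sub>v out x u"
  unfolding step_def out_def mult_mat_vec[OF A assms(1)] mult_mat_vec[OF B assms(2)]
    mult_mat_vec[OF C assms(1)] mult_mat_vec[OF D assms(2)]
  using A B C D by (intro eq_vecI; simp add: distrib_left)+

lemma step_zero: "step (0\<^sub>v n) (0\<^sub>v m) = 0\<^sub>v n"
  using A B by (auto intro!: eq_vecI simp: step_def)

lemma final_carrier: "x \<in> carrier_vec n \<Longrightarrow> us \<in> inputs \<Longrightarrow> final x us \<in> carrier_vec n"
  by (induction us arbitrary: x) auto

lemma final_append: "final x (us @ vs) = final (final x us) vs"
  by (induction us arbitrary: x) auto

lemma final_add:
  "length us = length vs \<Longrightarrow> x \<in> carrier_vec n \<Longrightarrow> y \<in> carrier_vec n \<Longrightarrow> us \<in> inputs \<Longrightarrow> vs \<in> inputs \<Longrightarrow>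
   final (x + y) (map2 (+) us vs) = final x us + final y vs"
proof (induction us vs arbitrary: x y rule: list_induct2)
  case (Cons u us v vs)
  have "final (step x u + step y v) (map2 (+) us vs) = final (step x u) us + final (step y v) vs"
    using Cons.prems by (intro Cons.IH) auto
  then show ?case using Cons.prems by (simp add: step_add(1))
qed simp

lemma final_smult:
  "x \<in> carrier_vec n \<Longrightarrow> us \<in> inputs \<Longrightarrow> final (l \<cdot>\<^sub>v x) (map ((\<cdot>\<^sub>v) l) us) = l \<cdot>\<^sub>v final x us"
  by (induction us arbitrary: x) (auto simp: step_smult)

lemma final_zero_replicate: "final (0\<^sub>v n) (replicate k (0\<^sub>v m)) = 0\<^sub>v n"
  by (induction k) (auto simp: step_zero)

lemma set_map2_carrier:
  assumes "us \<in> inputs" "vs \<in> inputs"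
  shows "map2 (+) us vs \<in> inputs" "map2 (-) us vs \<in> inputs"
proof -
  have "u \<in> carrier_vec m \<and> v \<in> carrier_vec m" if "(u, v) \<in> set (zip us vs)" for u v
    using set_zip_leftD[OF that] set_zip_rightD[OF that] assms by blast
  then show "map2 (+) us vs \<in> inputs" "map2 (-) us vs \<in> inputs" by auto
qed

text \<open>The reachable states form a subspace that is invariant under \<open>A\<close> and contains the range of
  \<open>B\<close>.\<close>

lemma reachable_set_eq_carrier:
  assumes ctrb: "controllable_pair n m A B"
  shows "final (0\<^sub>v n) ` inputs = carrier_vec n"
proof -
  let ?W = "final (0\<^sub>v n) ` inputs"
  have z: "0\<^sub>v n \<in> ?W" by (rule image_eqI[of _ _ "[]"]) auto
  have add: "v + w \<in> ?W" if v: "v \<in> ?W" and w: "w \<in> ?W" for v w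
  proof -
    obtain us where us: "us \<in> inputs" "v = final (0\<^sub>v n) us" using v by blast
    obtain vs where vs: "vs \<in> inputs" "w = final (0\<^sub>v n) vs" using w by blast
    \<comment> \<open>Inputs of different lengths are aligned at their ends: under zero input the system stays at rest.\<close>
    let ?us = "replicate (length vs) (0\<^sub>v m) @ us" and ?vs = "replicate (length us) (0\<^sub>v m) @ vs"
    have i: "?us \<in> inputs" "?vs \<in> inputs" using us vs by auto
    have "v + w = final (0\<^sub>v n) ?us + final (0\<^sub>v n) ?vs"
      by (simp add: final_append final_zero_replicate us vs)
    also have "\<dots> = final (0\<^sub>v n + 0\<^sub>v n) (map2 (+) ?us ?vs)" using i by (subst final_add) auto
    finally show ?thesis using set_map2_carrier(1)[OF i] by auto
  qed
  have smult: "l \<cdot>\<^sub>v v \<in> ?W" if v: "v \<in> ?W" for l v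
  proof -
    obtain us where us: "us \<in> inputs" "v = final (0\<^sub>v n) us" using v by blast
    have "l \<cdot>\<^sub>v v = final (l \<cdot>\<^sub>v 0\<^sub>v n) (map ((\<cdot>\<^sub>v) l) us)" using us by (simp add: final_smult)
    moreover have "l \<cdot>\<^sub>v 0\<^sub>v n = 0\<^sub>v n" by auto
    ultimately have "l \<cdot>\<^sub>v v = final (0\<^sub>v n) (map ((\<cdot>\<^sub>v) l) us)" by simp
    moreover have "map ((\<cdot>\<^sub>v) l) us \<in> inputs" using us(1) by auto
    ultimately show ?thesis by (rule image_eqI)
  qed
  have stp: "step x u \<in> ?W" if x: "x \<in> ?W" and u: "u \<in> carrier_vec m" for x u
  proof -
    obtain us where us: "us \<in> inputs" "x = final (0\<^sub>v n) us" using x by blast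
    then show ?thesis using u by (intro image_eqI[of _ _ "us @ [u]"]) (auto simp: final_append)
  qed
  have W: "?W \<subseteq> carrier_vec n" using final_carrier by auto
  obtain r T where T: "T \<in> carrier_mat n r" "inj_mat T" and WT: "?W = (\<lambda>v. T *\<^sub>v v) ` carrier_vec r"
    using subspace_eq_range_inj_mat[OF W z add smult] by metis
  have "(A * T) *\<^sub>v v \<in> (\<lambda>v. T *\<^sub>v v) ` carrier_vec r" if v: "v \<in> carrier_vec r" for v
  proof -
    have "T *\<^sub>v v \<in> ?W" using WT v by blast
    then have "step (T *\<^sub>v v) (0\<^sub>v m) \<in> ?W" using stp by simp
    moreover have "step (T *\<^sub>v v) (0\<^sub>v m) = (A * T) *\<^sub>v v"
      using A B T v by (auto simp: step_def assoc_mult_mat_vec[OF A T(1) v] intro!: eq_vecI)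
    ultimately show ?thesis using WT by simp
  qed
  then obtain A' where A': "A' \<in> carrier_mat r r" "A * T = T * A'"
    using factor_through_range[OF T(1) mult_carrier_mat[OF A T(1)]] by metis
  have "B *\<^sub>v v \<in> (\<lambda>v. T *\<^sub>v v) ` carrier_vec r" if v: "v \<in> carrier_vec m" for v
  proof -
    have "step (0\<^sub>v n) v \<in> ?W" using stp z v by simp
    moreover have "step (0\<^sub>v n) v = B *\<^sub>v v" using A B v by (auto simp: step_def intro!: eq_vecI)
    ultimately show ?thesis using WT by simp
  qed
  then obtain B' where B': "B' \<in> carrier_mat r m" "B = T * B'"
    using factor_through_range[OF T(1) B] by metis
  have "n \<le> r" using ctrb T A' B' unfolding controllable_pair_def by blast
  then have rn: "r = n" using inj_mat_dim_le[OF T] by simp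
  then obtain N where N: "N \<in> carrier_mat n n" "T * N = 1\<^sub>m n"
    using inj_mat_square_inverse T by metis
  have "x \<in> ?W" if x: "x \<in> carrier_vec n" for x
  proof -
    have "T *\<^sub>v (N *\<^sub>v x) = x" using assoc_mult_mat_vec[of T n n N n x] N T x rn by simp
    moreover have "N *\<^sub>v x \<in> carrier_vec r" using N x rn by simp
    ultimately show ?thesis unfolding WT by (metis imageI)
  qed
  with W show ?thesis by blast
qed

end

text \<open>Duality: the states without output under zero input are orthogonal (for the bilinear product) to
  everything that is reachable in the transposed system.\<close>

lemma (in linear_system) zero_output_imp_zero_state:
  assumes obs: "controllable_pair n m A\<^sup>T C\<^sup>T"
    and x: "x \<in> carrier_vec n" and out0: "\<And>k. C *\<^sub>v final x (replicate k (0\<^sub>v m)) = 0\<^sub>v m"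
  shows "x = 0\<^sub>v n"
proof -
  interpret dual: linear_system n m "A\<^sup>T" "C\<^sup>T" "B\<^sup>T" "D\<^sup>T"
    using A B C D by unfold_locales auto
  define N where "N = {x \<in> carrier_vec n. \<forall>k. C *\<^sub>v final x (replicate k (0\<^sub>v m)) = 0\<^sub>v m}"
  have N_A: "A *\<^sub>v z \<in> N" and N_C: "C *\<^sub>v z = 0\<^sub>v m" and N_c: "z \<in> carrier_vec n" if "z \<in> N" for z
  proof -
    show c: "z \<in> carrier_vec n" using that by (simp add: N_def)
    have z: "\<And>k. C *\<^sub>v final z (replicate k (0\<^sub>v m)) = 0\<^sub>v m" using that by (simp add: N_def)
    from z[of 0] show "C *\<^sub>v z = 0\<^sub>v m" by simp
    have "step z (0\<^sub>v m) = A *\<^sub>v z" using A B c by (auto simp: step_def intro!: eq_vecI)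
    then have "C *\<^sub>v final (A *\<^sub>v z) (replicate k (0\<^sub>v m)) = 0\<^sub>v m" for k using z[of "Suc k"] by simp
    then show "A *\<^sub>v z \<in> N" using A c by (simp add: N_def)
  qed
  have orth: "\<forall>z \<in> N. dual.final w us \<bullet> z = 0"
    if "us \<in> inputs" "w \<in> carrier_vec n" "\<forall>z \<in> N. w \<bullet> z = 0" for us w
    using that
  proof (induction us arbitrary: w)
    case Nil then show ?case by simp
  next
    case (Cons u us)
    have u: "u \<in> carrier_vec m" using Cons.prems by simp
    have "dual.step w u \<bullet> z = 0" if z: "z \<in> N" for z
    proof -
      have "dual.step w u \<bullet> z = (A\<^sup>T *\<^sub>v w) \<bullet> z + (C\<^sup>T *\<^sub>v u) \<bullet> z"
        unfolding dual.step_def using A C Cons.prems(2) u N_c[OF z]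
        by (intro add_scalar_prod_distrib[of _ n]) auto
      also have "\<dots> = w \<bullet> (A *\<^sub>v z) + u \<bullet> (C *\<^sub>v z)"
        using transpose_vec_mult_scalar[OF A N_c[OF z] Cons.prems(2)]
          transpose_vec_mult_scalar[OF C N_c[OF z] u] by simp
      also have "\<dots> = 0" using Cons.prems(3) N_A[OF z] N_C[OF z] u by simp
      finally show ?thesis .
    qed
    then show ?case using Cons.IH[of "dual.step w u"] Cons.prems u by auto
  qed
  have xN: "x \<in> N" using x out0 by (simp add: N_def)
  have "v \<bullet> x = 0" if v: "v \<in> carrier_vec n" for v
  proof -
    obtain us where "us \<in> inputs" "v = dual.final (0\<^sub>v n) us"
      using v unfolding dual.reachable_set_eq_carrier[OF obs, symmetric] by blast
    then show ?thesis using orth[of us "0\<^sub>v n"] xN N_c by auto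
  qed
  then have "x $ i = 0" if "i < n" for i using x that by (metis scalar_prod_left_unit unit_vec_carrier)
  then show ?thesis using x by (intro eq_vecI) auto
qed

section \<open>Available storage and the discrete-time lemma\<close>

lemma norm_parallelogram_complex:
  "(norm (p + q))\<^sup>2 + (norm (p - q))\<^sup>2 = 2 * (norm p)\<^sup>2 + 2 * (norm (q :: complex))\<^sup>2"
  unfolding cmod_power2 by (simp add: power2_eq_square algebra_simps)

lemma scalar_supply_parallelogram:
  "scalar_supply a b c (p + p') (q + q') + scalar_supply a b c (p - p') (q - q')
   = 2 * scalar_supply a b c p q + 2 * scalar_supply a b c p' q'"
proof -
  have "Re ((q + q') * cnj (p + p')) + Re ((q - q') * cnj (p - p')) = 2 * Re (q * cnj p) + 2 * Re (q' * cnj p')"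
    by (simp add: algebra_simps)
  then have "2 * b * Re ((q + q') * cnj (p + p')) + 2 * b * Re ((q - q') * cnj (p - p'))
      = 2 * (2 * b * Re (q * cnj p)) + 2 * (2 * b * Re (q' * cnj p'))"
    unfolding distrib_left[symmetric] by (simp only: mult.left_commute distrib_left)
  moreover have "a * (norm (p + p'))\<^sup>2 + a * (norm (p - p'))\<^sup>2 = 2 * (a * (norm p)\<^sup>2) + 2 * (a * (norm p')\<^sup>2)"
    unfolding distrib_left[symmetric] norm_parallelogram_complex by (simp add: algebra_simps)
  moreover have "c * (norm (q + q'))\<^sup>2 + c * (norm (q - q'))\<^sup>2 = 2 * (c * (norm q)\<^sup>2) + 2 * (c * (norm q')\<^sup>2)"
    unfolding distrib_left[symmetric] norm_parallelogram_complex by (simp add: algebra_simps)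
  ultimately show ?thesis unfolding scalar_supply_def by argo
qed

lemma scalar_supply_mult:
  "scalar_supply a b c (l * p) (l * q) = (norm l)\<^sup>2 * scalar_supply a b c p q"
proof -
  have "Re ((l * q) * cnj (l * p)) = (norm l)\<^sup>2 * Re (q * cnj p)"
    unfolding cmod_power2 by (simp add: power2_eq_square algebra_simps)
  then show ?thesis
    unfolding scalar_supply_def norm_mult power_mult_distrib by (simp add: algebra_simps)
qed

lemma supply_rate_parallelogram:
  assumes "u \<in> carrier_vec m" "u' \<in> carrier_vec m" "y \<in> carrier_vec m" "y' \<in> carrier_vec m"
  shows "supply_rate a b c (u + u') (y + y') + supply_rate a b c (u - u') (y - y')
   = 2 * supply_rate a b c u y + 2 * supply_rate a b c u' y'"
proof -
  have "supply_rate a b c (u + u') (y + y') + supply_rate a b c (u - u') (y - y')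
     = (\<Sum>i<m. scalar_supply a b c (u $ i + u' $ i) (y $ i + y' $ i)
          + scalar_supply a b c (u $ i - u' $ i) (y $ i - y' $ i))"
    using assms by (subst (1 2) supply_eq_sum[of _ m]) (auto simp: sum.distrib)
  then show ?thesis
    using assms by (simp add: scalar_supply_parallelogram supply_eq_sum[of _ m] sum.distrib sum_distrib_left)
qed

lemma supply_rate_smult:
  assumes "u \<in> carrier_vec m" "y \<in> carrier_vec m"
  shows "supply_rate a b c (l \<cdot>\<^sub>v u) (l \<cdot>\<^sub>v y) = (norm l)\<^sup>2 * supply_rate a b c u y"
  using assms by (simp add: supply_eq_sum[of _ m] scalar_supply_mult sum_distrib_left)

lemma supply_rate_zero_input:
  assumes "y \<in> carrier_vec m"
  shows "supply_rate a b c (0\<^sub>v m) y = - c * Re (y \<bullet>c y)"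
  using assms by (simp add: supply_rate_def)

locale supplied_system = linear_system +
  fixes a b c :: real
  assumes c: "0 \<le> c"
begin

abbreviation "s \<equiv> supply_rate a b c"

text \<open>The energy gained from the system along a finite list of inputs, that is minus the supplied
  energy.\<close>

primrec extracted :: "complex vec \<Rightarrow> complex vec list \<Rightarrow> real" where
  "extracted x [] = 0"
| "extracted x (u # us) = extracted (step x u) us - s u (out x u)"

lemma extracted_append: "extracted x (us @ vs) = extracted x us + extracted (final x us) vs"
  by (induction us arbitrary: x) auto

lemma extracted_zero_inputs: "x \<in> carrier_vec n \<Longrightarrow> 0 \<le> extracted x (replicate k (0\<^sub>v m))"
proof (induction k arbitrary: x)
  case (Suc k)
  have "0 \<le> c * Re (out x (0\<^sub>v m) \<bullet>c out x (0\<^sub>v m))"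
    using c Re_cscalar_prod_nonneg[of "out x (0\<^sub>v m)" m] Suc.prems by simp
  then show ?case
    using Suc supply_rate_zero_input[of "out x (0\<^sub>v m)" m a b c]
      Suc.IH[of "step x (0\<^sub>v m)"] by simp
qed simp

lemma extracted_smult:
  "x \<in> carrier_vec n \<Longrightarrow> us \<in> inputs \<Longrightarrow> extracted (l \<cdot>\<^sub>v x) (map ((\<cdot>\<^sub>v) l) us) = (norm l)\<^sup>2 * extracted x us"
  by (induction us arbitrary: x) (auto simp: step_smult supply_rate_smult[of _ m] algebra_simps)

text \<open>Extracted energy is a quadratic form in the pair of state and inputs, and step and output are
  linear in that pair.\<close>

lemma extracted_parallelogram:
  "length us = length vs \<Longrightarrow> x \<in> carrier_vec n \<Longrightarrow> y \<in> carrier_vec n \<Longrightarrow> us \<in> inputs \<Longrightarrow> vs \<in> inputs \<Longrightarrow>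
   extracted (x + y) (map2 (+) us vs) + extracted (x - y) (map2 (-) us vs)
   = 2 * extracted x us + 2 * extracted y vs"
proof (induction us vs arbitrary: x y rule: list_induct2)
  case (Cons u us v vs)
  have uv: "u \<in> carrier_vec m" "v \<in> carrier_vec m" using Cons.prems by auto
  have "extracted (step x u + step y v) (map2 (+) us vs) + extracted (step x u - step y v) (map2 (-) us vs)
     = 2 * extracted (step x u) us + 2 * extracted (step y v) vs"
    using Cons.prems by (intro Cons.IH) auto
  moreover have "s (u + v) (out x u + out y v) + s (u - v) (out x u - out y v)
     = 2 * s u (out x u) + 2 * s v (out y v)"
    using Cons.prems uv by (intro supply_rate_parallelogram[of _ m]) auto
  ultimately show ?case
    using Cons.prems uv by (simp add: step_add)
qed simp

end

text \<open>The last assumption excludes degenerate supply rates: whenever the output under zero input is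
  nonzero, some input extracts energy in one step.\<close>

locale dissipative_system = supplied_system +
  assumes ctrb: "controllable_pair n m A B"
    and obs: "controllable_pair n m A\<^sup>T C\<^sup>T"
    and zero_state_passive: "us \<in> inputs \<Longrightarrow> extracted (0\<^sub>v n) us \<le> 0"
    and extractable: "\<eta> \<in> carrier_vec m \<Longrightarrow> \<eta> \<noteq> 0\<^sub>v m \<Longrightarrow> \<exists>u \<in> carrier_vec m. supply_rate a b c u (\<eta> + D *\<^sub>v u) < 0"
begin

text \<open>Willems' available storage.\<close>

definition available_storage :: "complex vec \<Rightarrow> real" where
  "available_storage x = (SUP us \<in> inputs. extracted x us)"

text \<open>If \<open>x\<close> is reached from rest by the inputs \<open>vs\<close>, then extracting from \<open>x\<close> more than was spent on
  \<open>vs\<close> would gain energy from the system at rest.\<close>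

lemma bdd_above_extracted:
  assumes "x \<in> carrier_vec n"
  shows "bdd_above (extracted x ` inputs)"
proof -
  obtain vs where vs: "vs \<in> inputs" "x = final (0\<^sub>v n) vs"
    using assms unfolding reachable_set_eq_carrier[OF ctrb, symmetric] by blast
  have "extracted x us \<le> - extracted (0\<^sub>v n) vs" if "us \<in> inputs" for us
    using zero_state_passive[of "vs @ us"] vs that by (simp add: extracted_append)
  then show ?thesis by (intro bdd_aboveI2)
qed

lemma available_storage_upper:
  "x \<in> carrier_vec n \<Longrightarrow> us \<in> inputs \<Longrightarrow> extracted x us \<le> available_storage x"
  unfolding available_storage_def by (rule cSUP_upper[OF _ bdd_above_extracted])

lemma available_storage_least:
  "(\<And>us. us \<in> inputs \<Longrightarrow> extracted x us \<le> K) \<Longrightarrow> available_storage x \<le> K"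
  unfolding available_storage_def by (rule cSUP_least) (auto intro: exI[of _ "[]"])

lemma available_storage_nonneg: "x \<in> carrier_vec n \<Longrightarrow> 0 \<le> available_storage x"
  using available_storage_upper[of x "[]"] by simp

text \<open>Applying \<open>u\<close> first is one particular way to extract energy from \<open>x\<close>.\<close>

lemma available_storage_dissipation:
  assumes "x \<in> carrier_vec n" "u \<in> carrier_vec m"
  shows "available_storage (step x u) \<le> available_storage x + s u (out x u)"
proof (rule available_storage_least)
  fix us assume "us \<in> inputs"
  then show "extracted (step x u) us \<le> available_storage x + s u (out x u)"
    using available_storage_upper[of x "u # us"] assms by simp
qed

text \<open>Scaling inputs along with the state gives one inequality for every nonzero scalar, and the
  inequality for the inverse scalar is its converse.\<close>

lemma available_storage_smult:
  assumes x: "x \<in> carrier_vec n"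
  shows "available_storage (l \<cdot>\<^sub>v x) = (norm l)\<^sup>2 * available_storage x"
proof (cases "l = 0")
  case True
  have "available_storage (0\<^sub>v n) = 0"
    using available_storage_least[of "0\<^sub>v n" 0] zero_state_passive available_storage_nonneg[of "0\<^sub>v n"] by fastforce
  moreover have "l \<cdot>\<^sub>v x = 0\<^sub>v n" using x True by auto
  ultimately show ?thesis using True by simp
next
  case False
  have ge: "(norm l)\<^sup>2 * available_storage x \<le> available_storage (l \<cdot>\<^sub>v x)"
    if l: "l \<noteq> 0" and x: "x \<in> carrier_vec n" for l x
  proof -
    have "available_storage x \<le> available_storage (l \<cdot>\<^sub>v x) / (norm l)\<^sup>2"
    proof (rule available_storage_least)
      fix us assume us: "us \<in> inputs"
      have "(norm l)\<^sup>2 * extracted x us = extracted (l \<cdot>\<^sub>v x) (map ((\<cdot>\<^sub>v) l) us)"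
        by (rule extracted_smult[OF x us, symmetric])
      also have "\<dots> \<le> available_storage (l \<cdot>\<^sub>v x)" using x us by (intro available_storage_upper) auto
      finally show "extracted x us \<le> available_storage (l \<cdot>\<^sub>v x) / (norm l)\<^sup>2"
        using l by (simp add: field_simps)
    qed
    then show ?thesis using l by (simp add: field_simps)
  qed
  have "(1 / l) \<cdot>\<^sub>v (l \<cdot>\<^sub>v x) = x" using x False by auto
  then have "(norm (1 / l))\<^sup>2 * available_storage (l \<cdot>\<^sub>v x) \<le> available_storage x"
    using ge[of "1 / l" "l \<cdot>\<^sub>v x"] x False by simp
  then have "available_storage (l \<cdot>\<^sub>v x) \<le> (norm l)\<^sup>2 * available_storage x"
    using False by (simp add: norm_divide power_divide field_simps)
  with ge[OF False x] show ?thesis by linarith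
qed

text \<open>One half of the parallelogram law: combine near-optimal inputs for \<open>x\<close> and for \<open>y\<close>.\<close>

lemma available_storage_superadditive:
  assumes x: "x \<in> carrier_vec n" and y: "y \<in> carrier_vec n"
  shows "2 * available_storage x + 2 * available_storage y
    \<le> available_storage (x + y) + available_storage (x - y)"
proof -
  let ?R = "available_storage (x + y) + available_storage (x - y)"
  have pair: "2 * extracted x us + 2 * extracted y vs \<le> ?R" if us: "us \<in> inputs" and vs: "vs \<in> inputs" for us vs
  proof -
    \<comment> \<open>Here inputs are aligned at their starts; trailing zero inputs cannot decrease the extracted
      energy.\<close>
    let ?us = "us @ replicate (length vs) (0\<^sub>v m)" and ?vs = "vs @ replicate (length us) (0\<^sub>v m)"
    have i: "?us \<in> inputs" "?vs \<in> inputs" using us vs by auto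
    have "2 * extracted x us + 2 * extracted y vs \<le> 2 * extracted x ?us + 2 * extracted y ?vs"
      using extracted_zero_inputs[OF final_carrier[OF x us], of "length vs"]
        extracted_zero_inputs[OF final_carrier[OF y vs], of "length us"]
      by (simp add: extracted_append)
    also have "\<dots> = extracted (x + y) (map2 (+) ?us ?vs) + extracted (x - y) (map2 (-) ?us ?vs)"
      using x y i by (intro extracted_parallelogram[symmetric]) auto
    also have "\<dots> \<le> ?R"
      using x y set_map2_carrier[OF i] by (intro add_mono available_storage_upper) auto
    finally show ?thesis .
  qed
  have "available_storage x \<le> (?R - 2 * available_storage y) / 2"
  proof (rule available_storage_least)
    fix us assume us: "us \<in> inputs"
    have "available_storage y \<le> (?R - 2 * extracted x us) / 2"
      by (rule available_storage_least) (use pair[OF us] in fastforce)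
    then show "extracted x us \<le> (?R - 2 * available_storage y) / 2" by simp
  qed
  then show ?thesis by simp
qed

text \<open>The missing half follows from the other half, applied to \<open>x + y\<close> and \<open>x - y\<close>, and homogeneity.\<close>

lemma available_storage_parallelogram:
  assumes x: "x \<in> carrier_vec n" and y: "y \<in> carrier_vec n"
  shows "available_storage (x + y) + available_storage (x - y)
    = 2 * available_storage x + 2 * available_storage y"
proof -
  have "(x + y) + (x - y) = 2 \<cdot>\<^sub>v x" "(x + y) - (x - y) = 2 \<cdot>\<^sub>v y" using x y by auto
  then have "2 * available_storage (x + y) + 2 * available_storage (x - y)
      \<le> 4 * available_storage x + 4 * available_storage y"
    using available_storage_superadditive[of "x + y" "x - y"] x y by (simp add: available_storage_smult)
  with available_storage_superadditive[OF x y] show ?thesis by linarith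
qed

text \<open>A nonzero state produces under zero input, at some time \<open>k\<close>, a state with \<open>\<eta> = C z \<noteq> 0\<close>. Up
  to then nothing is lost, and at time \<open>k\<close> a suitable input extracts energy.\<close>

lemma available_storage_positive:
  assumes x: "x \<in> carrier_vec n" and nz: "x \<noteq> 0\<^sub>v n"
  shows "0 < available_storage x"
proof -
  obtain k where k: "C *\<^sub>v final x (replicate k (0\<^sub>v m)) \<noteq> 0\<^sub>v m"
    using zero_output_imp_zero_state[OF obs x] nz by blast
  let ?z = "final x (replicate k (0\<^sub>v m))"
  have z: "?z \<in> carrier_vec n" by (rule final_carrier[OF x]) auto
  obtain u where u: "u \<in> carrier_vec m" "s u (out ?z u) < 0"
    using extractable[OF mult_mat_vec_carrier[OF C z] k] by (auto simp: out_def)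
  have "0 < extracted x (replicate k (0\<^sub>v m) @ [u])"
    using u extracted_zero_inputs[OF x, of k] by (simp add: extracted_append)
  also have "\<dots> \<le> available_storage x" using u by (intro available_storage_upper[OF x]) auto
  finally show ?thesis .
qed

lemma quadratic_storage_exists:
  "\<exists>P \<in> pd_mats n. \<forall>x \<in> carrier_vec n. \<forall>u \<in> carrier_vec m.
     energy P (step x u) \<le> energy P x + s u (out x u)"
proof -
  obtain P where P: "P \<in> carrier_mat n n" "mat_adjoint P = P"
    and V: "\<And>x. x \<in> carrier_vec n \<Longrightarrow> energy P x = available_storage x"
    using parallelogram_imp_quadratic_form[of n available_storage, OF available_storage_nonneg
        available_storage_smult available_storage_parallelogram] by blast
  show ?thesis
  proof (intro bexI ballI)
    show "P \<in> pd_mats n" using P V available_storage_positive by (simp add: pd_mats_def)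
  qed (simp add: V available_storage_dissipation)
qed

end

lemma (in supplied_system) extracted_along_trajectory:
  assumes "\<And>k. u k \<in> carrier_vec m"
  shows "extracted (trajectory u j) (map u [j..<j + l])
     = - (\<Sum>k\<in>{j..<j + l}. s (u k) (out (trajectory u k) (u k)))"
proof (induction l arbitrary: j)
  case (Suc l)
  have "[j..<j + Suc l] = j # [Suc j..<Suc j + l]" by (simp add: upt_conv_Cons)
  moreover have "{j..<j + Suc l} = insert j {Suc j..<Suc j + l}" by auto
  ultimately show ?case using Suc[of "Suc j"] by simp
qed simp

text \<open>The Kalman--Yakubovich--Popov lemma in discrete time for a general supply rate: a
  controllable and observable system whose transfer function is dissipative in the disc has a
  positive definite quadratic storage function.\<close>

theorem (in supplied_system) discrete_kyp:
  assumes ctrb: "controllable_pair n m A B" and obs: "controllable_pair n m A\<^sup>T C\<^sup>T"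
    and extractable: "\<And>\<eta>. \<eta> \<in> carrier_vec m \<Longrightarrow> \<eta> \<noteq> 0\<^sub>v m \<Longrightarrow> \<exists>u \<in> carrier_vec m. s u (\<eta> + D *\<^sub>v u) < 0"
    and G: "\<And>w. G w \<in> carrier_mat m m"
    and hol: "\<And>i j. i < m \<Longrightarrow> j < m \<Longrightarrow> (\<lambda>w. G w $$ (i,j)) holomorphic_on ball 0 1 - {0}"
    and rep: "\<exists>r>0. \<forall>w. 0 < norm w \<longrightarrow> norm w < r \<longrightarrow> (\<forall>v \<in> carrier_vec m. \<forall>x \<in> carrier_vec n.
        x = w \<cdot>\<^sub>v step x v \<longrightarrow> G w *\<^sub>v v = out x v)"
    and diss: "\<And>w v. 0 < norm w \<Longrightarrow> norm w < 1 \<Longrightarrow> v \<in> carrier_vec m \<Longrightarrow> 0 \<le> s v (G w *\<^sub>v v)"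
  shows "\<exists>P \<in> pd_mats n. \<forall>x \<in> carrier_vec n. \<forall>u \<in> carrier_vec m.
     energy P (step x u) \<le> energy P x + s u (out x u)"
proof -
  have "extracted (0\<^sub>v n) us \<le> 0" if us: "us \<in> inputs" for us
  proof -
    define u where "u k = (if k < length us then us ! k else 0\<^sub>v m)" for k
    have u: "u k \<in> carrier_vec m" for k using us by (auto simp: u_def)
    have "0 \<le> (\<Sum>k<length us. s (u k) (out (trajectory u k) (u k)))"
      by (rule zero_state_dissipative[OF c G hol rep diss u]) (auto simp: u_def)
    moreover have "map u [0..<0 + length us] = us" by (intro nth_equalityI) (auto simp: u_def)
    ultimately show ?thesis
      using extracted_along_trajectory[of u 0 "length us", OF u] by (simp add: atLeast0LessThan)
  qed
  then interpret dissipative_system n m A B C D a b c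
    using ctrb obs extractable by unfold_locales auto
  show ?thesis by (rule quadratic_storage_exists)
qed

section \<open>Resolvents, realizations and minimality\<close>

abbreviation resolvent_mat :: "nat \<Rightarrow> complex mat \<Rightarrow> complex \<Rightarrow> complex mat" where
  "resolvent_mat n A z \<equiv> z \<cdot>\<^sub>m 1\<^sub>m n - A"

text \<open>The inverse by Cramer's rule, so that its entries are visibly holomorphic in \<open>z\<close> away from the
  spectrum.\<close>

definition resolvent :: "nat \<Rightarrow> complex mat \<Rightarrow> complex \<Rightarrow> complex mat" where
  "resolvent n A z = (1 / det (resolvent_mat n A z)) \<cdot>\<^sub>m adj_mat (resolvent_mat n A z)"

lemma resolvent_mat_mult_vec:
  assumes "A \<in> carrier_mat n n" "x \<in> carrier_vec n"
  shows "resolvent_mat n A z *\<^sub>v x = z \<cdot>\<^sub>v x - A *\<^sub>v x"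
proof -
  have "(z \<cdot>\<^sub>m 1\<^sub>m n) *\<^sub>v x = z \<cdot>\<^sub>v x"
  proof (rule eq_vecI)
    fix i assume "i < dim_vec (z \<cdot>\<^sub>v x)"
    then have i: "i < n" using assms by simp
    have "((z \<cdot>\<^sub>m 1\<^sub>m n) *\<^sub>v x) $ i = (\<Sum>j<n. (z \<cdot>\<^sub>m 1\<^sub>m n) $$ (i,j) * x $ j)"
      by (rule mult_mat_vec_index_sum[OF _ assms(2) i]) simp
    also have "\<dots> = (\<Sum>j<n. if i = j then z * x $ j else 0)"
      using i by (intro sum.cong) auto
    finally show "((z \<cdot>\<^sub>m 1\<^sub>m n) *\<^sub>v x) $ i = (z \<cdot>\<^sub>v x) $ i" using i assms(2) by simp
  qed (use assms in simp)
  then show ?thesis using assms by (subst minus_mult_distrib_mat_vec[of _ n n]) auto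
qed

lemma resolvent_inverse:
  assumes A: "A \<in> carrier_mat n n" and d: "det (resolvent_mat n A z) \<noteq> 0"
  shows "resolvent n A z \<in> carrier_mat n n"
    and "resolvent_mat n A z * resolvent n A z = 1\<^sub>m n"
    and "resolvent n A z * resolvent_mat n A z = 1\<^sub>m n"
proof -
  have M: "resolvent_mat n A z \<in> carrier_mat n n" using A by auto
  show "resolvent n A z \<in> carrier_mat n n" "resolvent_mat n A z * resolvent n A z = 1\<^sub>m n"
    "resolvent n A z * resolvent_mat n A z = 1\<^sub>m n"
    unfolding resolvent_def by (rule inverse_of_det_nonzero[OF M d])+
qed

lemma the_mat_inverse_eq_resolvent:
  assumes A: "A \<in> carrier_mat n n" and d: "det (resolvent_mat n A z) \<noteq> 0"
  shows "the (mat_inverse (resolvent_mat n A z)) = resolvent n A z"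
proof -
  let ?M = "resolvent_mat n A z"
  have M: "?M \<in> carrier_mat n n" using A by auto
  note R = resolvent_inverse[OF A d]
  have "mat_inverse ?M \<noteq> None" using mat_inverse(1)[OF M, where b = "()"] det_non_zero_imp_unit[OF M d, where b = "()"] by blast
  then obtain N where N: "mat_inverse ?M = Some N" by blast
  then have N': "N * ?M = 1\<^sub>m n" "N \<in> carrier_mat n n" using mat_inverse(2)[OF M] by auto
  have "N = N * (?M * resolvent n A z)" using N' R by simp
  also have "\<dots> = (N * ?M) * resolvent n A z" by (rule assoc_mult_mat[OF N'(2) M R(1), symmetric])
  also have "\<dots> = resolvent n A z" using N' R by simp
  finally show ?thesis using N by simp
qed

lemma resolvent_solves:
  assumes A: "A \<in> carrier_mat n n" and d: "det (resolvent_mat n A z) \<noteq> 0" and b: "b \<in> carrier_vec n"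
  shows "z \<cdot>\<^sub>v (resolvent n A z *\<^sub>v b) = A *\<^sub>v (resolvent n A z *\<^sub>v b) + b"
proof -
  note R = resolvent_inverse[OF A d]
  define x where "x = resolvent n A z *\<^sub>v b"
  have x: "x \<in> carrier_vec n" using R b by (auto simp: x_def)
  have M: "resolvent_mat n A z \<in> carrier_mat n n" using A by auto
  have "resolvent_mat n A z *\<^sub>v x = b"
    using assoc_mult_mat_vec[OF M R(1) b] R(2) b by (simp add: x_def)
  then have e: "b = z \<cdot>\<^sub>v x - A *\<^sub>v x" unfolding resolvent_mat_mult_vec[OF A x] by simp
  have "z \<cdot>\<^sub>v x = A *\<^sub>v x + b" unfolding e using x A by (intro eq_vecI) auto
  then show ?thesis unfolding x_def .
qed

lemma resolvent_unique:
  assumes A: "A \<in> carrier_mat n n" and d: "det (resolvent_mat n A z) \<noteq> 0" and b: "b \<in> carrier_vec n"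
    and x: "x \<in> carrier_vec n" and e: "z \<cdot>\<^sub>v x = A *\<^sub>v x + b"
  shows "x = resolvent n A z *\<^sub>v b"
proof -
  note R = resolvent_inverse[OF A d]
  have M: "resolvent_mat n A z \<in> carrier_mat n n" using A by auto
  have "b = resolvent_mat n A z *\<^sub>v x"
    unfolding resolvent_mat_mult_vec[OF A x] e using A x b by (auto intro!: eq_vecI)
  then show ?thesis using assoc_mult_mat_vec[OF R(1) M x] R(3) x by simp
qed

lemma finite_spectrum:
  fixes A :: "complex mat"
  assumes A: "A \<in> carrier_mat n n"
  shows "finite {z. det (resolvent_mat n A z) = 0}"
proof -
  have "- char_matrix A z = resolvent_mat n A z" for z
    using A by (intro eq_matI) (auto simp: char_matrix_def)
  then have "{z. det (resolvent_mat n A z) = 0} = {z. poly (char_poly A) z = 0}"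
    by (simp add: char_poly_matrix[OF A])
  moreover have "char_poly A \<noteq> 0" using degree_monic_char_poly[OF A] by auto
  ultimately show ?thesis by (simp add: poly_roots_finite)
qed

lemma open_resolvent_set:
  fixes A :: "complex mat"
  assumes A: "A \<in> carrier_mat n n"
  shows "open {z. det (resolvent_mat n A z) \<noteq> 0}"
proof -
  have "{z. det (resolvent_mat n A z) \<noteq> 0} = - {z. det (resolvent_mat n A z) = 0}" by auto
  then show ?thesis using finite_imp_closed[OF finite_spectrum[OF A]] by (simp add: open_Compl)
qed

lemma holomorphic_on_det:
  assumes M: "\<And>z. M z \<in> carrier_mat k k"
    and hol: "\<And>i j. i < k \<Longrightarrow> j < k \<Longrightarrow> (\<lambda>z. M z $$ (i,j)) holomorphic_on S"
  shows "(\<lambda>z. det (M z)) holomorphic_on S"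
proof -
  have "(\<lambda>z. \<Sum>p \<in> {p. p permutes {0..<k}}. signof p * (\<Prod>i = 0..<k. M z $$ (i, p i))) holomorphic_on S"
    by (intro holomorphic_intros hol) (auto simp: permutes_in_image dest: permutes_in_image)
  then show ?thesis by (simp add: det_def'[OF M])
qed

lemma holomorphic_on_resolvent_entry:
  assumes A: "A \<in> carrier_mat n n" and ij: "i < n" "j < n"
  shows "(\<lambda>z. resolvent n A z $$ (i,j)) holomorphic_on {z. det (resolvent_mat n A z) \<noteq> 0}" (is "_ holomorphic_on ?S")
proof -
  have M: "resolvent_mat n A z \<in> carrier_mat n n" for z using A by auto
  have hM: "(\<lambda>z. resolvent_mat n A z $$ (k,l)) holomorphic_on ?S" if "k < n" "l < n" for k l
  proof -
    have "(\<lambda>z. resolvent_mat n A z $$ (k,l)) = (\<lambda>z. (if k = l then z else 0) - A $$ (k,l))"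
      using that A by auto
    then show ?thesis by (cases "k = l") (auto intro!: holomorphic_intros)
  qed
  have "(\<lambda>z. det (mat_delete (resolvent_mat n A z) j i)) holomorphic_on ?S"
  proof (rule holomorphic_on_det)
    show "mat_delete (resolvent_mat n A z) j i \<in> carrier_mat (n - 1) (n - 1)" for z
      by (rule mat_delete_carrier[OF M])
    fix k l assume kl: "k < n - 1" "l < n - 1"
    have "(\<lambda>z. mat_delete (resolvent_mat n A z) j i $$ (k,l))
       = (\<lambda>z. resolvent_mat n A z $$ (if k < j then k else Suc k, if l < i then l else Suc l))"
      using kl A by (auto simp: mat_delete_def)
    then show "(\<lambda>z. mat_delete (resolvent_mat n A z) j i $$ (k,l)) holomorphic_on ?S"
      using kl by (simp only:) (rule hM; auto)
  qed
  moreover have "(\<lambda>z. det (resolvent_mat n A z)) holomorphic_on ?S"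
    by (rule holomorphic_on_det[OF M hM])
  ultimately have "(\<lambda>z. (1 / det (resolvent_mat n A z)) * ((-1) ^ (j + i) * det (mat_delete (resolvent_mat n A z) j i))) holomorphic_on ?S"
    by (intro holomorphic_intros) auto
  then show ?thesis
    using ij A by (simp add: resolvent_def adj_mat_def cofactor_def)
qed

definition transfer_function :: "nat \<Rightarrow> complex mat \<Rightarrow> complex mat \<Rightarrow> complex mat \<Rightarrow> complex mat \<Rightarrow> complex \<Rightarrow> complex mat" where
  "transfer_function n A B C D z = C * resolvent n A z * B + D"

context linear_system
begin

lemma transfer_function_carrier:
  "transfer_function n A B C D z \<in> carrier_mat m m"
  using D unfolding transfer_function_def by auto

lemma transfer_function_mult_vec:
  assumes d: "det (resolvent_mat n A z) \<noteq> 0" and v: "v \<in> carrier_vec m"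
  shows "transfer_function n A B C D z *\<^sub>v v = out (resolvent n A z *\<^sub>v (B *\<^sub>v v)) v"
proof -
  note R = resolvent_inverse(1)[OF A d]
  have CR: "C * resolvent n A z \<in> carrier_mat m n" using C R by auto
  show ?thesis
    unfolding transfer_function_def out_def
    using A B C D R CR v assoc_mult_mat_vec[OF CR B v] assoc_mult_mat_vec[OF C R, of "B *\<^sub>v v"]
    by (subst add_mult_distrib_mat_vec[of _ m m]) auto
qed

lemma holomorphic_on_transfer_function_entry:
  assumes i: "i < m" and j: "j < m"
  shows "(\<lambda>z. transfer_function n A B C D z $$ (i,j)) holomorphic_on {z. det (resolvent_mat n A z) \<noteq> 0}" (is "_ holomorphic_on ?S")
proof -
  have "(\<lambda>z. (\<Sum>k<n. C $$ (i,k) * (\<Sum>l<n. resolvent n A z $$ (k,l) * B $$ (l,j))) + D $$ (i,j)) holomorphic_on ?S"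
    by (intro holomorphic_intros holomorphic_on_resolvent_entry[OF A]) auto
  moreover have "transfer_function n A B C D z $$ (i,j)
      = (\<Sum>k<n. C $$ (i,k) * (\<Sum>l<n. resolvent n A z $$ (k,l) * B $$ (l,j))) + D $$ (i,j)"
    if "z \<in> ?S" for z
  proof -
    from that have d: "det (resolvent_mat n A z) \<noteq> 0" by simp
    note R = resolvent_inverse(1)[OF A d]
    have "transfer_function n A B C D z = C * (resolvent n A z * B) + D"
      unfolding transfer_function_def by (simp add: assoc_mult_mat[OF C R B])
    then show ?thesis using A B C D R i j by (simp add: scalar_prod_def atLeast0LessThan)
  qed
  ultimately show ?thesis by (subst holomorphic_cong[OF refl]) auto
qed

end

lemma is_realization_iff:
  "is_realization n m F A B C D \<longleftrightarrow> linear_system n m A B C D \<and>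
     (\<forall>z. det (resolvent_mat n A z) \<noteq> 0 \<longrightarrow> F z = transfer_function n A B C D z)"
  unfolding is_realization_def linear_system_def transfer_function_def
  using the_mat_inverse_eq_resolvent by auto

text \<open>A reduced fraction has no removable singularities left. At a zero of the denominator the value of
  the fraction is \<open>0\<close> by division by zero, but then it cannot agree with a bounded function nearby:
  numerator and denominator would vanish together, against Bezout's identity.\<close>

lemma real_rational_continuous_extension:
  assumes f: "real_rational f" and g: "isCont g z\<^sub>0" and eq: "\<forall>\<^sub>F z in at z\<^sub>0. f z = g z"
  shows "f z\<^sub>0 = g z\<^sub>0"
proof -
  obtain p q :: "real poly" where q0: "q \<noteq> 0" and cop: "coprime p q"
    and f: "\<And>z. f z = poly (map_poly of_real p) z / poly (map_poly of_real q) z"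
    using f unfolding real_rational_def by blast
  define P Q :: "complex poly" where "P = map_poly of_real p" and "Q = map_poly of_real q"
  interpret pm: map_poly_comm_ring_hom "of_real :: real \<Rightarrow> complex" by unfold_locales auto
  have fPQ: "f z = poly P z / poly Q z" for z by (simp add: f P_def Q_def)
  have Q0: "Q \<noteq> 0" using q0 by (simp add: Q_def map_poly_eq_0_iff)
  have g_lim: "(g \<longlongrightarrow> g z\<^sub>0) (at z\<^sub>0)" using g by (simp add: isCont_def)
  have P_lim: "(poly P \<longlongrightarrow> poly P z\<^sub>0) (at z\<^sub>0)" and Q_lim: "(poly Q \<longlongrightarrow> poly Q z\<^sub>0) (at z\<^sub>0)"
    using poly_isCont isCont_def by blast+
  have Qz: "poly Q z\<^sub>0 \<noteq> 0"
  proof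
    assume Qz: "poly Q z\<^sub>0 = 0"
    have "\<forall>\<^sub>F z in at z\<^sub>0. poly Q z \<noteq> 0"
      using poly_roots_finite[OF Q0] by (auto simp: eventually_at_topological intro!: exI[of _ "- ({z. poly Q z = 0} - {z\<^sub>0})"] finite_imp_closed)
    with eq have "\<forall>\<^sub>F z in at z\<^sub>0. g z * poly Q z = poly P z"
      by eventually_elim (auto simp: fPQ field_simps)
    moreover have "((\<lambda>z. g z * poly Q z) \<longlongrightarrow> g z\<^sub>0 * poly Q z\<^sub>0) (at z\<^sub>0)"
      by (intro tendsto_mult g_lim Q_lim)
    ultimately have "(poly P \<longlongrightarrow> g z\<^sub>0 * poly Q z\<^sub>0) (at z\<^sub>0)"
      by (rule Lim_transform_eventually[rotated])
    then have Pz: "poly P z\<^sub>0 = 0" using P_lim Qz tendsto_unique[OF _ P_lim] by fastforce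
    obtain a b where "a * p + b * q = 1"
      using bezout_coefficients_fst_snd[of p q] cop by (metis coprime_imp_gcd_eq_1)
    then have "map_poly of_real (a * p + b * q) = (1 :: complex poly)" by simp
    then have "map_poly of_real a * P + map_poly of_real b * Q = 1"
      unfolding P_def Q_def by (simp add: pm.hom_add pm.hom_mult)
    then have "poly (map_poly of_real a * P + map_poly of_real b * Q) z\<^sub>0 = 1" by simp
    then show False using Pz Qz by simp
  qed
  have "(f \<longlongrightarrow> f z\<^sub>0) (at z\<^sub>0)" unfolding fPQ by (intro tendsto_divide P_lim Q_lim Qz)
  moreover have "(f \<longlongrightarrow> g z\<^sub>0) (at z\<^sub>0)"
    using g_lim eq by (intro Lim_transform_eventually[OF g_lim]) (auto elim: eventually_mono)
  ultimately show ?thesis using tendsto_unique at_neq_bot by blast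
qed

text \<open>It suffices to check a candidate realization away from the spectrum of another state matrix. At
  the finitely many remaining points, which are not poles of the candidate, equality follows by
  continuity.\<close>

lemma realization_by_agreement:
  assumes F: "real_rational_mat m F" and sys: "linear_system r m A' B' C' D" and A: "A \<in> carrier_mat n n"
    and agree: "\<And>z v. det (resolvent_mat r A' z) \<noteq> 0 \<Longrightarrow> det (resolvent_mat n A z) \<noteq> 0 \<Longrightarrow> v \<in> carrier_vec m \<Longrightarrow>
      \<exists>x \<in> carrier_vec r. z \<cdot>\<^sub>v x = A' *\<^sub>v x + B' *\<^sub>v v \<and> F z *\<^sub>v v = C' *\<^sub>v x + D *\<^sub>v v"
  shows "is_realization r m F A' B' C' D"
  unfolding is_realization_iff
proof (intro conjI allI impI sys)
  interpret linear_system r m A' B' C' D by (rule sys)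
  let ?g = "transfer_function r A' B' C' D"
  have Fc: "F z \<in> carrier_mat m m" for z using F by (simp add: real_rational_mat_def)
  have same: "F z = ?g z" if d: "det (resolvent_mat r A' z) \<noteq> 0" "det (resolvent_mat n A z) \<noteq> 0" for z
  proof (rule eq_matI)
    have gc: "?g z \<in> carrier_mat m m" by (rule transfer_function_carrier)
    fix i j assume "i < dim_row (?g z)" "j < dim_col (?g z)"
    then have ij: "i < m" "j < m" using gc by auto
    obtain x where x: "x \<in> carrier_vec r" "z \<cdot>\<^sub>v x = A' *\<^sub>v x + B' *\<^sub>v unit_vec m j"
      "F z *\<^sub>v unit_vec m j = C' *\<^sub>v x + D *\<^sub>v unit_vec m j"
      using agree[OF d, of "unit_vec m j"] by auto
    have "x = resolvent r A' z *\<^sub>v (B' *\<^sub>v unit_vec m j)"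
      using B x by (intro resolvent_unique[OF A d(1)]) auto
    then have "F z *\<^sub>v unit_vec m j = ?g z *\<^sub>v unit_vec m j"
      using x(3) transfer_function_mult_vec[OF d(1), of "unit_vec m j"] by (simp add: out_def)
    then have "col (F z) j = col (?g z) j"
      unfolding mult_unit_vec_eq_col[OF Fc ij(2)] mult_unit_vec_eq_col[OF gc ij(2)] .
    then have "col (F z) j $ i = col (?g z) j $ i" by simp
    then show "F z $$ (i,j) = ?g z $$ (i,j)" using ij Fc[of z] gc by auto
  next
    show "dim_row (F z) = dim_row (?g z)" "dim_col (F z) = dim_col (?g z)"
      using Fc[of z] transfer_function_carrier[of z] by auto
  qed
  fix z assume d: "det (resolvent_mat r A' z) \<noteq> 0"
  let ?S = "{z. det (resolvent_mat r A' z) \<noteq> 0}"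
  have "\<forall>\<^sub>F w in at z. w \<in> ?S" using open_resolvent_set[OF A] d by (intro eventually_at_in_open') auto
  moreover have "\<forall>\<^sub>F w in at z. det (resolvent_mat n A w) \<noteq> 0"
    using finite_spectrum[OF assms(3)]
    by (auto simp: eventually_at_topological intro!: exI[of _ "- ({w. det (resolvent_mat n A w) = 0} - {z})"] finite_imp_closed)
  ultimately have ev: "\<forall>\<^sub>F w in at z. F w = ?g w" by eventually_elim (auto intro: same)
  show "F z = ?g z"
  proof (rule eq_matI)
    have gc: "?g z \<in> carrier_mat m m" by (rule transfer_function_carrier)
    fix i j assume "i < dim_row (?g z)" "j < dim_col (?g z)"
    then have ij: "i < m" "j < m" using gc by auto
    have "continuous_on ?S (\<lambda>z. ?g z $$ (i,j))"
      by (rule holomorphic_on_imp_continuous_on[OF holomorphic_on_transfer_function_entry[OF ij]])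
    then have "isCont (\<lambda>z. ?g z $$ (i,j)) z"
      unfolding continuous_on_eq_continuous_at[OF open_resolvent_set[OF A]] using d by blast
    then show "F z $$ (i,j) = ?g z $$ (i,j)"
      using F ij ev by (intro real_rational_continuous_extension[of "\<lambda>z. F z $$ (i,j)"])
        (auto simp: real_rational_mat_def elim: eventually_mono)
  next
    show "dim_row (F z) = dim_row (?g z)" "dim_col (F z) = dim_col (?g z)"
      using Fc[of z] transfer_function_carrier[of z] by auto
  qed
qed

lemma realization_mult_vec:
  assumes R: "is_realization n m F A B C D" and d: "det (resolvent_mat n A z) \<noteq> 0"
    and v: "v \<in> carrier_vec m" and x: "x \<in> carrier_vec n" "z \<cdot>\<^sub>v x = A *\<^sub>v x + B *\<^sub>v v"
  shows "F z *\<^sub>v v = C *\<^sub>v x + D *\<^sub>v v"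
proof -
  interpret linear_system n m A B C D using R by (simp add: is_realization_iff)
  have "x = resolvent n A z *\<^sub>v (B *\<^sub>v v)" using B v x by (intro resolvent_unique[OF A d]) auto
  then show ?thesis using R d transfer_function_mult_vec[OF d v] by (simp add: is_realization_iff out_def)
qed

lemma minimal_imp_dim_le:
  "n = mcmillan_degree m F \<Longrightarrow> is_realization r m F A' B' C' D' \<Longrightarrow> n \<le> r"
  unfolding mcmillan_degree_def by (blast intro: Least_le)

text \<open>Restricting the system to an invariant subspace containing the range of \<open>B\<close> keeps the transfer
  function.\<close>

lemma minimal_imp_controllable:
  assumes F: "real_rational_mat m F" and R: "is_realization n m F A B C D" and min: "n = mcmillan_degree m F"
  shows "controllable_pair n m A B"
  unfolding controllable_pair_def
proof (intro allI impI)
  fix r T A' B'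
  assume T: "T \<in> carrier_mat n r" and A': "A' \<in> carrier_mat r r" and B': "B' \<in> carrier_mat r m"
    and AT: "A * T = T * A'" and BT: "B = T * B'"
  interpret linear_system n m A B C D using R by (simp add: is_realization_iff)
  have sys: "linear_system r m A' B' (C * T) D" using A' B' T C D by unfold_locales auto
  have "is_realization r m F A' B' (C * T) D"
  proof (rule realization_by_agreement[OF F sys A])
    fix z and v :: "complex vec" assume d': "det (resolvent_mat r A' z) \<noteq> 0" and d: "det (resolvent_mat n A z) \<noteq> 0"
      and v: "v \<in> carrier_vec m"
    define x where "x = resolvent r A' z *\<^sub>v (B' *\<^sub>v v)"
    have x: "x \<in> carrier_vec r" "z \<cdot>\<^sub>v x = A' *\<^sub>v x + B' *\<^sub>v v"
      using resolvent_inverse(1)[OF A' d'] resolvent_solves[OF A' d', of "B' *\<^sub>v v"] B' v by (auto simp: x_def)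
    have "z \<cdot>\<^sub>v (T *\<^sub>v x) = T *\<^sub>v (A' *\<^sub>v x + B' *\<^sub>v v)"
      unfolding x(2)[symmetric] by (rule mult_mat_vec[OF T x(1), symmetric])
    also have "\<dots> = T *\<^sub>v (A' *\<^sub>v x) + T *\<^sub>v (B' *\<^sub>v v)"
      using A' B' x v by (intro mult_add_distrib_mat_vec[OF T]) auto
    also have "T *\<^sub>v (A' *\<^sub>v x) = A *\<^sub>v (T *\<^sub>v x)"
      using assoc_mult_mat_vec[OF T A' x(1)] assoc_mult_mat_vec[OF A T x(1)] AT by simp
    also have "T *\<^sub>v (B' *\<^sub>v v) = B *\<^sub>v v" using assoc_mult_mat_vec[OF T B' v] BT by simp
    finally have e: "z \<cdot>\<^sub>v (T *\<^sub>v x) = A *\<^sub>v (T *\<^sub>v x) + B *\<^sub>v v" .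
    have "F z *\<^sub>v v = C *\<^sub>v (T *\<^sub>v x) + D *\<^sub>v v"
      using T x by (intro realization_mult_vec[OF R d v _ e]) auto
    then show "\<exists>x \<in> carrier_vec r. z \<cdot>\<^sub>v x = A' *\<^sub>v x + B' *\<^sub>v v \<and> F z *\<^sub>v v = C * T *\<^sub>v x + D *\<^sub>v v"
      using x assoc_mult_mat_vec[OF C T x(1)] by auto
  qed
  then show "n \<le> r" by (rule minimal_imp_dim_le[OF min])
qed

text \<open>Dually, dividing the state space by an invariant subspace on which \<open>C\<close> vanishes keeps the transfer
  function; \<open>T\<^sup>T\<close> is the quotient map.\<close>

lemma minimal_imp_observable:
  assumes F: "real_rational_mat m F" and R: "is_realization n m F A B C D" and min: "n = mcmillan_degree m F"
  shows "controllable_pair n m A\<^sup>T C\<^sup>T"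
  unfolding controllable_pair_def
proof (intro allI impI)
  fix r T A' B'
  assume T: "T \<in> carrier_mat n r" and A': "A' \<in> carrier_mat r r" and B': "B' \<in> carrier_mat r m"
    and AT: "A\<^sup>T * T = T * A'" and CT: "C\<^sup>T = T * B'"
  interpret linear_system n m A B C D using R by (simp add: is_realization_iff)
  have S: "T\<^sup>T \<in> carrier_mat r n" using T by auto
  have A'T: "A'\<^sup>T \<in> carrier_mat r r" and B'T: "B'\<^sup>T \<in> carrier_mat m r" using A' B' by auto
  have SA: "T\<^sup>T * A = A'\<^sup>T * T\<^sup>T"
    using arg_cong[OF AT, of transpose_mat] transpose_mult[OF _ T, of "A\<^sup>T" n] transpose_mult[OF T A'] A by simp
  have CS: "C = B'\<^sup>T * T\<^sup>T"
    using arg_cong[OF CT, of transpose_mat] transpose_mult[OF T B'] by simp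
  have sys: "linear_system r m A'\<^sup>T (T\<^sup>T * B) B'\<^sup>T D" using A'T B'T S B D by unfold_locales auto
  have "is_realization r m F A'\<^sup>T (T\<^sup>T * B) B'\<^sup>T D"
  proof (rule realization_by_agreement[OF F sys A])
    fix z and v :: "complex vec" assume d: "det (resolvent_mat n A z) \<noteq> 0" and v: "v \<in> carrier_vec m"
    define x where "x = resolvent n A z *\<^sub>v (B *\<^sub>v v)"
    have x: "x \<in> carrier_vec n" "z \<cdot>\<^sub>v x = A *\<^sub>v x + B *\<^sub>v v"
      using resolvent_inverse(1)[OF A d] resolvent_solves[OF A d, of "B *\<^sub>v v"] B v by (auto simp: x_def)
    have "z \<cdot>\<^sub>v (T\<^sup>T *\<^sub>v x) = T\<^sup>T *\<^sub>v (A *\<^sub>v x + B *\<^sub>v v)"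
      unfolding x(2)[symmetric] by (rule mult_mat_vec[OF S x(1), symmetric])
    also have "\<dots> = T\<^sup>T *\<^sub>v (A *\<^sub>v x) + T\<^sup>T *\<^sub>v (B *\<^sub>v v)"
      using A B x v by (intro mult_add_distrib_mat_vec[OF S]) auto
    also have "T\<^sup>T *\<^sub>v (A *\<^sub>v x) = A'\<^sup>T *\<^sub>v (T\<^sup>T *\<^sub>v x)"
      using assoc_mult_mat_vec[OF S A x(1)] assoc_mult_mat_vec[OF A'T S x(1)] SA by simp
    also have "T\<^sup>T *\<^sub>v (B *\<^sub>v v) = T\<^sup>T * B *\<^sub>v v" using assoc_mult_mat_vec[OF S B v] by simp
    finally have e: "z \<cdot>\<^sub>v (T\<^sup>T *\<^sub>v x) = A'\<^sup>T *\<^sub>v (T\<^sup>T *\<^sub>v x) + T\<^sup>T * B *\<^sub>v v" .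
    have "F z *\<^sub>v v = C *\<^sub>v x + D *\<^sub>v v" by (rule realization_mult_vec[OF R d v x])
    also have "C *\<^sub>v x = B'\<^sup>T *\<^sub>v (T\<^sup>T *\<^sub>v x)" using assoc_mult_mat_vec[OF B'T S x(1)] CS by simp
    finally show "\<exists>x \<in> carrier_vec r. z \<cdot>\<^sub>v x = A'\<^sup>T *\<^sub>v x + T\<^sup>T * B *\<^sub>v v \<and> F z *\<^sub>v v = B'\<^sup>T *\<^sub>v x + D *\<^sub>v v"
      using e S x by (intro bexI[of _ "T\<^sup>T *\<^sub>v x"]) auto
  qed
  then show "n \<le> r" by (rule minimal_imp_dim_le[OF min])
qed

section \<open>The matrix conditions as dissipation inequalities\<close>

lemma cscalar_prod_eq_sum:
  "y \<in> carrier_vec k \<Longrightarrow> (x :: complex vec) \<bullet>c y = (\<Sum>i<k. x $ i * cnj (y $ i))"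
  by (auto simp: scalar_prod_def atLeast0LessThan intro!: sum.cong)

lemma cscalar_prod_swap:
  assumes "x \<in> carrier_vec k" "y \<in> carrier_vec k"
  shows "y \<bullet>c x = cnj ((x :: complex vec) \<bullet>c y)"
  using assms by (simp add: cscalar_prod_eq_sum[of _ k] mult.commute)

lemma Re_cscalar_prod_swap:
  "x \<in> carrier_vec k \<Longrightarrow> y \<in> carrier_vec k \<Longrightarrow> Re (y \<bullet>c x) = Re ((x :: complex vec) \<bullet>c y)"
  by (subst cscalar_prod_swap[of x k y]) auto

lemma cscalar_prod_add_left:
  "x \<in> carrier_vec k \<Longrightarrow> x' \<in> carrier_vec k \<Longrightarrow> y \<in> carrier_vec k \<Longrightarrow>
   ((x :: complex vec) + x') \<bullet>c y = x \<bullet>c y + x' \<bullet>c y"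
  by (simp add: cscalar_prod_eq_sum[of _ k] sum.distrib distrib_right)

lemma cscalar_prod_append:
  assumes "x \<in> carrier_vec k" "y \<in> carrier_vec k" "x' \<in> carrier_vec l" "y' \<in> carrier_vec l"
  shows "(x @\<^sub>v x') \<bullet>c (y @\<^sub>v y') = (x :: complex vec) \<bullet>c y + x' \<bullet>c y'"
proof -
  have "conjugate (y @\<^sub>v y') = conjugate y @\<^sub>v conjugate y'" by (intro eq_vecI) auto
  then show ?thesis using assms by (simp add: scalar_prod_append[of _ k _ l])
qed

lemma mat_adjoint_cscalar_prod:
  fixes M :: "complex mat"
  assumes M: "M \<in> carrier_mat k l" and x: "x \<in> carrier_vec k" and y: "y \<in> carrier_vec l"
  shows "(mat_adjoint M *\<^sub>v x) \<bullet>c y = x \<bullet>c (M *\<^sub>v y)"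
proof -
  have M': "mat_adjoint M \<in> carrier_mat l k" using M by auto
  have "(mat_adjoint M *\<^sub>v x) \<bullet>c y = (\<Sum>i<l. (\<Sum>j<k. cnj (M $$ (j,i)) * x $ j) * cnj (y $ i))"
    unfolding cscalar_prod_eq_sum[OF y]
    by (intro sum.cong refl) (use M in \<open>simp add: mult_mat_vec_index_sum[OF M' x] mat_adjoint_index del: index_mult_mat_vec\<close>)
  also have "\<dots> = (\<Sum>j<k. x $ j * cnj (\<Sum>i<l. M $$ (j,i) * y $ i))"
    unfolding cnj_sum sum_distrib_left sum_distrib_right
    by (subst sum.swap) (simp add: mult_ac)
  also have "\<dots> = x \<bullet>c (M *\<^sub>v y)"
    unfolding cscalar_prod_eq_sum[OF mult_mat_vec_carrier[OF M y]]
    by (intro sum.cong refl) (simp add: mult_mat_vec_index_sum[OF M y] del: index_mult_mat_vec)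
  finally show ?thesis .
qed

lemma mat_adjoint_mult:
  fixes X Y :: "complex mat"
  assumes "X \<in> carrier_mat k l" "Y \<in> carrier_mat l r"
  shows "mat_adjoint (X * Y) = mat_adjoint Y * mat_adjoint X"
  using assms by (intro eq_matI) (auto simp: mat_adjoint_index scalar_prod_def mult.commute)

lemma mat_adjoint_mat_adjoint: "mat_adjoint (mat_adjoint X) = (X :: complex mat)"
  by (intro eq_matI) (auto simp: mat_adjoint_index)

lemma mat_adjoint_add:
  "X \<in> carrier_mat k l \<Longrightarrow> Y \<in> carrier_mat k l \<Longrightarrow> mat_adjoint (X + Y) = mat_adjoint X + mat_adjoint (Y :: complex mat)"
  by (intro eq_matI) (auto simp: mat_adjoint_index)

lemma mat_adjoint_smult: "mat_adjoint (l \<cdot>\<^sub>m X) = cnj l \<cdot>\<^sub>m mat_adjoint X"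
  by (intro eq_matI) (auto simp: mat_adjoint_index)

lemma mat_adjoint_simps [simp]:
  "mat_adjoint (0\<^sub>m k l) = (0\<^sub>m l k :: complex mat)"
  "mat_adjoint (1\<^sub>m k) = (1\<^sub>m k :: complex mat)"
  "mat_adjoint (- X) = - mat_adjoint (X :: complex mat)"
  by (intro eq_matI; simp add: mat_adjoint_index)+

lemma mat_adjoint_four_block_mat:
  assumes "X \<in> carrier_mat k l" "Y \<in> carrier_mat k l'" "Z \<in> carrier_mat k' l" "U \<in> carrier_mat k' l'"
  shows "mat_adjoint (four_block_mat X Y Z U)
    = four_block_mat (mat_adjoint X) (mat_adjoint Z) (mat_adjoint Y) (mat_adjoint (U :: complex mat))"
  using assms by (intro eq_matI) (auto simp: mat_adjoint_index)

lemma block_diag_carrier [simp, intro]: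
  "X \<in> carrier_mat k k \<Longrightarrow> Y \<in> carrier_mat l l \<Longrightarrow> block_diag X Y \<in> carrier_mat (k + l) (k + l)"
  by (auto simp: block_diag_def)

lemma mat_adjoint_block_diag:
  assumes "X \<in> carrier_mat k k" "Y \<in> carrier_mat l l"
  shows "mat_adjoint (block_diag X Y) = block_diag (mat_adjoint X) (mat_adjoint Y)"
  using assms unfolding block_diag_def
  by (subst mat_adjoint_four_block_mat[of _ k k _ l _ l]) auto

lemma block_diag_zero: "block_diag (0\<^sub>m k k) (0\<^sub>m l l) = 0\<^sub>m (k + l) (k + l)"
  by (intro eq_matI) (auto simp: block_diag_def)

lemma block_diag_mult_vec:
  assumes "X \<in> carrier_mat k k" "Y \<in> carrier_mat l l" "x \<in> carrier_vec k" "y \<in> carrier_vec l"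
  shows "block_diag X Y *\<^sub>v (x @\<^sub>v y) = (X *\<^sub>v x) @\<^sub>v (Y *\<^sub>v y)"
  unfolding block_diag_def using assms
  by (subst four_block_mat_mult_vec[of _ k k _ l _ l]) auto

lemma pd_mats_swap:
  assumes "P \<in> pd_mats n" "x \<in> carrier_vec n" "y \<in> carrier_vec n"
  shows "Re ((P *\<^sub>v x) \<bullet>c y) = Re ((P *\<^sub>v y) \<bullet>c x)"
proof -
  have P: "P \<in> carrier_mat n n" "mat_adjoint P = P" using assms(1) by (auto simp: pd_mats_def)
  have "(P *\<^sub>v x) \<bullet>c y = x \<bullet>c (P *\<^sub>v y)" using mat_adjoint_cscalar_prod[OF P(1) assms(2,3)] P(2) by simp
  then show ?thesis using Re_cscalar_prod_swap[of "P *\<^sub>v y" n x] P assms by simp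
qed

definition hermitian_mat :: "nat \<Rightarrow> complex mat \<Rightarrow> bool" where
  "hermitian_mat k X \<longleftrightarrow> X \<in> carrier_mat k k \<and> mat_adjoint X = X"

lemma hermitian_mat_zero: "hermitian_mat k (0\<^sub>m k k)"
  and hermitian_mat_one: "hermitian_mat k (1\<^sub>m k)"
  and hermitian_mat_uminus: "hermitian_mat k X \<Longrightarrow> hermitian_mat k (- X)"
  and hermitian_mat_pd: "X \<in> pd_mats k \<Longrightarrow> hermitian_mat k X"
  by (auto simp: hermitian_mat_def pd_mats_def)

text \<open>The common shape of the four matrices \<open>W\<close>: a symmetric \<open>2 \<times> 2\<close> arrangement of block diagonal
  matrices, acting on \<open>(A x + B u, C x + D u)\<close> in the first block row and on \<open>(x, u)\<close> in the
  second.\<close>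

definition symmetric_block_mat where
  "symmetric_block_mat Xa Xb Ya Yb Za Zb =
     four_block_mat (block_diag Xa Xb) (block_diag Ya Yb) (block_diag Ya Yb) (block_diag Za Zb)"

lemma W_eq_symmetric_block_mat:
  "W_alpha n m P = symmetric_block_mat (0\<^sub>m n n) (0\<^sub>m m m) (- P) (1\<^sub>m m) (0\<^sub>m n n) (0\<^sub>m m m)"
  "W_beta n m P = symmetric_block_mat (0\<^sub>m n n) (- 1\<^sub>m m) (- P) (0\<^sub>m m m) (0\<^sub>m n n) (1\<^sub>m m)"
  "W_gamma n m P = symmetric_block_mat (- P) (0\<^sub>m m m) (0\<^sub>m n n) (1\<^sub>m m) P (0\<^sub>m m m)"
  "W_delta n m P = symmetric_block_mat (- P) (- 1\<^sub>m m) (0\<^sub>m n n) (0\<^sub>m m m) P (1\<^sub>m m)"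
  by (simp_all add: symmetric_block_mat_def W_alpha_def W_beta_def W_gamma_def W_delta_def block_diag_zero)

context linear_system
begin

lemma block_congruence_psd_iff:
  assumes "hermitian_mat n Xa" "hermitian_mat m Xb" "hermitian_mat n Ya" "hermitian_mat m Yb"
      "hermitian_mat n Za" "hermitian_mat m Zb"
  defines "W \<equiv> symmetric_block_mat Xa Xb Ya Yb Za Zb"
    and "M \<equiv> four_block_mat A B C D @\<^sub>r 1\<^sub>m (n + m)"
  shows "mat_adjoint M * W * M \<in> psd_mats (n + m) \<longleftrightarrow>
    (\<forall>x \<in> carrier_vec n. \<forall>u \<in> carrier_vec m. 0 \<le>
       Re ((Xa *\<^sub>v step x u) \<bullet>c step x u) + Re ((Ya *\<^sub>v x) \<bullet>c step x u)
     + Re ((Ya *\<^sub>v step x u) \<bullet>c x) + Re ((Za *\<^sub>v x) \<bullet>c x)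
     + Re ((Xb *\<^sub>v out x u) \<bullet>c out x u) + Re ((Yb *\<^sub>v u) \<bullet>c out x u)
     + Re ((Yb *\<^sub>v out x u) \<bullet>c u) + Re ((Zb *\<^sub>v u) \<bullet>c u))" (is "_ \<longleftrightarrow> (\<forall>x \<in> _. \<forall>u \<in> _. 0 \<le> ?q x u)")
proof -
  have car: "Xa \<in> carrier_mat n n" "Ya \<in> carrier_mat n n" "Za \<in> carrier_mat n n"
      "Xb \<in> carrier_mat m m" "Yb \<in> carrier_mat m m" "Zb \<in> carrier_mat m m"
    and herm: "mat_adjoint Xa = Xa" "mat_adjoint Ya = Ya" "mat_adjoint Za = Za"
      "mat_adjoint Xb = Xb" "mat_adjoint Yb = Yb" "mat_adjoint Zb = Zb"
    using assms(1-6) by (auto simp: hermitian_mat_def)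
  let ?k = "n + m"
  have M: "M \<in> carrier_mat (?k + ?k) ?k" using A D by (auto simp: M_def)
  have bd: "block_diag Xa Xb \<in> carrier_mat ?k ?k" "block_diag Ya Yb \<in> carrier_mat ?k ?k"
    "block_diag Za Zb \<in> carrier_mat ?k ?k" using car by auto
  have W: "W \<in> carrier_mat (?k + ?k) (?k + ?k)"
    using bd by (auto simp: W_def symmetric_block_mat_def)
  have W_herm: "mat_adjoint W = W"
    unfolding W_def symmetric_block_mat_def mat_adjoint_four_block_mat[OF bd(1,2,2,3)]
    using car herm by (simp add: mat_adjoint_block_diag[of _ n _ m])
  have M': "mat_adjoint M \<in> carrier_mat ?k (?k + ?k)" using M by auto
  have herm: "mat_adjoint (mat_adjoint M * W * M) = mat_adjoint M * W * M"
    using mat_adjoint_mult[OF mult_carrier_mat[OF M' W] M] mat_adjoint_mult[OF M' W]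
      assoc_mult_mat[OF M' W M] by (simp add: W_herm mat_adjoint_mat_adjoint)
  have form: "Re (((mat_adjoint M * W * M) *\<^sub>v v) \<bullet>c v) = ?q x u"
    if x: "x \<in> carrier_vec n" and u: "u \<in> carrier_vec m" and v: "v = x @\<^sub>v u" for x u v
  proof -
    have vc: "v \<in> carrier_vec ?k" using x u v by auto
    have p: "step x u \<in> carrier_vec n" "out x u \<in> carrier_vec m" using x u by auto
    have R: "four_block_mat A B C D \<in> carrier_mat ?k ?k" using A D by auto
    have Mv: "M *\<^sub>v v = (step x u @\<^sub>v out x u) @\<^sub>v (x @\<^sub>v u)"
      using mat_mult_append[OF R one_carrier_mat vc] four_block_mat_mult_vec[OF A B C D x u] vc
      by (simp add: M_def v step_def out_def)
    have Mvc: "M *\<^sub>v v \<in> carrier_vec (?k + ?k)" using M vc by auto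
    have "W *\<^sub>v (M *\<^sub>v v)
       = (block_diag Xa Xb *\<^sub>v (step x u @\<^sub>v out x u) + block_diag Ya Yb *\<^sub>v (x @\<^sub>v u))
         @\<^sub>v (block_diag Ya Yb *\<^sub>v (step x u @\<^sub>v out x u) + block_diag Za Zb *\<^sub>v (x @\<^sub>v u))"
      unfolding W_def symmetric_block_mat_def Mv using x u p
      by (intro four_block_mat_mult_vec[OF bd(1,2,2,3)]) auto
    also have "\<dots> = ((Xa *\<^sub>v step x u + Ya *\<^sub>v x) @\<^sub>v (Xb *\<^sub>v out x u + Yb *\<^sub>v u))
         @\<^sub>v ((Ya *\<^sub>v step x u + Za *\<^sub>v x) @\<^sub>v (Yb *\<^sub>v out x u + Zb *\<^sub>v u))"
      using car x u p by (simp add: block_diag_mult_vec[of _ n _ m] append_vec_add[of _ n _ _ m])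
    finally have WMv: "W *\<^sub>v (M *\<^sub>v v) = \<dots>" .
    have "(mat_adjoint M * W * M) *\<^sub>v v = mat_adjoint M *\<^sub>v (W *\<^sub>v (M *\<^sub>v v))"
      using assoc_mult_mat_vec[OF mult_carrier_mat[OF M' W] M vc] assoc_mult_mat_vec[OF M' W Mvc] by simp
    then have "((mat_adjoint M * W * M) *\<^sub>v v) \<bullet>c v = (W *\<^sub>v (M *\<^sub>v v)) \<bullet>c (M *\<^sub>v v)"
      using mat_adjoint_cscalar_prod[OF M _ vc] W Mvc by simp
    also have "\<dots> = ((Xa *\<^sub>v step x u + Ya *\<^sub>v x) \<bullet>c step x u + (Xb *\<^sub>v out x u + Yb *\<^sub>v u) \<bullet>c out x u)
       + ((Ya *\<^sub>v step x u + Za *\<^sub>v x) \<bullet>c x + (Yb *\<^sub>v out x u + Zb *\<^sub>v u) \<bullet>c u)"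
      unfolding WMv unfolding Mv using car x u p
      by (subst cscalar_prod_append[of _ ?k _ _ ?k]; simp add: cscalar_prod_append[of _ n _ _ m])
    finally show ?thesis
      using car x u p by (simp add: cscalar_prod_add_left[of _ n] cscalar_prod_add_left[of _ m])
  qed
  have "mat_adjoint M * W * M \<in> carrier_mat ?k ?k" by (intro mult_carrier_mat[of _ _ "?k + ?k"] M' W M)
  then have "mat_adjoint M * W * M \<in> psd_mats ?k \<longleftrightarrow>
      (\<forall>v \<in> carrier_vec ?k. 0 \<le> Re (((mat_adjoint M * W * M) *\<^sub>v v) \<bullet>c v))"
    by (simp only: psd_mats_def mem_Collect_eq herm simp_thms)
  also have "\<dots> \<longleftrightarrow> (\<forall>x \<in> carrier_vec n. \<forall>u \<in> carrier_vec m. 0 \<le> ?q x u)"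
    unfolding all_vec_append by (intro ball_cong refl) (simp only: form[OF _ _ refl])
  finally show ?thesis .
qed

lemma quadratic_condition_iff:
  fixes R\<^sub>F :: "complex mat"
  defines "R\<^sub>F \<equiv> four_block_mat A B C D"
  shows "quadratic_condition n m W_alpha R\<^sub>F \<longleftrightarrow> (\<exists>P \<in> pd_mats n. \<forall>x \<in> carrier_vec n. \<forall>u \<in> carrier_vec m.
      2 * Re ((P *\<^sub>v step x u) \<bullet>c x) \<le> supply_rate 0 1 0 u (out x u))"
    and "quadratic_condition n m W_beta R\<^sub>F \<longleftrightarrow> (\<exists>P \<in> pd_mats n. \<forall>x \<in> carrier_vec n. \<forall>u \<in> carrier_vec m.
      2 * Re ((P *\<^sub>v step x u) \<bullet>c x) \<le> supply_rate 1 0 1 u (out x u))"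
    and "quadratic_condition n m W_gamma R\<^sub>F \<longleftrightarrow> (\<exists>P \<in> pd_mats n. \<forall>x \<in> carrier_vec n. \<forall>u \<in> carrier_vec m.
      energy P (step x u) \<le> energy P x + supply_rate 0 1 0 u (out x u))"
    and "quadratic_condition n m W_delta R\<^sub>F \<longleftrightarrow> (\<exists>P \<in> pd_mats n. \<forall>x \<in> carrier_vec n. \<forall>u \<in> carrier_vec m.
      energy P (step x u) \<le> energy P x + supply_rate 1 0 1 u (out x u))"
proof goal_cases
  have Pc: "P \<in> carrier_mat n n" "mat_adjoint P = P" if "P \<in> pd_mats n" for P
    using that by (auto simp: pd_mats_def)
  have uminus_cscalar: "(- v) \<bullet>c w = - (v \<bullet>c w)" if "v \<in> carrier_vec k" "w \<in> carrier_vec k" for v w :: "complex vec" and k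
    using that by simp
  have zero_mult: "0\<^sub>m k k *\<^sub>v v = 0\<^sub>v k" if "v \<in> carrier_vec k" for v :: "complex vec" and k
    using that by (intro eq_vecI) auto
  have uminus_mult: "(- X) *\<^sub>v v = - (X *\<^sub>v v)" if "X \<in> carrier_mat k k" "v \<in> carrier_vec k" for X :: "complex mat" and v k
    using that by simp
  have comm: "Re (u \<bullet>c y) = Re (y \<bullet>c u)" if "u \<in> carrier_vec m" "y \<in> carrier_vec m" for u y :: "complex vec"
    using Re_cscalar_prod_swap that by blast
  note simps = uminus_cscalar[of _ n] uminus_cscalar[of _ m] zero_mult uminus_mult[of _ n] uminus_mult[of _ m] supply_rate_def
  case 1 show ?case
    unfolding quadratic_condition_def R\<^sub>F_def W_eq_symmetric_block_mat
    apply (intro bex_cong refl)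
    subgoal premises P for P
      apply (subst block_congruence_psd_iff[OF hermitian_mat_zero hermitian_mat_zero hermitian_mat_uminus[OF hermitian_mat_pd[OF P]] hermitian_mat_one hermitian_mat_zero hermitian_mat_zero])
      apply (intro ball_cong refl)
      subgoal for x u
        using Pc(1)[OF P] pd_mats_swap[OF P, of x "step x u"] comm[of u "out x u"]
        by (auto simp: simps)
      done
    done
  case 2 show ?case
    unfolding quadratic_condition_def R\<^sub>F_def W_eq_symmetric_block_mat
    apply (intro bex_cong refl)
    subgoal premises P for P
      apply (subst block_congruence_psd_iff[OF hermitian_mat_zero hermitian_mat_uminus[OF hermitian_mat_one] hermitian_mat_uminus[OF hermitian_mat_pd[OF P]] hermitian_mat_zero hermitian_mat_zero hermitian_mat_one])
      apply (intro ball_cong refl)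
      subgoal for x u
        using Pc(1)[OF P] pd_mats_swap[OF P, of x "step x u"] comm[of u "out x u"]
        by (auto simp: simps)
      done
    done
  case 3 show ?case
    unfolding quadratic_condition_def R\<^sub>F_def W_eq_symmetric_block_mat
    apply (intro bex_cong refl)
    subgoal premises P for P
      apply (subst block_congruence_psd_iff[OF hermitian_mat_uminus[OF hermitian_mat_pd[OF P]] hermitian_mat_zero hermitian_mat_zero hermitian_mat_one hermitian_mat_pd[OF P] hermitian_mat_zero])
      apply (intro ball_cong refl)
      subgoal for x u
        using Pc(1)[OF P] pd_mats_swap[OF P, of x "step x u"] comm[of u "out x u"]
        by (auto simp: simps)
      done
    done
  case 4 show ?case
    unfolding quadratic_condition_def R\<^sub>F_def W_eq_symmetric_block_mat
    apply (intro bex_cong refl)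
    subgoal premises P for P
      apply (subst block_congruence_psd_iff[OF hermitian_mat_uminus[OF hermitian_mat_pd[OF P]] hermitian_mat_uminus[OF hermitian_mat_one] hermitian_mat_zero hermitian_mat_zero hermitian_mat_pd[OF P] hermitian_mat_one])
      apply (intro ball_cong refl)
      subgoal for x u
        using Pc(1)[OF P] pd_mats_swap[OF P, of x "step x u"] comm[of u "out x u"]
        by (auto simp: simps)
      done
    done
qed

end

section \<open>The target sets as supply inequalities\<close>

text \<open>\<open>v\<^sup>* (X + X\<^sup>*) v = 2 Re (v\<^sup>* X v)\<close>.\<close>

lemma L_bar_iff_supply:
  assumes X: "X \<in> carrier_mat m m"
  shows "X \<in> L_bar m \<longleftrightarrow> (\<forall>v \<in> carrier_vec m. 0 \<le> supply_rate 0 1 0 v (X *\<^sub>v v))"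
proof -
  have X': "mat_adjoint X \<in> carrier_mat m m" using X by auto
  have herm: "mat_adjoint (X + mat_adjoint X) = X + mat_adjoint X"
    using X X' by (simp add: mat_adjoint_add[of _ m m] mat_adjoint_mat_adjoint comm_add_mat[of _ m m])
  have "Re (((X + mat_adjoint X) *\<^sub>v v) \<bullet>c v) = supply_rate 0 1 0 v (X *\<^sub>v v)" if v: "v \<in> carrier_vec m" for v
  proof -
    have Xv: "X *\<^sub>v v \<in> carrier_vec m" using X v by simp
    have "((X + mat_adjoint X) *\<^sub>v v) \<bullet>c v = (X *\<^sub>v v) \<bullet>c v + (mat_adjoint X *\<^sub>v v) \<bullet>c v"
      using X X' v by (simp add: add_mult_distrib_mat_vec[of _ m m] cscalar_prod_add_left[of _ m])
    also have "(mat_adjoint X *\<^sub>v v) \<bullet>c v = v \<bullet>c (X *\<^sub>v v)" by (rule mat_adjoint_cscalar_prod[OF X v v])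
    finally show ?thesis using Re_cscalar_prod_swap[OF Xv v] by (simp add: supply_rate_def)
  qed
  then show ?thesis using X X' herm by (auto simp: L_bar_def psd_mats_def)
qed

lemma euclid_norm_smult:
  assumes "v \<in> carrier_vec k"
  shows "euclid_norm (l \<cdot>\<^sub>v v) = norm l * euclid_norm v"
proof -
  have "Re ((l \<cdot>\<^sub>v v) \<bullet>c (l \<cdot>\<^sub>v v)) = (norm l)\<^sup>2 * Re (v \<bullet>c v)"
    unfolding Re_cscalar_prod_self[OF smult_carrier_vec[THEN iffD2, OF assms]] Re_cscalar_prod_self[OF assms]
    using assms by (simp add: norm_mult power_mult_distrib sum_distrib_left)
  then show ?thesis by (simp add: euclid_norm_def real_sqrt_mult)
qed

lemma euclid_norm_le_iff:
  "euclid_norm v \<le> euclid_norm w \<longleftrightarrow> Re (v \<bullet>c v) \<le> Re (w \<bullet>c w)"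
  by (simp add: euclid_norm_def)

lemma euclid_norm_eq_0_iff:
  assumes "v \<in> carrier_vec k"
  shows "euclid_norm v = 0 \<longleftrightarrow> v = 0\<^sub>v k"
proof -
  have "euclid_norm v = 0 \<longleftrightarrow> (\<Sum>i<k. (norm (v $ i))\<^sup>2) = 0"
    by (simp add: euclid_norm_def Re_cscalar_prod_self[OF assms])
  also have "\<dots> \<longleftrightarrow> (\<forall>i<k. v $ i = 0)" by (subst sum_nonneg_eq_0_iff) auto
  finally show ?thesis using assms by auto
qed

lemma norm_index_le_euclid_norm:
  assumes "v \<in> carrier_vec k" "i < k"
  shows "norm (v $ i) \<le> euclid_norm v"
proof -
  have "(norm (v $ i))\<^sup>2 \<le> (\<Sum>i<k. (norm (v $ i))\<^sup>2)"
    using assms(2) by (intro member_le_sum) auto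
  then show ?thesis
    unfolding euclid_norm_def Re_cscalar_prod_self[OF assms(1)] by (rule real_le_rsqrt)
qed

text \<open>Without boundedness the supremum in the definition of the spectral norm would carry no
  information.\<close>

lemma bdd_above_spectral_norm:
  assumes X: "X \<in> carrier_mat k m"
  shows "bdd_above ((\<lambda>v. euclid_norm (X *\<^sub>v v)) ` {v \<in> carrier_vec m. euclid_norm v \<le> 1})"
proof (rule bdd_aboveI2)
  fix v assume "v \<in> {v \<in> carrier_vec m. euclid_norm v \<le> 1}"
  then have v: "v \<in> carrier_vec m" "euclid_norm v \<le> 1" by auto
  have "norm ((X *\<^sub>v v) $ i) \<le> (\<Sum>j<m. norm (X $$ (i,j)))" if i: "i < k" for i
  proof -
    have "norm ((X *\<^sub>v v) $ i) \<le> (\<Sum>j<m. norm (X $$ (i,j) * v $ j))"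
      unfolding mult_mat_vec_index_sum[OF X v(1) i] by (rule norm_sum)
    also have "\<dots> \<le> (\<Sum>j<m. norm (X $$ (i,j)) * 1)"
      unfolding norm_mult using norm_index_le_euclid_norm[OF v(1)] v(2)
      by (intro sum_mono mult_left_mono) force+
    finally show ?thesis by simp
  qed
  then have "Re ((X *\<^sub>v v) \<bullet>c (X *\<^sub>v v)) \<le> (\<Sum>i<k. (\<Sum>j<m. norm (X $$ (i,j)))\<^sup>2)"
    unfolding Re_cscalar_prod_self[OF mult_mat_vec_carrier[OF X v(1)]]
    by (intro sum_mono power_mono) auto
  then show "euclid_norm (X *\<^sub>v v) \<le> sqrt (\<Sum>i<k. (\<Sum>j<m. norm (X $$ (i,j)))\<^sup>2)"
    unfolding euclid_norm_def by (rule real_sqrt_le_mono)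
qed

lemma spectral_norm_le_1_iff:
  assumes X: "X \<in> carrier_mat k m"
  shows "spectral_norm X \<le> 1 \<longleftrightarrow> (\<forall>v \<in> carrier_vec m. euclid_norm (X *\<^sub>v v) \<le> euclid_norm v)"
proof
  assume le: "spectral_norm X \<le> 1"
  show "\<forall>v \<in> carrier_vec m. euclid_norm (X *\<^sub>v v) \<le> euclid_norm v"
  proof
    fix v :: "complex vec" assume v: "v \<in> carrier_vec m"
    show "euclid_norm (X *\<^sub>v v) \<le> euclid_norm v"
    proof (cases "euclid_norm v = 0")
      case True
      then have "v = 0\<^sub>v m" using euclid_norm_eq_0_iff[OF v] by simp
      then have "X *\<^sub>v v = 0\<^sub>v k" using X by (intro eq_vecI) auto
      then show ?thesis using True euclid_norm_eq_0_iff[of "X *\<^sub>v v" k] by simp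
    next
      case False
      have pos: "euclid_norm v > 0"
        using False Re_cscalar_prod_nonneg[OF v] by (auto simp: euclid_norm_def less_le)
      define l :: complex where "l = of_real (1 / euclid_norm v)"
      have l: "norm l = 1 / euclid_norm v" using pos by (simp add: l_def norm_divide)
      have "euclid_norm (X *\<^sub>v (l \<cdot>\<^sub>v v)) \<le> spectral_norm X"
        unfolding spectral_norm_def using X v l pos
        by (intro cSUP_upper) (auto intro: bdd_above_spectral_norm simp: euclid_norm_smult[OF v])
      also have "X *\<^sub>v (l \<cdot>\<^sub>v v) = l \<cdot>\<^sub>v (X *\<^sub>v v)" by (rule mult_mat_vec[OF X v])
      finally have "euclid_norm (X *\<^sub>v v) / euclid_norm v \<le> 1"
        using le euclid_norm_smult[OF mult_mat_vec_carrier[OF X v], of l] l by simp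
      then show ?thesis using pos by (simp add: field_simps)
    qed
  qed
next
  assume *: "\<forall>v \<in> carrier_vec m. euclid_norm (X *\<^sub>v v) \<le> euclid_norm v"
  have "euclid_norm (0\<^sub>v m) = 0" using euclid_norm_eq_0_iff[of "0\<^sub>v m" m] by simp
  then have "0\<^sub>v m \<in> {v \<in> carrier_vec m. euclid_norm v \<le> 1}" by simp
  moreover have "euclid_norm (X *\<^sub>v v) \<le> 1" if "v \<in> {v \<in> carrier_vec m. euclid_norm v \<le> 1}" for v
    using * that by (auto intro: order_trans)
  ultimately show "spectral_norm X \<le> 1"
    unfolding spectral_norm_def using X by (intro cSUP_least) (auto intro!: exI[of _ "0\<^sub>v m"])
qed

lemma S_bar_iff_supply:
  assumes X: "X \<in> carrier_mat m m"
  shows "X \<in> S_bar m \<longleftrightarrow> (\<forall>v \<in> carrier_vec m. 0 \<le> supply_rate 1 0 1 v (X *\<^sub>v v))"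
  using X by (simp add: S_bar_def spectral_norm_le_1_iff euclid_norm_le_iff supply_rate_def)

section \<open>Sufficiency\<close>

text \<open>On solutions of \<open>A x + B u = z x\<close> the rate of change of the stored energy is a multiple \<open>\<kappa> z\<close> of
  the energy itself, negative in the region. An eigenvector of \<open>A\<close> is such a solution with \<open>u = 0\<close>,
  for which the supply is nonpositive; so the region contains no eigenvalue.\<close>

lemma strict_dissipation_imp_stable_and_supply_nonneg:
  assumes R: "is_realization n m F A B C D" and S: "open S" and c: "0 \<le> c"
    and P: "P \<in> pd_mats n" and \<kappa>: "\<And>z. z \<in> S \<Longrightarrow> \<kappa> z < 0"
    and diss: "\<And>z x u. z \<in> S \<Longrightarrow> x \<in> carrier_vec n \<Longrightarrow> u \<in> carrier_vec m \<Longrightarrow> A *\<^sub>v x + B *\<^sub>v u = z \<cdot>\<^sub>v x \<Longrightarrow>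
      0 \<le> \<kappa> z * energy P x + supply_rate a b c u (C *\<^sub>v x + D *\<^sub>v u)"
  shows "mat_analytic_on m F S" and "\<And>z v. z \<in> S \<Longrightarrow> v \<in> carrier_vec m \<Longrightarrow> 0 \<le> supply_rate a b c v (F z *\<^sub>v v)"
proof -
  interpret linear_system n m A B C D using R by (simp add: is_realization_iff)
  have V: "0 < energy P x" if "x \<in> carrier_vec n" "x \<noteq> 0\<^sub>v n" for x
    using P that by (simp add: pd_mats_def)
  have V0: "0 \<le> energy P x" if x: "x \<in> carrier_vec n" for x
  proof (cases "x = 0\<^sub>v n")
    case True
    have "P *\<^sub>v x \<in> carrier_vec n" using P x by (auto simp: pd_mats_def)
    then show ?thesis using True by simp
  qed (use V[OF x] in simp)
  have d: "det (resolvent_mat n A z) \<noteq> 0" if z: "z \<in> S" for z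
  proof
    assume d: "det (resolvent_mat n A z) = 0"
    have M: "resolvent_mat n A z \<in> carrier_mat n n" using A by auto
    obtain x where x: "x \<in> carrier_vec n" "x \<noteq> 0\<^sub>v n" "resolvent_mat n A z *\<^sub>v x = 0\<^sub>v n"
      using d det_0_iff_vec_prod_zero[OF M] by auto
    have "z \<cdot>\<^sub>v x - A *\<^sub>v x = 0\<^sub>v n" using x resolvent_mat_mult_vec[OF A x(1)] by simp
    then have "(z \<cdot>\<^sub>v x - A *\<^sub>v x) $ i = 0" if "i < n" for i using that by simp
    then have "A *\<^sub>v x + B *\<^sub>v 0\<^sub>v m = z \<cdot>\<^sub>v x" using A B x(1) by (intro eq_vecI) auto
    then have "0 \<le> \<kappa> z * energy P x + supply_rate a b c (0\<^sub>v m) (C *\<^sub>v x + D *\<^sub>v 0\<^sub>v m)"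
      using diss[OF z x(1), of "0\<^sub>v m"] by simp
    moreover have y: "C *\<^sub>v x + D *\<^sub>v 0\<^sub>v m \<in> carrier_vec m"
      using C D x by (intro add_carrier_vec mult_mat_vec_carrier[of _ m n] mult_mat_vec_carrier[of _ m m]) auto
    have "supply_rate a b c (0\<^sub>v m) (C *\<^sub>v x + D *\<^sub>v 0\<^sub>v m) \<le> 0"
      unfolding supply_rate_zero_input[OF y] using c Re_cscalar_prod_nonneg[OF y]
      by simp
    moreover have "\<kappa> z * energy P x < 0" using \<kappa>[OF z] V[OF x(1,2)] by (rule mult_neg_pos)
    ultimately show False by linarith
  qed
  have FT: "F z = transfer_function n A B C D z" if "z \<in> S" for z
    using R d[OF that] by (simp add: is_realization_iff)
  show "mat_analytic_on m F S"
    unfolding mat_analytic_on_def analytic_on_open[OF S]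
  proof (intro allI impI)
    fix i j assume ij: "i < m" "j < m"
    have "(\<lambda>z. transfer_function n A B C D z $$ (i,j)) holomorphic_on S"
      by (rule holomorphic_on_subset[OF holomorphic_on_transfer_function_entry[OF ij]]) (use d in auto)
    then show "(\<lambda>z. F z $$ (i,j)) holomorphic_on S"
      by (rule holomorphic_transform) (simp add: FT)
  qed
  fix z and v :: "complex vec" assume z: "z \<in> S" and v: "v \<in> carrier_vec m"
  define x where "x = resolvent n A z *\<^sub>v (B *\<^sub>v v)"
  have x: "x \<in> carrier_vec n" "z \<cdot>\<^sub>v x = A *\<^sub>v x + B *\<^sub>v v"
    using resolvent_inverse(1)[OF A d[OF z]] resolvent_solves[OF A d[OF z], of "B *\<^sub>v v"] B v by (auto simp: x_def)
  have "0 \<le> \<kappa> z * energy P x + supply_rate a b c v (C *\<^sub>v x + D *\<^sub>v v)"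
    using diss[OF z x(1) v] x(2) by simp
  moreover have "\<kappa> z * energy P x \<le> 0"
    using \<kappa>[OF z] V0[OF x(1)] by (intro mult_nonpos_nonneg) auto
  ultimately show "0 \<le> supply_rate a b c v (F z *\<^sub>v v)"
    using realization_mult_vec[OF R d[OF z] v x] by simp
qed

lemma quadratic_form_smult:
  fixes P :: "complex mat"
  assumes "P \<in> carrier_mat n n" "x \<in> carrier_vec n"
  shows "(P *\<^sub>v (z \<cdot>\<^sub>v x)) \<bullet>c (z \<cdot>\<^sub>v x) = of_real ((norm z)\<^sup>2) * ((P *\<^sub>v x) \<bullet>c x)"
    and "(P *\<^sub>v (z \<cdot>\<^sub>v x)) \<bullet>c x = z * ((P *\<^sub>v x) \<bullet>c x)"
proof -
  have Px: "P *\<^sub>v x \<in> carrier_vec n" using assms by simp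
  have 1: "P *\<^sub>v (z \<cdot>\<^sub>v x) = z \<cdot>\<^sub>v (P *\<^sub>v x)" by (rule mult_mat_vec[OF assms])
  show "(P *\<^sub>v (z \<cdot>\<^sub>v x)) \<bullet>c (z \<cdot>\<^sub>v x) = of_real ((norm z)\<^sup>2) * ((P *\<^sub>v x) \<bullet>c x)"
    unfolding 1 complex_norm_square using Px assms(2) by (simp add: conjugate_smult_vec mult_ac)
  show "(P *\<^sub>v (z \<cdot>\<^sub>v x)) \<bullet>c x = z * ((P *\<^sub>v x) \<bullet>c x)"
    unfolding 1 using Px assms(2) by simp
qed

lemma quadratic_form_hermitian_real:
  assumes "P \<in> pd_mats n" "x \<in> carrier_vec n"
  shows "Im ((P *\<^sub>v x) \<bullet>c x) = 0"
proof -
  have P: "P \<in> carrier_mat n n" "mat_adjoint P = P" using assms(1) by (auto simp: pd_mats_def)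
  have "(P *\<^sub>v x) \<bullet>c x = x \<bullet>c (P *\<^sub>v x)" using mat_adjoint_cscalar_prod[OF P(1) assms(2,2)] P(2) by simp
  also have "\<dots> = cnj ((P *\<^sub>v x) \<bullet>c x)" using P assms by (intro cscalar_prod_swap) auto
  finally have "Im ((P *\<^sub>v x) \<bullet>c x) = Im (cnj ((P *\<^sub>v x) \<bullet>c x))" by (rule arg_cong)
  then show ?thesis by simp
qed

lemma discrete_sufficiency:
  assumes R: "is_realization n m F A B C D" and c: "0 \<le> c" and P: "P \<in> pd_mats n"
    and diss: "\<And>x u. x \<in> carrier_vec n \<Longrightarrow> u \<in> carrier_vec m \<Longrightarrow>
      energy P (A *\<^sub>v x + B *\<^sub>v u) \<le> energy P x + supply_rate a b c u (C *\<^sub>v x + D *\<^sub>v u)"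
  shows "mat_analytic_on m F disc_exterior"
    and "\<And>z v. z \<in> disc_exterior \<Longrightarrow> v \<in> carrier_vec m \<Longrightarrow> 0 \<le> supply_rate a b c v (F z *\<^sub>v v)"
proof -
  have S: "open disc_exterior" unfolding disc_exterior_def by (intro open_Collect_less continuous_intros)
  have Pc: "P \<in> carrier_mat n n" using P by (auto simp: pd_mats_def)
  have \<kappa>: "1 - (norm z)\<^sup>2 < 0" if "z \<in> disc_exterior" for z :: complex
    using that by (simp add: disc_exterior_def power2_eq_square) (metis less_1_mult)
  have d: "0 \<le> (1 - (norm z)\<^sup>2) * energy P x + supply_rate a b c u (C *\<^sub>v x + D *\<^sub>v u)"
    if "x \<in> carrier_vec n" "u \<in> carrier_vec m" "A *\<^sub>v x + B *\<^sub>v u = z \<cdot>\<^sub>v x" for z x u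
    using diss[OF that(1,2)] unfolding that(3) quadratic_form_smult[OF Pc that(1)] by (simp add: algebra_simps)
  \<comment> \<open>From \<open>V (z x) = |z|\<^sup>2 V x\<close>.\<close>
  note L = strict_dissipation_imp_stable_and_supply_nonneg[OF R S c P, of "\<lambda>z. 1 - (norm z)\<^sup>2" a b, OF \<kappa> d]
  show "mat_analytic_on m F disc_exterior" by (rule L(1))
  show "0 \<le> supply_rate a b c v (F z *\<^sub>v v)" if "z \<in> disc_exterior" "v \<in> carrier_vec m" for z v
    using that by (intro L(2))
qed

lemma continuous_sufficiency:
  assumes R: "is_realization n m F A B C D" and c: "0 \<le> c" and P: "P \<in> pd_mats n"
    and diss: "\<And>x u. x \<in> carrier_vec n \<Longrightarrow> u \<in> carrier_vec m \<Longrightarrow>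
      2 * Re ((P *\<^sub>v (A *\<^sub>v x + B *\<^sub>v u)) \<bullet>c x) \<le> supply_rate a b c u (C *\<^sub>v x + D *\<^sub>v u)"
  shows "mat_analytic_on m F right_half_plane"
    and "\<And>z v. z \<in> right_half_plane \<Longrightarrow> v \<in> carrier_vec m \<Longrightarrow> 0 \<le> supply_rate a b c v (F z *\<^sub>v v)"
proof -
  have S: "open right_half_plane" unfolding right_half_plane_def by (intro open_Collect_less continuous_intros)
  have Pc: "P \<in> carrier_mat n n" using P by (auto simp: pd_mats_def)
  have \<kappa>: "- 2 * Re z < 0" if "z \<in> right_half_plane" for z
    using that by (simp add: right_half_plane_def)
  have d: "0 \<le> (- 2 * Re z) * energy P x + supply_rate a b c u (C *\<^sub>v x + D *\<^sub>v u)"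
    if "x \<in> carrier_vec n" "u \<in> carrier_vec m" "A *\<^sub>v x + B *\<^sub>v u = z \<cdot>\<^sub>v x" for z x u
    using diss[OF that(1,2)] quadratic_form_hermitian_real[OF P that(1)]
    unfolding that(3) quadratic_form_smult[OF Pc that(1)] by (simp add: algebra_simps)
  \<comment> \<open>From \<open>2 Re (x\<^sup>* P (z x)) = 2 Re z V x\<close>, as \<open>V x\<close> is real.\<close>
  note L = strict_dissipation_imp_stable_and_supply_nonneg[OF R S c P, of "\<lambda>z. - 2 * Re z" a b, OF \<kappa> d]
  show "mat_analytic_on m F right_half_plane" by (rule L(1))
  show "0 \<le> supply_rate a b c v (F z *\<^sub>v v)" if "z \<in> right_half_plane" "v \<in> carrier_vec m" for z v
    using that by (intro L(2))
qed

section \<open>Necessity in discrete time\<close>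

text \<open>The input \<open>u = - e \<eta>\<close> gives \<open>- 2 e |\<eta>|\<^sup>2\<close> to first order in \<open>e\<close>; the feedthrough \<open>D\<close> enters
  only in second order.\<close>

lemma positive_supply_extractable:
  assumes D: "D \<in> carrier_mat m m" and \<eta>: "\<eta> \<in> carrier_vec m" "\<eta> \<noteq> 0\<^sub>v m"
  shows "\<exists>u \<in> carrier_vec m. supply_rate 0 1 0 u (\<eta> + D *\<^sub>v u) < 0"
proof -
  define h where "h = Re (\<eta> \<bullet>c \<eta>)"
  define q where "q = \<bar>Re ((D *\<^sub>v \<eta>) \<bullet>c \<eta>)\<bar>"
  have h: "0 < h"
    using \<eta> conjugate_square_greater_0_vec[OF \<eta>(1)] by (simp add: h_def less_complex_def)
  \<comment> \<open>Small enough for the first-order term \<open>e h\<close> to exceed the second-order term \<open>e\<^sup>2 q\<close>.\<close>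
  define e where "e = h / (q + 1)"
  have q: "0 \<le> q" by (simp add: q_def)
  have e: "0 < e" using h q by (simp add: e_def)
  have "e * q < h" using h q by (simp add: e_def field_simps)
  define u where "u = of_real (- e) \<cdot>\<^sub>v \<eta>"
  have D\<eta>: "D *\<^sub>v \<eta> \<in> carrier_vec m" using D \<eta> by simp
  have "D *\<^sub>v u = of_real (- e) \<cdot>\<^sub>v (D *\<^sub>v \<eta>)" unfolding u_def by (rule mult_mat_vec[OF D \<eta>(1)])
  then have "(\<eta> + D *\<^sub>v u) \<bullet>c u = of_real (- e) * (\<eta> \<bullet>c \<eta> + of_real (- e) * ((D *\<^sub>v \<eta>) \<bullet>c \<eta>))"
    using \<eta> D\<eta> by (simp add: u_def conjugate_smult_vec cscalar_prod_add_left[of _ m] add_scalar_prod_distrib[of _ m] algebra_simps)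
  then have "supply_rate 0 1 0 u (\<eta> + D *\<^sub>v u) = 2 * (- e * (h - e * Re ((D *\<^sub>v \<eta>) \<bullet>c \<eta>)))"
    by (simp add: supply_rate_def h_def)
  moreover have "e * Re ((D *\<^sub>v \<eta>) \<bullet>c \<eta>) \<le> e * q" using e by (intro mult_left_mono) (auto simp: q_def)
  then have "0 < h - e * Re ((D *\<^sub>v \<eta>) \<bullet>c \<eta>)" using \<open>e * q < h\<close> by linarith
  ultimately have "supply_rate 0 1 0 u (\<eta> + D *\<^sub>v u) < 0" using e by (simp add: mult_pos_pos)
  moreover have "u \<in> carrier_vec m" using \<eta> by (simp add: u_def)
  ultimately show ?thesis by blast
qed

lemma bounded_supply_extractable:
  assumes D: "D \<in> carrier_mat m m" and \<eta>: "\<eta> \<in> carrier_vec m" "\<eta> \<noteq> 0\<^sub>v m"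
  shows "\<exists>u \<in> carrier_vec m. supply_rate 1 0 1 u (\<eta> + D *\<^sub>v u) < 0"
proof (intro bexI)
  have "D *\<^sub>v 0\<^sub>v m = 0\<^sub>v m" using D by (intro eq_vecI) auto
  then have "supply_rate 1 0 1 (0\<^sub>v m) (\<eta> + D *\<^sub>v 0\<^sub>v m) = - Re (\<eta> \<bullet>c \<eta>)"
    using \<eta> supply_rate_zero_input[OF \<eta>(1), of 1 0 1] by simp
  then show "supply_rate 1 0 1 (0\<^sub>v m) (\<eta> + D *\<^sub>v 0\<^sub>v m) < 0"
    using \<eta> conjugate_square_greater_0_vec[OF \<eta>(1)] by (simp add: less_complex_def)
qed simp

lemma spectrum_bounded:
  assumes A: "A \<in> carrier_mat n n"
  obtains K where "0 < K" "\<And>z. K < norm z \<Longrightarrow> det (resolvent_mat n A z) \<noteq> 0"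
proof -
  have "bounded {z. det (resolvent_mat n A z) = 0}" by (rule finite_imp_bounded[OF finite_spectrum[OF A]])
  then obtain K where "0 < K" "\<And>z. z \<in> {z. det (resolvent_mat n A z) = 0} \<Longrightarrow> norm z \<le> K"
    unfolding bounded_pos by blast
  with that show ?thesis by force
qed

text \<open>The substitution \<open>w = 1 / z\<close> maps the exterior of the unit disc to the punctured disc.\<close>

lemma discrete_necessity:
  assumes Frat: "real_rational_mat m F" and R: "is_realization n m F A B C D" and min: "n = mcmillan_degree m F"
    and c: "0 \<le> c"
    and ext: "\<And>D \<eta>. D \<in> carrier_mat m m \<Longrightarrow> \<eta> \<in> carrier_vec m \<Longrightarrow> \<eta> \<noteq> 0\<^sub>v m \<Longrightarrow>
       \<exists>u \<in> carrier_vec m. supply_rate a b c u (\<eta> + D *\<^sub>v u) < 0"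
    and an: "mat_analytic_on m F disc_exterior"
    and diss: "\<And>z v. z \<in> disc_exterior \<Longrightarrow> v \<in> carrier_vec m \<Longrightarrow> 0 \<le> supply_rate a b c v (F z *\<^sub>v v)"
  shows "\<exists>P \<in> pd_mats n. \<forall>x \<in> carrier_vec n. \<forall>u \<in> carrier_vec m.
     energy P (A *\<^sub>v x + B *\<^sub>v u) \<le> energy P x + supply_rate a b c u (C *\<^sub>v x + D *\<^sub>v u)"
proof -
  interpret supplied_system n m A B C D a b c
    using R c by (simp add: is_realization_iff supplied_system_def supplied_system_axioms_def)
  have ext_in: "1 / w \<in> disc_exterior" if "0 < norm w" "norm w < 1" for w
    using that by (simp add: disc_exterior_def norm_divide)
  have "\<exists>P \<in> pd_mats n. \<forall>x \<in> carrier_vec n. \<forall>u \<in> carrier_vec m.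
     energy P (step x u) \<le> energy P x + s u (out x u)"
  proof (rule discrete_kyp[where G = "\<lambda>w. F (1 / w)"])
    show "controllable_pair n m A B" by (rule minimal_imp_controllable[OF Frat R min])
    show "controllable_pair n m A\<^sup>T C\<^sup>T" by (rule minimal_imp_observable[OF Frat R min])
    show "\<exists>u \<in> carrier_vec m. s u (\<eta> + D *\<^sub>v u) < 0" if "\<eta> \<in> carrier_vec m" "\<eta> \<noteq> 0\<^sub>v m" for \<eta>
      using ext[OF D that] .
    show "F (1 / w) \<in> carrier_mat m m" for w using Frat by (simp add: real_rational_mat_def)
    show "(\<lambda>w. F (1 / w) $$ (i,j)) holomorphic_on ball 0 1 - {0}" if "i < m" "j < m" for i j
    proof -
      have "(\<lambda>z. F z $$ (i,j)) holomorphic_on disc_exterior"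
        using an that by (auto simp: mat_analytic_on_def intro: analytic_imp_holomorphic)
      then have "((\<lambda>z. F z $$ (i,j)) \<circ> (\<lambda>w. 1 / w)) holomorphic_on ball 0 1 - {0}"
        by (intro holomorphic_on_compose_gen[where t = disc_exterior] holomorphic_intros)
          (auto intro!: ext_in)
      then show ?thesis by (simp add: o_def)
    qed
    show "0 \<le> s v (F (1 / w) *\<^sub>v v)" if "0 < norm w" "norm w < 1" "v \<in> carrier_vec m" for w v
      using diss[OF ext_in[OF that(1,2)] that(3)] .
    obtain K where K: "0 < K" "\<And>z. K < norm z \<Longrightarrow> det (resolvent_mat n A z) \<noteq> 0"
      using spectrum_bounded[OF A] by metis
    show "\<exists>r>0. \<forall>w. 0 < norm w \<longrightarrow> norm w < r \<longrightarrow> (\<forall>v \<in> carrier_vec m. \<forall>x \<in> carrier_vec n.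
        x = w \<cdot>\<^sub>v step x v \<longrightarrow> F (1 / w) *\<^sub>v v = out x v)"
    proof (intro exI[of _ "1 / K"] conjI allI impI ballI)
      show "0 < 1 / K" using K by simp
      fix w v x assume w: "0 < norm w" "norm w < 1 / K" and v: "v \<in> carrier_vec m" and x: "x \<in> carrier_vec n"
        and e: "x = w \<cdot>\<^sub>v step x v"
      have "K < norm (1 / w)" using w K by (simp add: norm_divide field_simps)
      then have d: "det (resolvent_mat n A (1 / w)) \<noteq> 0" by (rule K(2))
      have "x $ i = w * step x v $ i" if "i < n" for i
        using arg_cong[OF e, of "\<lambda>v. v $ i"] that step_carrier[OF x v] by simp
      then have "(1 / w) \<cdot>\<^sub>v x = step x v"
        using w x step_carrier[OF x v] by (intro eq_vecI) (auto simp: field_simps)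
      then show "F (1 / w) *\<^sub>v v = out x v"
        using realization_mult_vec[OF R d v x] by (simp add: step_def out_def)
    qed
  qed
  then show ?thesis by (simp add: step_def out_def)
qed

section \<open>Necessity in continuous time by the Cayley transform\<close>

lemma mat_eq_by_mult_vec:
  fixes X Y :: "complex mat"
  assumes X: "X \<in> carrier_mat k l" and Y: "Y \<in> carrier_mat k l"
    and eq: "\<And>v. v \<in> carrier_vec l \<Longrightarrow> X *\<^sub>v v = Y *\<^sub>v v"
  shows "X = Y"
proof (rule eq_matI)
  fix i j assume "i < dim_row Y" "j < dim_col Y"
  then have ij: "i < k" "j < l" using Y by auto
  have "col X j = col Y j"
    using eq[of "unit_vec l j"] mult_unit_vec_eq_col[OF X ij(2)] mult_unit_vec_eq_col[OF Y ij(2)] by simp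
  then have "col X j $ i = col Y j $ i" by simp
  then show "X $$ (i,j) = Y $$ (i,j)" using ij X Y by simp
qed (use X Y in auto)

lemma smult_mat_mult_vec:
  fixes X :: "complex mat"
  assumes X: "X \<in> carrier_mat k l" and v: "v \<in> carrier_vec l"
  shows "(c \<cdot>\<^sub>m X) *\<^sub>v v = c \<cdot>\<^sub>v (X *\<^sub>v v)"
proof (rule eq_vecI)
  fix i assume "i < dim_vec (c \<cdot>\<^sub>v (X *\<^sub>v v))"
  then have i: "i < k" using X by simp
  have cX: "c \<cdot>\<^sub>m X \<in> carrier_mat k l" using X by simp
  have "((c \<cdot>\<^sub>m X) *\<^sub>v v) $ i = c * (X *\<^sub>v v) $ i"
    unfolding mult_mat_vec_index_sum[OF cX v i] mult_mat_vec_index_sum[OF X v i]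
    using X i by (simp add: sum_distrib_left mult.assoc)
  then show "((c \<cdot>\<^sub>m X) *\<^sub>v v) $ i = (c \<cdot>\<^sub>v (X *\<^sub>v v)) $ i" using X i by simp
qed (use X in simp)

lemma cayley_mult_vec:
  fixes N :: "complex mat"
  assumes N: "N \<in> carrier_mat n n" and v: "v \<in> carrier_vec n"
  shows "(l \<cdot>\<^sub>m N - 1\<^sub>m n) *\<^sub>v v = l \<cdot>\<^sub>v (N *\<^sub>v v) - v"
  using N v by (simp add: minus_mult_distrib_mat_vec[of _ n n] smult_mat_mult_vec[OF N v])

text \<open>The Cayley transform is built from \<open>N = (s - A)\<^sup>-\<^sup>1\<close>. A subspace invariant under it is
  invariant under \<open>N\<close>; since \<open>N\<close> is injective, its restriction \<open>R'\<close> to that finite-dimensional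
  subspace is invertible, so the subspace is invariant under \<open>s - A\<close> and under \<open>A\<close> as well. The
  transformed pair therefore has no invariant subspaces beyond those of \<open>(A, B)\<close>.\<close>

lemma controllable_cayley:
  assumes A: "A \<in> carrier_mat n n" and B: "B \<in> carrier_mat n m" and N: "N \<in> carrier_mat n n"
    and inv: "resolvent_mat n A s * N = 1\<^sub>m n" "N * resolvent_mat n A s = 1\<^sub>m n"
    and nz: "s \<noteq> 0" "l \<noteq> 0"
    and ctrb: "controllable_pair n m A B"
  shows "controllable_pair n m ((2 * s) \<cdot>\<^sub>m N - 1\<^sub>m n) (l \<cdot>\<^sub>m (N * B))"
  unfolding controllable_pair_def
proof (intro allI impI)
  fix r T A' B'
  assume T: "T \<in> carrier_mat n r" and A': "A' \<in> carrier_mat r r" and B': "B' \<in> carrier_mat r m"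
    and inj: "inj_mat T" and AT: "((2 * s) \<cdot>\<^sub>m N - 1\<^sub>m n) * T = T * A'" and BT: "l \<cdot>\<^sub>m (N * B) = T * B'"
  have M: "resolvent_mat n A s \<in> carrier_mat n n" using A by auto
  have Ad: "(2 * s) \<cdot>\<^sub>m N - 1\<^sub>m n \<in> carrier_mat n n" using N by auto
  have MN: "resolvent_mat n A s *\<^sub>v (N *\<^sub>v v) = v" if "v \<in> carrier_vec n" for v
    using assoc_mult_mat_vec[OF M N that] inv that by simp
  have A'1: "A' + 1\<^sub>m r \<in> carrier_mat r r" using A' by auto
  define R' where "R' = (1 / (2 * s)) \<cdot>\<^sub>m (A' + 1\<^sub>m r)"
  have R': "R' \<in> carrier_mat r r" using A' by (auto simp: R'_def)
  have NT: "N *\<^sub>v (T *\<^sub>v v) = T *\<^sub>v (R' *\<^sub>v v)" if v: "v \<in> carrier_vec r" for v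
  proof -
    have Tv: "T *\<^sub>v v \<in> carrier_vec n" and A'v: "A' *\<^sub>v v \<in> carrier_vec r" using T A' v by auto
    have "(2 * s) \<cdot>\<^sub>v (N *\<^sub>v (T *\<^sub>v v)) - T *\<^sub>v v = T *\<^sub>v (A' *\<^sub>v v)"
      using assoc_mult_mat_vec[OF Ad T v] assoc_mult_mat_vec[OF T A' v] AT cayley_mult_vec[OF N Tv] by simp
    then have "2 * s * (N *\<^sub>v (T *\<^sub>v v)) $ i - (T *\<^sub>v v) $ i = (T *\<^sub>v (A' *\<^sub>v v)) $ i" if "i < n" for i
      using arg_cong[of _ _ "\<lambda>w. w $ i"] that N T
      by (metis (no_types, lifting) Tv carrier_vecD index_minus_vec(1) index_smult_vec(1) mult_mat_vec_carrier)
    then have "N *\<^sub>v (T *\<^sub>v v) = (1 / (2 * s)) \<cdot>\<^sub>v (T *\<^sub>v (A' *\<^sub>v v) + T *\<^sub>v v)"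
      using N T nz by (intro eq_vecI) (auto simp: field_simps simp del: index_mult_mat_vec)
    also have "T *\<^sub>v (A' *\<^sub>v v) + T *\<^sub>v v = T *\<^sub>v ((A' + 1\<^sub>m r) *\<^sub>v v)"
      using mult_add_distrib_mat_vec[OF T A'v v] A' v by (simp add: add_mult_distrib_mat_vec[of _ r r])
    also have "(1 / (2 * s)) \<cdot>\<^sub>v (T *\<^sub>v ((A' + 1\<^sub>m r) *\<^sub>v v)) = T *\<^sub>v (R' *\<^sub>v v)"
      using mult_mat_vec[OF T mult_mat_vec_carrier[OF A'1 v]] smult_mat_mult_vec[OF A'1 v]
      by (simp add: R'_def)
    finally show ?thesis .
  qed
  have "inj_mat R'"
    unfolding inj_mat_def
  proof (intro ballI impI)
    fix v assume "v \<in> carrier_vec (dim_col R')" and 0: "R' *\<^sub>v v = 0\<^sub>v (dim_row R')"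
    then have v: "v \<in> carrier_vec r" using R' by simp
    have zero: "X *\<^sub>v 0\<^sub>v k = 0\<^sub>v l" if "X \<in> carrier_mat l k" for X :: "complex mat" and k l
      using that by (intro eq_vecI) auto
    note T0 = zero[OF T] zero[OF M]
    have Tv: "T *\<^sub>v v \<in> carrier_vec n" using T v by simp
    have "N *\<^sub>v (T *\<^sub>v v) = 0\<^sub>v n" using NT[OF v] 0 R' T0 by simp
    then have "T *\<^sub>v v = 0\<^sub>v n" using MN[OF Tv] T0 by simp
    then show "v = 0\<^sub>v (dim_col R')" using inj v T R' by (auto simp: inj_mat_def)
  qed
  then obtain Q where Q: "Q \<in> carrier_mat r r" "R' * Q = 1\<^sub>m r"
    using inj_mat_square_inverse[OF R'] by metis
  have MT: "resolvent_mat n A s *\<^sub>v (T *\<^sub>v v) = T *\<^sub>v (Q *\<^sub>v v)" if v: "v \<in> carrier_vec r" for v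
  proof -
    have Qv: "Q *\<^sub>v v \<in> carrier_vec r" using Q v by simp
    have "T *\<^sub>v v = T *\<^sub>v (R' *\<^sub>v (Q *\<^sub>v v))" using assoc_mult_mat_vec[OF R' Q(1) v] Q v by simp
    also have "\<dots> = N *\<^sub>v (T *\<^sub>v (Q *\<^sub>v v))" by (rule NT[OF Qv, symmetric])
    finally show ?thesis using MN[of "T *\<^sub>v (Q *\<^sub>v v)"] T Qv by simp
  qed
  have sQ: "s \<cdot>\<^sub>m 1\<^sub>m r - Q \<in> carrier_mat r r" using Q by auto
  have "A * T = T * (s \<cdot>\<^sub>m 1\<^sub>m r - Q)"
  proof (rule mat_eq_by_mult_vec[of _ n r])
    fix v :: "complex vec" assume v: "v \<in> carrier_vec r"
    have Tv: "T *\<^sub>v v \<in> carrier_vec n" and Qv: "Q *\<^sub>v v \<in> carrier_vec r" using T Q v by auto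
    have "s \<cdot>\<^sub>v (T *\<^sub>v v) - A *\<^sub>v (T *\<^sub>v v) = T *\<^sub>v (Q *\<^sub>v v)"
      using MT[OF v] resolvent_mat_mult_vec[OF A Tv] by simp
    then have "A *\<^sub>v (T *\<^sub>v v) = s \<cdot>\<^sub>v (T *\<^sub>v v) - T *\<^sub>v (Q *\<^sub>v v)"
      using A Tv by (auto intro!: eq_vecI simp del: index_mult_mat_vec dest!: sym[of _ "T *\<^sub>v (Q *\<^sub>v v)"])
    also have "\<dots> = T *\<^sub>v (s \<cdot>\<^sub>v v - Q *\<^sub>v v)"
      using mult_minus_distrib_mat_vec[OF T _ Qv, of "s \<cdot>\<^sub>v v"] mult_mat_vec[OF T v] v by simp
    also have "s \<cdot>\<^sub>v v - Q *\<^sub>v v = (s \<cdot>\<^sub>m 1\<^sub>m r - Q) *\<^sub>v v"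
      using resolvent_mat_mult_vec[OF Q(1) v] by simp
    finally show "(A * T) *\<^sub>v v = (T * (s \<cdot>\<^sub>m 1\<^sub>m r - Q)) *\<^sub>v v"
      using assoc_mult_mat_vec[OF A T v] assoc_mult_mat_vec[OF T sQ v] by simp
  qed (use A T Q in auto)
  moreover have "B = T * ((1 / l) \<cdot>\<^sub>m (Q * B'))"
  proof (rule mat_eq_by_mult_vec[of _ n m])
    fix u :: "complex vec" assume u: "u \<in> carrier_vec m"
    have Bu: "B *\<^sub>v u \<in> carrier_vec n" and B'u: "B' *\<^sub>v u \<in> carrier_vec r" using B B' u by auto
    have NB: "N * B \<in> carrier_mat n m" and QB: "Q * B' \<in> carrier_mat r m" using N B Q B' by auto
    have NBu: "N *\<^sub>v (B *\<^sub>v u) \<in> carrier_vec n" using N Bu by simp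
    have "l \<cdot>\<^sub>v (N *\<^sub>v (B *\<^sub>v u)) = T *\<^sub>v (B' *\<^sub>v u)"
      using arg_cong[OF BT, of "\<lambda>X. X *\<^sub>v u"] smult_mat_mult_vec[OF NB u]
        assoc_mult_mat_vec[OF N B u] assoc_mult_mat_vec[OF T B' u] by simp
    then have "l \<cdot>\<^sub>v (B *\<^sub>v u) = T *\<^sub>v (Q *\<^sub>v (B' *\<^sub>v u))"
      using MT[OF B'u] mult_mat_vec[OF M NBu, of l] MN[OF Bu] by simp
    then have "B *\<^sub>v u = (1 / l) \<cdot>\<^sub>v (T *\<^sub>v (Q *\<^sub>v (B' *\<^sub>v u)))"
      using nz Bu by (metis nonzero_eq_divide_eq one_smult_vec smult_smult_assoc mult.commute)
    then show "B *\<^sub>v u = (T * ((1 / l) \<cdot>\<^sub>m (Q * B'))) *\<^sub>v u"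
      using assoc_mult_mat_vec[OF T _ u, of "(1 / l) \<cdot>\<^sub>m (Q * B')"] smult_mat_mult_vec[OF QB u]
        assoc_mult_mat_vec[OF Q(1) B' u] mult_mat_vec[OF T, of "Q *\<^sub>v (B' *\<^sub>v u)"] Q B'u QB by simp
  qed (use B T Q B' in auto)
  moreover have "s \<cdot>\<^sub>m 1\<^sub>m r - Q \<in> carrier_mat r r" "(1 / l) \<cdot>\<^sub>m (Q * B') \<in> carrier_mat r m"
    using Q B' by auto
  ultimately show "n \<le> r" using ctrb T inj unfolding controllable_pair_def by blast
qed

lemma quadratic_form_polarization:
  assumes P: "P \<in> pd_mats n" and p: "p \<in> carrier_vec n" and q: "q \<in> carrier_vec n"
  shows "energy P (p + q) - energy P (p - q) = 4 * Re ((P *\<^sub>v q) \<bullet>c p)"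
proof -
  have Pc: "P \<in> carrier_mat n n" using P by (auto simp: pd_mats_def)
  have Pp: "P *\<^sub>v p \<in> carrier_vec n" and Pq: "P *\<^sub>v q \<in> carrier_vec n" using Pc p q by auto
  have dist: "x \<bullet>c (y + z) = x \<bullet>c y + x \<bullet>c z" "x \<bullet>c (y - z) = x \<bullet>c y - x \<bullet>c z" "(x - y) \<bullet>c z = x \<bullet>c z - y \<bullet>c z"
    if "x \<in> carrier_vec n" "y \<in> carrier_vec n" "z \<in> carrier_vec n" for x y z :: "complex vec"
    using that by (simp_all add: cscalar_prod_eq_sum[of _ n] sum.distrib sum_subtractf algebra_simps)
  note swap = pd_mats_swap[OF P p q]
  show ?thesis
    unfolding mult_add_distrib_mat_vec[OF Pc p q] mult_minus_distrib_mat_vec[OF Pc p q]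
    using p q Pp Pq swap by (simp add: dist cscalar_prod_add_left[of _ n])
qed

lemma pd_mats_smult:
  assumes P: "P \<in> pd_mats n" and t: "0 < t"
  shows "of_real t \<cdot>\<^sub>m P \<in> pd_mats n"
    and "x \<in> carrier_vec n \<Longrightarrow> y \<in> carrier_vec n \<Longrightarrow>
      Re (((of_real t \<cdot>\<^sub>m P) *\<^sub>v x) \<bullet>c y) = t * Re ((P *\<^sub>v x) \<bullet>c y)"
proof -
  have Pc: "P \<in> carrier_mat n n" "mat_adjoint P = P" using P by (auto simp: pd_mats_def)
  show form: "Re (((of_real t \<cdot>\<^sub>m P) *\<^sub>v x) \<bullet>c y) = t * Re ((P *\<^sub>v x) \<bullet>c y)"
    if "x \<in> carrier_vec n" "y \<in> carrier_vec n" for x y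
    using Pc that by (simp add: smult_mat_mult_vec[OF Pc(1)])
  have "mat_adjoint (of_real t \<cdot>\<^sub>m P) = of_real t \<cdot>\<^sub>m P" using Pc by (simp add: mat_adjoint_smult)
  then show "of_real t \<cdot>\<^sub>m P \<in> pd_mats n"
    using P t form by (auto simp: pd_mats_def)
qed

text \<open>The discrete-time lemma is applied to the Cayley transform of the system, whose transfer function
  is \<open>F\<close> composed with a Moebius map of the disc onto the right half plane.\<close>

lemma continuous_necessity:
  assumes Frat: "real_rational_mat m F" and R: "is_realization n m F A B C D" and min: "n = mcmillan_degree m F"
    and c: "0 \<le> c"
    and ext: "\<And>D \<eta>. D \<in> carrier_mat m m \<Longrightarrow> \<eta> \<in> carrier_vec m \<Longrightarrow> \<eta> \<noteq> 0\<^sub>v m \<Longrightarrow>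
       \<exists>u \<in> carrier_vec m. supply_rate a b c u (\<eta> + D *\<^sub>v u) < 0"
    and an: "mat_analytic_on m F right_half_plane"
    and diss: "\<And>z v. z \<in> right_half_plane \<Longrightarrow> v \<in> carrier_vec m \<Longrightarrow> 0 \<le> supply_rate a b c v (F z *\<^sub>v v)"
  shows "\<exists>P \<in> pd_mats n. \<forall>x \<in> carrier_vec n. \<forall>u \<in> carrier_vec m.
     2 * Re ((P *\<^sub>v (A *\<^sub>v x + B *\<^sub>v u)) \<bullet>c x) \<le> supply_rate a b c u (C *\<^sub>v x + D *\<^sub>v u)"
proof -
  interpret cont: linear_system n m A B C D using R by (simp add: is_realization_iff)
  note A = cont.A and B = cont.B and C = cont.C and D = cont.D
  obtain K where K: "0 < K" "\<And>z. K < norm z \<Longrightarrow> det (resolvent_mat n A z) \<noteq> 0"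
    using spectrum_bounded[OF A] by metis
  \<comment> \<open>Any positive real outside the spectrum can serve as the point that is sent to \<open>w = 0\<close>.\<close>
  define \<sigma> where "\<sigma> = K + 1"
  define s :: complex where "s = of_real \<sigma>"
  have \<sigma>: "0 < \<sigma>" using K by (simp add: \<sigma>_def)
  have s0: "s \<noteq> 0" using \<sigma> by (simp add: s_def)
  have ds: "det (resolvent_mat n A s) \<noteq> 0" using K \<sigma> by (intro K(2)) (simp add: s_def \<sigma>_def)
  define N where "N = resolvent n A s"
  have N: "N \<in> carrier_mat n n" and inv: "resolvent_mat n A s * N = 1\<^sub>m n" "N * resolvent_mat n A s = 1\<^sub>m n"
    using resolvent_inverse[OF A ds] by (auto simp: N_def)
  have M: "resolvent_mat n A s \<in> carrier_mat n n" using A by auto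
  \<comment> \<open>These matrices express \<open>\<xi>\<^sub>+ = s x + x'\<close> and \<open>y\<close> by \<open>\<xi> = s x - x'\<close> and \<open>u\<close>, where
    \<open>x' = A x + B u\<close>; the state is recovered as \<open>x = N (\<xi> + B u)\<close>.\<close>
  define Ad where "Ad = (2 * s) \<cdot>\<^sub>m N - 1\<^sub>m n"
  define Bd where "Bd = (2 * s) \<cdot>\<^sub>m (N * B)"
  define Cd where "Cd = C * N"
  define Dd where "Dd = C * N * B + D"
  interpret disc: supplied_system n m Ad Bd Cd Dd a b c
    using N B C D c by unfold_locales (auto simp: Ad_def Bd_def Cd_def Dd_def)
  have NB: "N * B \<in> carrier_mat n m" and CN: "C * N \<in> carrier_mat m n" using N B C by auto
  have state: "N *\<^sub>v (\<xi> + B *\<^sub>v u) \<in> carrier_vec n"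
    and step_eq: "disc.step \<xi> u = (2 * s) \<cdot>\<^sub>v (N *\<^sub>v (\<xi> + B *\<^sub>v u)) - \<xi>"
    and out_eq: "disc.out \<xi> u = C *\<^sub>v (N *\<^sub>v (\<xi> + B *\<^sub>v u)) + D *\<^sub>v u"
    if \<xi>: "\<xi> \<in> carrier_vec n" and u: "u \<in> carrier_vec m" for \<xi> u
  proof -
    have Bu: "B *\<^sub>v u \<in> carrier_vec n" using B u by simp
    have N\<xi>: "N *\<^sub>v \<xi> \<in> carrier_vec n" and NBu: "N *\<^sub>v (B *\<^sub>v u) \<in> carrier_vec n" using N \<xi> Bu by auto
    have add: "N *\<^sub>v (\<xi> + B *\<^sub>v u) = N *\<^sub>v \<xi> + N *\<^sub>v (B *\<^sub>v u)" by (rule mult_add_distrib_mat_vec[OF N \<xi> Bu])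
    show "N *\<^sub>v (\<xi> + B *\<^sub>v u) \<in> carrier_vec n" using N \<xi> Bu by simp
    have "Bd *\<^sub>v u = (2 * s) \<cdot>\<^sub>v (N *\<^sub>v (B *\<^sub>v u))"
      unfolding Bd_def smult_mat_mult_vec[OF NB u] assoc_mult_mat_vec[OF N B u] ..
    then show "disc.step \<xi> u = (2 * s) \<cdot>\<^sub>v (N *\<^sub>v (\<xi> + B *\<^sub>v u)) - \<xi>"
      unfolding disc.step_def unfolding add Ad_def cayley_mult_vec[OF N \<xi>] using N N\<xi> NBu \<xi>
      by (intro eq_vecI) (auto simp: algebra_simps simp del: index_mult_mat_vec)
    have "Cd *\<^sub>v \<xi> = C *\<^sub>v (N *\<^sub>v \<xi>)" unfolding Cd_def by (rule assoc_mult_mat_vec[OF C N \<xi>])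
    moreover have "Dd *\<^sub>v u = C *\<^sub>v (N *\<^sub>v (B *\<^sub>v u)) + D *\<^sub>v u"
      unfolding Dd_def using add_mult_distrib_mat_vec[OF mult_carrier_mat[OF CN B] D u]
        assoc_mult_mat_vec[OF CN B u] assoc_mult_mat_vec[OF C N Bu] by simp
    moreover have "C *\<^sub>v (N *\<^sub>v \<xi>) \<in> carrier_vec m" "C *\<^sub>v (N *\<^sub>v (B *\<^sub>v u)) \<in> carrier_vec m" "D *\<^sub>v u \<in> carrier_vec m"
      using C D N\<xi> NBu u by auto
    ultimately show "disc.out \<xi> u = C *\<^sub>v (N *\<^sub>v (\<xi> + B *\<^sub>v u)) + D *\<^sub>v u"
      unfolding disc.out_def add mult_add_distrib_mat_vec[OF C N\<xi> NBu]
      by (simp add: assoc_add_vec[of _ m])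
  qed
  \<comment> \<open>If \<open>x' = z x\<close>, then \<open>\<xi> = w \<xi>\<^sub>+\<close> holds for \<open>w = (s - z) / (s + z)\<close>; this is the inverse map.\<close>
  define \<phi> where "\<phi> w = s * (1 - w) / (1 + w)" for w :: complex
  have w1: "1 + w \<noteq> 0" if "norm w < 1" for w :: complex
    using that by (metis add.commute add_eq_0_iff norm_minus_cancel norm_one order_less_irrefl)
  have \<phi>_rhp: "\<phi> w \<in> right_half_plane" if "norm w < 1" for w
  proof -
    have "Re ((1 - w) * cnj (1 + w)) = 1 - (norm w)\<^sup>2"
      unfolding cmod_power2 by (simp add: power2_eq_square algebra_simps)
    moreover have "(norm w)\<^sup>2 < 1" using that by (simp add: power_less_one_iff abs_square_less_1)
    ultimately have "0 < Re ((1 - w) / (1 + w))" unfolding Re_complex_div_gt_0 by simp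
    moreover have "\<phi> w = of_real \<sigma> * ((1 - w) / (1 + w))" by (simp add: \<phi>_def s_def)
    ultimately show ?thesis using \<sigma> by (simp add: right_half_plane_def del: Re_divide times_divide_eq_right)
  qed
  have \<phi>_hol: "\<phi> holomorphic_on ball 0 1"
    unfolding \<phi>_def by (intro holomorphic_intros) (use w1 in auto)
  have "\<exists>P \<in> pd_mats n. \<forall>x \<in> carrier_vec n. \<forall>u \<in> carrier_vec m.
     energy P (disc.step x u) \<le> energy P x + supply_rate a b c u (disc.out x u)"
  proof (rule disc.discrete_kyp[where G = "\<lambda>w. F (\<phi> w)"])
    show "controllable_pair n m Ad Bd" unfolding Ad_def Bd_def
      by (rule controllable_cayley[OF A B N inv s0 _ minimal_imp_controllable[OF Frat R min]]) (use s0 in simp)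
    have NT: "N\<^sup>T \<in> carrier_mat n n" using N by simp
    have MT: "(resolvent_mat n A s)\<^sup>T = resolvent_mat n A\<^sup>T s"
      using A by (intro eq_matI) auto
    have invT: "resolvent_mat n A\<^sup>T s * N\<^sup>T = 1\<^sub>m n" "N\<^sup>T * resolvent_mat n A\<^sup>T s = 1\<^sub>m n"
      unfolding MT[symmetric] using transpose_mult[OF N M] transpose_mult[OF M N] inv by simp_all
    have "Ad\<^sup>T = (2 * s) \<cdot>\<^sub>m N\<^sup>T - 1\<^sub>m n" using N by (intro eq_matI) (auto simp: Ad_def)
    moreover have "Cd\<^sup>T = 1 \<cdot>\<^sub>m (N\<^sup>T * C\<^sup>T)" unfolding Cd_def transpose_mult[OF C N] by auto
    ultimately show "controllable_pair n m Ad\<^sup>T Cd\<^sup>T"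
      using controllable_cayley[of "A\<^sup>T" n "C\<^sup>T" m "N\<^sup>T" s 1, OF _ _ NT invT s0 _ minimal_imp_observable[OF Frat R min]] A C by simp
    have Ddc: "Dd \<in> carrier_mat m m" using D by (simp add: Dd_def)
    show "\<exists>u \<in> carrier_vec m. supply_rate a b c u (\<eta> + Dd *\<^sub>v u) < 0" if "\<eta> \<in> carrier_vec m" "\<eta> \<noteq> 0\<^sub>v m" for \<eta>
      by (rule ext[OF Ddc that])
    show "F (\<phi> w) \<in> carrier_mat m m" for w using Frat by (simp add: real_rational_mat_def)
    show "(\<lambda>w. F (\<phi> w) $$ (i,j)) holomorphic_on ball 0 1 - {0}" if "i < m" "j < m" for i j
    proof -
      have "(\<lambda>z. F z $$ (i,j)) holomorphic_on right_half_plane"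
        using an that by (auto simp: mat_analytic_on_def intro: analytic_imp_holomorphic)
      then have "((\<lambda>z. F z $$ (i,j)) \<circ> \<phi>) holomorphic_on ball 0 1 - {0}"
        using holomorphic_on_subset[OF \<phi>_hol]
        by (intro holomorphic_on_compose_gen[where t = right_half_plane]) (auto intro!: \<phi>_rhp)
      then show ?thesis by (simp add: o_def)
    qed
    show "0 \<le> supply_rate a b c v (F (\<phi> w) *\<^sub>v v)" if "0 < norm w" "norm w < 1" "v \<in> carrier_vec m" for w v
      using diss[OF \<phi>_rhp[OF that(2)] that(3)] .
    have "isCont \<phi> 0" unfolding \<phi>_def by (intro continuous_intros) auto
    then have "(\<phi> \<longlongrightarrow> s) (at 0)" by (simp add: isCont_def \<phi>_def)
    then have "\<forall>\<^sub>F w in at 0. \<phi> w \<in> {z. det (resolvent_mat n A z) \<noteq> 0}"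
      using ds by (intro topological_tendstoD open_resolvent_set[OF A]) auto
    then obtain r where r: "0 < r" "\<And>w. w \<noteq> 0 \<Longrightarrow> norm w < r \<Longrightarrow> det (resolvent_mat n A (\<phi> w)) \<noteq> 0"
      by (auto simp: eventually_at dist_norm)
    show "\<exists>r>0. \<forall>w. 0 < norm w \<longrightarrow> norm w < r \<longrightarrow> (\<forall>v \<in> carrier_vec m. \<forall>\<xi> \<in> carrier_vec n.
        \<xi> = w \<cdot>\<^sub>v disc.step \<xi> v \<longrightarrow> F (\<phi> w) *\<^sub>v v = disc.out \<xi> v)"
    proof (intro exI[of _ "min r 1"] conjI allI impI ballI)
      show "0 < min r 1" using r by simp
      fix w v \<xi> assume w: "0 < norm w" "norm w < min r 1" and v: "v \<in> carrier_vec m" and \<xi>: "\<xi> \<in> carrier_vec n"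
        and e: "\<xi> = w \<cdot>\<^sub>v disc.step \<xi> v"
      have d: "det (resolvent_mat n A (\<phi> w)) \<noteq> 0" using r(2)[of w] w by auto
      have nz: "1 + w \<noteq> 0" using w1[of w] w by simp
      define x where "x = N *\<^sub>v (\<xi> + B *\<^sub>v v)"
      have x: "x \<in> carrier_vec n" unfolding x_def by (rule state[OF \<xi> v])
      have Bv: "B *\<^sub>v v \<in> carrier_vec n" using B v by simp
      have Ax: "A *\<^sub>v x \<in> carrier_vec n" using A x by simp
      have "s \<cdot>\<^sub>v x = A *\<^sub>v x + (\<xi> + B *\<^sub>v v)"
        unfolding x_def N_def using \<xi> Bv by (intro resolvent_solves[OF A ds]) auto
      then have comp: "(s \<cdot>\<^sub>v x) $ i = (A *\<^sub>v x + (\<xi> + B *\<^sub>v v)) $ i" for i by simp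
      have 1: "s * x $ i = (A *\<^sub>v x) $ i + (\<xi> $ i + (B *\<^sub>v v) $ i)" if "i < n" for i
        using comp[of i] that x A B \<xi> by (simp del: index_mult_mat_vec)
      have "\<xi> = w \<cdot>\<^sub>v ((2 * s) \<cdot>\<^sub>v x - \<xi>)" using e unfolding step_eq[OF \<xi> v] x_def .
      then have "\<xi> $ i = (w \<cdot>\<^sub>v ((2 * s) \<cdot>\<^sub>v x - \<xi>)) $ i" for i by (rule arg_cong)
      then have 2: "\<xi> $ i = w * (2 * s * x $ i - \<xi> $ i)" if "i < n" for i
        using that x \<xi> by (metis carrier_vecD index_minus_vec(1,2) index_smult_vec(1,2))
      have "\<phi> w \<cdot>\<^sub>v x = A *\<^sub>v x + B *\<^sub>v v"
      proof (rule eq_vecI)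
        fix i assume "i < dim_vec (A *\<^sub>v x + B *\<^sub>v v)"
        then have i: "i < n" using B by simp
        have "(1 + w) * \<xi> $ i = 2 * s * w * x $ i" using 2[OF i] by (simp add: algebra_simps)
        then have "\<phi> w * x $ i = s * x $ i - \<xi> $ i"
          using nz unfolding \<phi>_def by (simp add: field_simps)
        then show "(\<phi> w \<cdot>\<^sub>v x) $ i = (A *\<^sub>v x + B *\<^sub>v v) $ i"
          using 1[OF i] i x A B by (simp del: index_mult_mat_vec)
      qed (use x B in simp)
      then show "F (\<phi> w) *\<^sub>v v = disc.out \<xi> v"
        unfolding out_eq[OF \<xi> v] x_def[symmetric] by (rule realization_mult_vec[OF R d v x])
    qed
  qed
  then obtain P where P: "P \<in> pd_mats n" and lmi: "\<And>x u. x \<in> carrier_vec n \<Longrightarrow> u \<in> carrier_vec m \<Longrightarrow>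
     energy P (disc.step x u) \<le> energy P x + supply_rate a b c u (disc.out x u)" by blast
  have Pc: "P \<in> carrier_mat n n" using P by (auto simp: pd_mats_def)
  show ?thesis
  \<comment> \<open>The factor comes from the polarization identity
      \<open>V (\<sigma> x + x') - V (\<sigma> x - x') = 4 \<sigma> Re (x\<^sup>* P x')\<close>.\<close>
  proof (intro bexI[of _ "of_real (2 * \<sigma>) \<cdot>\<^sub>m P"] ballI)
    show "of_real (2 * \<sigma>) \<cdot>\<^sub>m P \<in> pd_mats n" using \<sigma> by (intro pd_mats_smult(1)[OF P]) simp
    fix x u :: "complex vec" assume x: "x \<in> carrier_vec n" and u: "u \<in> carrier_vec m"
    define x' where "x' = A *\<^sub>v x + B *\<^sub>v u"
    have Ax: "A *\<^sub>v x \<in> carrier_vec n" and Bu: "B *\<^sub>v u \<in> carrier_vec n" using A B x u by auto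
    then have x': "x' \<in> carrier_vec n" by (simp add: x'_def)
    define \<xi> where "\<xi> = s \<cdot>\<^sub>v x - x'"
    have \<xi>: "\<xi> \<in> carrier_vec n" using x x' by (simp add: \<xi>_def)
    have "\<xi> + B *\<^sub>v u = resolvent_mat n A s *\<^sub>v x"
      unfolding resolvent_mat_mult_vec[OF A x] \<xi>_def x'_def using x A B
      by (intro eq_vecI) (auto simp del: index_mult_mat_vec)
    then have Nx: "N *\<^sub>v (\<xi> + B *\<^sub>v u) = x" using assoc_mult_mat_vec[OF N M x] inv x by simp
    have st: "disc.step \<xi> u = s \<cdot>\<^sub>v x + x'"
      unfolding step_eq[OF \<xi> u] Nx unfolding \<xi>_def using x x' by (intro eq_vecI) (auto simp: algebra_simps)
    have ot: "disc.out \<xi> u = C *\<^sub>v x + D *\<^sub>v u" unfolding out_eq[OF \<xi> u] Nx ..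
    have Px': "P *\<^sub>v x' \<in> carrier_vec n" using Pc x' by simp
    have "2 * Re (((of_real (2 * \<sigma>) \<cdot>\<^sub>m P) *\<^sub>v x') \<bullet>c x) = 4 * (\<sigma> * Re ((P *\<^sub>v x') \<bullet>c x))"
      using \<sigma> pd_mats_smult(2)[OF P _ x' x, of "2 * \<sigma>"] by simp
    also have "\<sigma> * Re ((P *\<^sub>v x') \<bullet>c x) = Re ((P *\<^sub>v x') \<bullet>c (s \<cdot>\<^sub>v x))"
      using Px' x by (simp add: conjugate_smult_vec s_def)
    also have "4 * \<dots> = energy P (s \<cdot>\<^sub>v x + x') - energy P \<xi>"
      unfolding \<xi>_def using x by (intro quadratic_form_polarization[OF P _ x', symmetric]) simp
    also have "\<dots> \<le> supply_rate a b c u (C *\<^sub>v x + D *\<^sub>v u)"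
      using lmi[OF \<xi> u] unfolding st ot by linarith
    finally show "2 * Re (((of_real (2 * \<sigma>) \<cdot>\<^sub>m P) *\<^sub>v (A *\<^sub>v x + B *\<^sub>v u)) \<bullet>c x)
        \<le> supply_rate a b c u (C *\<^sub>v x + D *\<^sub>v u)" unfolding x'_def .
  qed
qed

section \<open>The four equivalences\<close>

lemma real_classes_iff_supply:
  assumes F: "real_rational_mat m F"
  shows "F \<in> Positive_Real m \<longleftrightarrow> mat_analytic_on m F right_half_plane \<and>
      (\<forall>z \<in> right_half_plane. \<forall>v \<in> carrier_vec m. 0 \<le> supply_rate 0 1 0 v (F z *\<^sub>v v))"
    and "F \<in> Bounded_Real m \<longleftrightarrow> mat_analytic_on m F right_half_plane \<and>
      (\<forall>z \<in> right_half_plane. \<forall>v \<in> carrier_vec m. 0 \<le> supply_rate 1 0 1 v (F z *\<^sub>v v))"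
    and "F \<in> Discrete_Positive_Real m \<longleftrightarrow> mat_analytic_on m F disc_exterior \<and>
      (\<forall>z \<in> disc_exterior. \<forall>v \<in> carrier_vec m. 0 \<le> supply_rate 0 1 0 v (F z *\<^sub>v v))"
    and "F \<in> Discrete_Bounded_Real m \<longleftrightarrow> mat_analytic_on m F disc_exterior \<and>
      (\<forall>z \<in> disc_exterior. \<forall>v \<in> carrier_vec m. 0 \<le> supply_rate 1 0 1 v (F z *\<^sub>v v))"
  using F by (simp_all add: Positive_Real_def Bounded_Real_def Discrete_Positive_Real_def
      Discrete_Bounded_Real_def real_rational_mat_def L_bar_iff_supply S_bar_iff_supply)

theorem theorem4p5:
  fixes n m :: nat
    and F :: "complex \<Rightarrow> complex mat"
    and A B C D R\<^sub>F :: "complex mat"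
  assumes "real_rational_mat m F"
    and "is_realization n m F A B C D"
    and "R\<^sub>F = four_block_mat A B C D"
  shows
    "(quadratic_condition n m W_alpha R\<^sub>F \<longrightarrow> F \<in> Positive_Real m) \<and>
     (quadratic_condition n m W_beta R\<^sub>F \<longrightarrow> F \<in> Bounded_Real m) \<and>
     (quadratic_condition n m W_gamma R\<^sub>F \<longrightarrow> F \<in> Discrete_Positive_Real m) \<and>
     (quadratic_condition n m W_delta R\<^sub>F \<longrightarrow> F \<in> Discrete_Bounded_Real m) \<and>
     (n = mcmillan_degree m F \<longrightarrow>
       (F \<in> Positive_Real m \<longrightarrow> quadratic_condition n m W_alpha R\<^sub>F) \<and>
       (F \<in> Bounded_Real m \<longrightarrow> quadratic_condition n m W_beta R\<^sub>F) \<and>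
       (F \<in> Discrete_Positive_Real m \<longrightarrow> quadratic_condition n m W_gamma R\<^sub>F) \<and>
       (F \<in> Discrete_Bounded_Real m \<longrightarrow> quadratic_condition n m W_delta R\<^sub>F))"
proof -
  note F = assms(1) and R = assms(2)
  interpret linear_system n m A B C D using R by (simp add: is_realization_iff)
  note conds = quadratic_condition_iff[folded assms(3), unfolded step_def out_def]
  note classes = real_classes_iff_supply[OF F]
  have "F \<in> Positive_Real m" if q: "quadratic_condition n m W_alpha R\<^sub>F"
  proof -
    obtain P where P: "P \<in> pd_mats n" and lmi: "\<And>x u. x \<in> carrier_vec n \<Longrightarrow> u \<in> carrier_vec m \<Longrightarrow>
        2 * Re ((P *\<^sub>v (A *\<^sub>v x + B *\<^sub>v u)) \<bullet>c x) \<le> supply_rate 0 1 0 u (C *\<^sub>v x + D *\<^sub>v u)"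
      using q unfolding conds(1) by blast
    show ?thesis
      unfolding classes(1) using continuous_sufficiency[OF R _ P lmi] by simp
  qed
  moreover have "F \<in> Bounded_Real m" if q: "quadratic_condition n m W_beta R\<^sub>F"
  proof -
    obtain P where P: "P \<in> pd_mats n" and lmi: "\<And>x u. x \<in> carrier_vec n \<Longrightarrow> u \<in> carrier_vec m \<Longrightarrow>
        2 * Re ((P *\<^sub>v (A *\<^sub>v x + B *\<^sub>v u)) \<bullet>c x) \<le> supply_rate 1 0 1 u (C *\<^sub>v x + D *\<^sub>v u)"
      using q unfolding conds(2) by blast
    show ?thesis
      unfolding classes(2) using continuous_sufficiency[OF R _ P lmi] by simp
  qed
  moreover have "F \<in> Discrete_Positive_Real m" if q: "quadratic_condition n m W_gamma R\<^sub>F"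
  proof -
    obtain P where P: "P \<in> pd_mats n" and lmi: "\<And>x u. x \<in> carrier_vec n \<Longrightarrow> u \<in> carrier_vec m \<Longrightarrow>
        energy P (A *\<^sub>v x + B *\<^sub>v u) \<le> energy P x + supply_rate 0 1 0 u (C *\<^sub>v x + D *\<^sub>v u)"
      using q unfolding conds(3) by blast
    show ?thesis
      unfolding classes(3) using discrete_sufficiency[OF R _ P lmi] by simp
  qed
  moreover have "F \<in> Discrete_Bounded_Real m" if q: "quadratic_condition n m W_delta R\<^sub>F"
  proof -
    obtain P where P: "P \<in> pd_mats n" and lmi: "\<And>x u. x \<in> carrier_vec n \<Longrightarrow> u \<in> carrier_vec m \<Longrightarrow>
        energy P (A *\<^sub>v x + B *\<^sub>v u) \<le> energy P x + supply_rate 1 0 1 u (C *\<^sub>v x + D *\<^sub>v u)"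
      using q unfolding conds(4) by blast
    show ?thesis
      unfolding classes(4) using discrete_sufficiency[OF R _ P lmi] by simp
  qed
  moreover have "F \<in> Positive_Real m \<Longrightarrow> quadratic_condition n m W_alpha R\<^sub>F" if min: "n = mcmillan_degree m F"
    unfolding conds(1) classes(1)
    by (rule continuous_necessity[OF F R min]) (auto intro: positive_supply_extractable)
  moreover have "F \<in> Bounded_Real m \<Longrightarrow> quadratic_condition n m W_beta R\<^sub>F" if min: "n = mcmillan_degree m F"
    unfolding conds(2) classes(2)
    by (rule continuous_necessity[OF F R min]) (auto intro: bounded_supply_extractable)
  moreover have "F \<in> Discrete_Positive_Real m \<Longrightarrow> quadratic_condition n m W_gamma R\<^sub>F" if min: "n = mcmillan_degree m F"
    unfolding conds(3) classes(3)
    by (rule discrete_necessity[OF F R min]) (auto intro: positive_supply_extractable)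
  moreover have "F \<in> Discrete_Bounded_Real m \<Longrightarrow> quadratic_condition n m W_delta R\<^sub>F" if min: "n = mcmillan_degree m F"
    unfolding conds(4) classes(4)
    by (rule discrete_necessity[OF F R min]) (auto intro: bounded_supply_extractable)
  ultimately show ?thesis by simp
qed

end
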